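(* Let $\Omega\subset\mathbb{R}^n$ be open and nonempty and let $P(D)=\sum_{|\alpha|\le m}a_\alpha D^\alpha$ be a partial differential operator with constant generalized coefficients $a_\alpha\in\widetilde{\mathbb{C}}$. Then the solvability property $$\forall f\in\mathcal{G}_{\mathrm c}(\Omega)\ \exists u\in\mathcal{G}(\Omega):\quad P(D)u=f$$ holds if and only if $\widetilde{P}^2$ is invertible at some point of $\mathbb{R}^n$, i.e. $\widetilde{P}^2(\xi_0)$ is invertible in the ring of generalized numbers for some $\xi_0\in\mathbb{R}^n$.
   Context: Colombeau algebra: for $\Omega\subset\mathbb{R}^n$ open, $\mathcal{E}_{\mathrm M}(\Omega)$ is the set of nets $(u_\varepsilon)_{\varepsilon\in(0,1]}$ in $C^\infty(\Omega)$ such that for every compact $K\subset\Omega$ and $\alpha\in\mathbb{N}_0^n$ there is $p\ge0$ with $\sup_{K}|\partial^\alpha u_\varepsilon|=O(\varepsilon^{-p})$ as $\varepsilon\to0$; $\mathcal{N}(\Omega)$ is the set of nets such that for all $K,\alpha$ and all $q\ge0$, $\sup_{K}|\partial^\alpha u_\varepsilon|=O(\varepsilon^{q})$. $\mathcal{G}(\Omega)=\mathcal{E}_{\mathrm M}(\Omega)/\mathcal{N}(\Omega)$, with operations on representatives; $\Omega\mapsto\mathcal{G}(\Omega)$ is a sheaf, so supports are defined, and $\mathcal{G}_{\mathrm c}(\Omega)$ is the subalgebra of elements with compact support in $\Omega$. $\widetilde{\mathbb{C}}$: nets $(c_\varepsilon)_{\varepsilon\in(0,1]}$ in $\mathbb{C}$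 with $|c_\varepsilon|=O(\varepsilon^{-p})$ for some $p$, modulo those with $|c_\varepsilon|=O(\varepsilon^q)$ for all $q$; it is a commutative ring. $D=(-i\partial_1,\dots,-i\partial_n)$. With representatives $(a_\alpha^\varepsilon)_\varepsilon$ of the coefficients, $P_\varepsilon(\xi)=\sum_{|\alpha|\le m}a^\varepsilon_\alpha\xi^\alpha$. Associated weight function: $\widetilde{P}^2\in\mathcal{G}(\mathbb{R}^n)$ is the class of $\widetilde{P}^2_\varepsilon(\xi)=\sum_{|\alpha|\le m}|\partial_\xi^\alpha P_\varepsilon(\xi)|^2$, and $\widetilde{P}^2(\xi_0)$ is the class of $(\widetilde{P}^2_\varepsilon(\xi_0))_\varepsilon$. *)

theory Defs
  imports
    "HOL-Analysis.Analysis"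
    "HOL-Algebra.QuotRing"
    "HOL-Library.Landau_Symbols"
begin

section \<open>Multi-indices and iterated partial derivatives\<close>

type_synonym 'n multiindex = "'n \<Rightarrow> nat"

definition mi_size :: "'n::finite multiindex \<Rightarrow> nat" where
  "mi_size \<alpha> = (\<Sum>i\<in>UNIV. \<alpha> i)"

lemma finite_mi_size_le: "finite {\<alpha> :: 'n::finite multiindex. mi_size \<alpha> \<le> m}"
proof (rule finite_subset)
  show "{\<alpha> :: 'n multiindex. mi_size \<alpha> \<le> m} \<subseteq> Pi\<^sub>E UNIV (\<lambda>_. {..m})"
  proof
    fix \<alpha> :: "'n multiindex"
    assume "\<alpha> \<in> {\<alpha>. mi_size \<alpha> \<le> m}"
    then have "\<alpha> i \<le> m" for i
      using member_le_sum[of i UNIV \<alpha>] by (simp add: mi_size_def)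
    then show "\<alpha> \<in> Pi\<^sub>E UNIV (\<lambda>_. {..m})" by auto
  qed
  show "finite (Pi\<^sub>E (UNIV :: 'n set) (\<lambda>_. {..m}))" by (intro finite_PiE) auto
qed

definition mi_power :: "real ^ 'n \<Rightarrow> 'n::finite multiindex \<Rightarrow> real" where
  "mi_power \<xi> \<alpha> = (\<Prod>i\<in>UNIV. (\<xi> $ i) ^ \<alpha> i)"

definition partial :: "'n::finite \<Rightarrow> (real ^ 'n \<Rightarrow> complex) \<Rightarrow> real ^ 'n \<Rightarrow> complex" where
  "partial i f x = vector_derivative (\<lambda>t. f (x + t *\<^sub>R axis i 1)) (at 0)"

text \<open>
  The index type carries no order, so an arbitrary enumeration of it, fixed once and for all, plays
  the role of \<open>1, \<dots>, n\<close> in \<open>\<partial>\<^sub>1\<^sup>\<alpha>\<^sup>1 \<dots> \<partial>\<^sub>n\<^sup>\<alpha>\<^sup>n\<close>.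
  On smooth functions the partial derivatives commute, so the choice does not matter.
\<close>

definition coord_list :: "'n::finite list" where
  "coord_list = (SOME is. set is = UNIV \<and> distinct is)"

lemma coord_list: "set (coord_list :: 'n::finite list) = UNIV" "distinct (coord_list :: 'n list)"
proof -
  have "\<exists>is :: 'n list. set is = UNIV \<and> distinct is"
    using finite_distinct_list[of "UNIV :: 'n set"] by simp
  from someI_ex[OF this]
  show "set (coord_list :: 'n list) = UNIV" "distinct (coord_list :: 'n list)"
    unfolding coord_list_def by auto
qed

definition mi_deriv ::
    "'n::finite multiindex \<Rightarrow> (real ^ 'n \<Rightarrow> complex) \<Rightarrow> real ^ 'n \<Rightarrow> complex" where
  "mi_deriv \<alpha> f = foldr (\<lambda>i g. (partial i ^^ \<alpha> i) g) coord_list f"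

text \<open>
  The space \<open>C\<^sup>\<infinity>(\<Omega>)\<close> for open \<open>\<Omega>\<close>: all iterated partial derivatives, in any order, exist and are
  differentiable, hence continuous. The values of the function outside \<open>\<Omega>\<close> are irrelevant.
\<close>

definition smooth_on :: "(real ^ 'n::finite) set \<Rightarrow> (real ^ 'n \<Rightarrow> complex) \<Rightarrow> bool" where
  "smooth_on \<Omega> f \<longleftrightarrow> (\<forall>is. foldr partial is f differentiable_on \<Omega>)"


section \<open>The ring of generalized complex numbers\<close>

text \<open>
  Nets indexed by \<open>\<epsilon> \<in> (0,1]\<close> are total functions on the reals whose values outside \<open>(0,1]\<close> are
  unconstrained. Two nets that agree on \<open>(0,1]\<close> differ by a negligible one, so these values are
  not seen by the quotients. The same applies to the values outside \<open>\<Omega>\<close> of nets of functions below.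
\<close>

definition moderate_numbers :: "(real \<Rightarrow> complex) ring" where
  "moderate_numbers =
     \<lparr>carrier = {c. \<exists>p\<ge>0. c \<in> O[at_right 0](\<lambda>\<epsilon>. \<epsilon> powr (-p))},
      monoid.mult = (\<lambda>c d \<epsilon>. c \<epsilon> * d \<epsilon>), one = (\<lambda>_. 1),
      zero = (\<lambda>_. 0), add = (\<lambda>c d \<epsilon>. c \<epsilon> + d \<epsilon>)\<rparr>"

definition negligible_numbers :: "(real \<Rightarrow> complex) set" where
  "negligible_numbers = {c. \<forall>q\<ge>0. c \<in> O[at_right 0](\<lambda>\<epsilon>. \<epsilon> powr q)}"

definition gen_numbers :: "(real \<Rightarrow> complex) set ring" where
  "gen_numbers = moderate_numbers Quot negligible_numbers"

definition number_class :: "(real \<Rightarrow> complex) \<Rightarrow> (real \<Rightarrow> complex) set" where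
  "number_class c = negligible_numbers +>\<^bsub>moderate_numbers\<^esub> c"


section \<open>The Colombeau algebra\<close>

type_synonym 'n net = "real \<Rightarrow> real ^ 'n \<Rightarrow> complex"

text \<open>
  The empty compact set, for which the real supremum is an unspecified number, is left out of the
  two growth conditions.
\<close>

definition moderate_nets :: "(real ^ 'n::finite) set \<Rightarrow> 'n net ring" where
  "moderate_nets \<Omega> =
     \<lparr>carrier = {u. (\<forall>\<epsilon>\<in>{0<..1}. smooth_on \<Omega> (u \<epsilon>)) \<and>
        (\<forall>K \<alpha>. compact K \<and> K \<noteq> {} \<and> K \<subseteq> \<Omega> \<longrightarrow>
           (\<exists>p\<ge>0. (\<lambda>\<epsilon>. SUP x\<in>K. norm (mi_deriv \<alpha> (u \<epsilon>) x)) \<in> O[at_right 0](\<lambda>\<epsilon>. \<epsilon> powr (-p))))},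
      monoid.mult = (\<lambda>u v \<epsilon> x. u \<epsilon> x * v \<epsilon> x), one = (\<lambda>_ _. 1),
      zero = (\<lambda>_ _. 0), add = (\<lambda>u v \<epsilon> x. u \<epsilon> x + v \<epsilon> x)\<rparr>"

definition negligible_nets :: "(real ^ 'n::finite) set \<Rightarrow> 'n net set" where
  "negligible_nets \<Omega> =
     {u. (\<forall>\<epsilon>\<in>{0<..1}. smooth_on \<Omega> (u \<epsilon>)) \<and>
        (\<forall>K \<alpha>. compact K \<and> K \<noteq> {} \<and> K \<subseteq> \<Omega> \<longrightarrow>
           (\<forall>q\<ge>0. (\<lambda>\<epsilon>. SUP x\<in>K. norm (mi_deriv \<alpha> (u \<epsilon>) x)) \<in> O[at_right 0](\<lambda>\<epsilon>. \<epsilon> powr q)))}"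

definition colombeau :: "(real ^ 'n::finite) set \<Rightarrow> 'n net set ring" where
  "colombeau \<Omega> = moderate_nets \<Omega> Quot negligible_nets \<Omega>"

definition net_class :: "(real ^ 'n::finite) set \<Rightarrow> 'n net \<Rightarrow> 'n net set" where
  "net_class \<Omega> u = negligible_nets \<Omega> +>\<^bsub>moderate_nets \<Omega>\<^esub> u"

text \<open>
  Operations on classes are written, as the multiplication of the library's factor ring is, as the
  union over all representatives of the class of the result. As these classes coincide, the union
  is that class.
\<close>

definition restriction :: "(real ^ 'n::finite) set \<Rightarrow> 'n net set \<Rightarrow> 'n net set" where
  "restriction V U = (\<Union>u\<in>U. net_class V u)"

definition point_value :: "'n::finite net set \<Rightarrow> real ^ 'n \<Rightarrow> (real \<Rightarrow> complex) set" where
  "point_value U x = (\<Union>u\<in>U. number_class (\<lambda>\<epsilon>. u \<epsilon> x))"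

definition gen_support :: "(real ^ 'n::finite) set \<Rightarrow> 'n net set \<Rightarrow> (real ^ 'n) set" where
  "gen_support \<Omega> U =
     \<Omega> - \<Union>{V. open V \<and> V \<subseteq> \<Omega> \<and> restriction V U = \<zero>\<^bsub>colombeau V\<^esub>}"

definition colombeau_c :: "(real ^ 'n::finite) set \<Rightarrow> 'n net set set" where
  "colombeau_c \<Omega> = {U \<in> carrier (colombeau \<Omega>). compact (gen_support \<Omega> U)}"


section \<open>Differential operators with generalized constant coefficients\<close>

definition coeff_reps ::
    "nat \<Rightarrow> ('n::finite multiindex \<Rightarrow> (real \<Rightarrow> complex) set) \<Rightarrow>
     ('n multiindex \<Rightarrow> real \<Rightarrow> complex) set" where
  "coeff_reps m A = {a. \<forall>\<alpha>. mi_size \<alpha> \<le> m \<longrightarrow> a \<alpha> \<in> A \<alpha>}"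

text \<open>The factor \<open>(-\<i>)\<^sup>|\<^sup>\<alpha>\<^sup>|\<close> comes from \<open>D = (-\<i>\<partial>\<^sub>1, \<dots>, -\<i>\<partial>\<^sub>n)\<close>.\<close>

definition diff_op_net ::
    "nat \<Rightarrow> ('n::finite multiindex \<Rightarrow> real \<Rightarrow> complex) \<Rightarrow> 'n net \<Rightarrow> 'n net" where
  "diff_op_net m a u =
     (\<lambda>\<epsilon> x. \<Sum>\<alpha> | mi_size \<alpha> \<le> m. a \<alpha> \<epsilon> * ((- \<i>) ^ mi_size \<alpha> * mi_deriv \<alpha> (u \<epsilon>) x))"

definition diff_op ::
    "(real ^ 'n::finite) set \<Rightarrow> nat \<Rightarrow> ('n multiindex \<Rightarrow> (real \<Rightarrow> complex) set) \<Rightarrow>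
     'n net set \<Rightarrow> 'n net set" where
  "diff_op \<Omega> m A U = (\<Union>a\<in>coeff_reps m A. \<Union>u\<in>U. net_class \<Omega> (diff_op_net m a u))"

definition symbol_net ::
    "nat \<Rightarrow> ('n::finite multiindex \<Rightarrow> real \<Rightarrow> complex) \<Rightarrow> 'n net" where
  "symbol_net m a = (\<lambda>\<epsilon> \<xi>. \<Sum>\<alpha> | mi_size \<alpha> \<le> m. a \<alpha> \<epsilon> * of_real (mi_power \<xi> \<alpha>))"

definition weight_sq_net ::
    "nat \<Rightarrow> ('n::finite multiindex \<Rightarrow> real \<Rightarrow> complex) \<Rightarrow> 'n net" where
  "weight_sq_net m a =
     (\<lambda>\<epsilon> \<xi>. of_real (\<Sum>\<alpha> | mi_size \<alpha> \<le> m. (norm (mi_deriv \<alpha> (symbol_net m a \<epsilon>) \<xi>))\<^sup>2))"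

definition weight_sq ::
    "nat \<Rightarrow> ('n::finite multiindex \<Rightarrow> (real \<Rightarrow> complex) set) \<Rightarrow> 'n net set" where
  "weight_sq m A = (\<Union>a\<in>coeff_reps m A. net_class UNIV (weight_sq_net m a))"

end

theory Submission
  imports Defs
begin

text \<open>
  By Taylor's formula, the weight is invertible at some point if and only if
  \<open>max\<^sub>\<alpha> |a\<^sub>\<alpha>\<^sup>\<epsilon>| \<ge> \<epsilon>\<^sup>N\<close> for some \<open>N\<close> and all small \<open>\<epsilon>\<close>. If the equation is solvable for a bump function
  that is 1 at a point, then there \<open>1/2 \<le> |P\<^sub>\<epsilon>(D)u\<^sub>\<epsilon>| \<le> \<Sum> |a\<^sub>\<alpha>\<^sup>\<epsilon>| |\<partial>\<^sup>\<alpha> u\<^sub>\<epsilon>|\<close> for small \<open>\<epsilon>\<close>, and moderateness of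
  \<open>u\<close> gives the lower bound.

  Conversely, \<open>f\<close> has a representative supported in a fixed compact set. Expand \<open>f\<^sub>\<epsilon>\<close> into a Fourier
  series with frequencies \<open>\<theta> + \<epsilon>k\<close>, \<open>k \<in> \<int>\<^sup>n\<close>, on a cube of side \<open>2\<pi>/\<epsilon>\<close>, and divide the coefficients by
  \<open>P\<^sub>\<epsilon>(\<theta> + \<epsilon>k)\<close>. The shift \<open>\<theta> \<in> [0,1]\<^sup>n\<close>, which depends on \<open>\<epsilon>\<close>, can be chosen with
  \<open>|P\<^sub>\<epsilon>(\<theta> + \<epsilon>k)| \<ge> c max\<^sub>\<alpha> |a\<^sub>\<alpha>\<^sup>\<epsilon>| \<Prod>\<^sub>i (1 + |k\<^sub>i|)\<^bsup>-M\<^esup>\<close> for all \<open>k\<close>, because the sets of bad shifts have small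
  measure on a curve \<open>\<theta>\<^sub>i = t\<^bsup>e\<^sub>i\<^esup>\<close> along which the monomials of \<open>P\<^sub>\<epsilon>\<close> stay distinct. The solution
  obtained is moderate, and the cubes exhaust \<open>\<real>\<^sup>n\<close> as \<open>\<epsilon> \<rightarrow> 0\<close>, so that \<open>P\<^sub>\<epsilon>(D)u\<^sub>\<epsilon> = f\<^sub>\<epsilon>\<close> near every compact
  set for small \<open>\<epsilon>\<close>.
\<close>


section \<open>Lattice shifts avoiding the zeros of a polynomial\<close>

text \<open>What shapes the proof is uniformity in \<epsilon>. Invertibility of the weight says only
  that for each small \<epsilon> some coefficient is at least a power of \<epsilon>; which one may
  change with \<epsilon>, and the leading coefficients may vanish. So no constant may depend on the
  coefficients, and every bound is stated in terms of one coefficient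
  \<open>a \<alpha>\<^sub>0\<close> that is chosen afresh for each \<epsilon>. The lower bound at
  the lattice frequencies is of Remez type: a polynomial with one coefficient that is not small can
  itself be small only on a few short intervals. At frequency \<open>k\<close> intervals of length
  about \<open>1 / W\<^sup>2\<close> are allowed, with \<open>W = lattice_weight k\<close>; these
  lengths are summable over the lattice, so some parameter escapes all of them. The price is a power
  of \<open>W\<close>, which the rapid decay of the Fourier coefficients of smooth data absorbs. The
  lattice spacing \<epsilon> costs further powers of \<open>1 / \<epsilon>\<close>, which
  moderateness tolerates.\<close>

text \<open>Induction on the degree bound, dividing out one node: \<open>q = (X - x0) r + c\<close>
  with \<open>c = q(x0)\<close>. At the other nodes \<open>r\<close> is at most
  \<open>2 * \<delta> / s\<close> because they are separated from \<open>x0\<close>, and the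
  coefficients of \<open>q\<close> are recovered from those of \<open>r\<close> and from
  \<open>c\<close>.\<close>

lemma norm_coeff_le_of_separated:
  fixes q :: "complex poly" and T :: "real set"
  assumes "degree q \<le> D" "finite T" "card T = Suc D" "T \<subseteq> {0..1}"
    and "\<And>x y. x \<in> T \<Longrightarrow> y \<in> T \<Longrightarrow> x \<noteq> y \<Longrightarrow> s \<le> \<bar>x - y\<bar>" and s: "0 < s" "s \<le> 1"
    and "\<And>x. x \<in> T \<Longrightarrow> norm (poly q (of_real x)) \<le> \<delta>"
  shows "norm (coeff q j) \<le> (5 / s) ^ D * \<delta>"
  using assms(1-5,8)
proof (induction D arbitrary: q T \<delta> j)
  case 0
  then obtain x where x: "x \<in> T" by (metis card_eq_SucD insertI1)
  obtain a where "q = [:a:]" using 0 by (metis degree_eq_zeroE le_zero_eq)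
  then have "poly q (of_real x) = coeff q 0" by simp
  moreover have "norm (coeff q j) \<le> norm (coeff q 0)"
    using 0(1) by (cases j) (auto simp: coeff_eq_0)
  ultimately show ?case using 0(6)[OF x] by simp
next
  case (Suc D)
  obtain x0 T' where T: "T = insert x0 T'" "x0 \<notin> T'" "card T' = Suc D"
    using Suc.prems(3) card_eq_SucD[of T "Suc D"] by blast
  define r where "r = synthetic_div q (of_real x0)"
  define c where "c = poly q (of_real x0)"
  have q: "q = [:- of_real x0, 1:] * r + [:c:]"
    unfolding r_def c_def by (rule synthetic_div_correct'[symmetric])
  have c: "norm c \<le> \<delta>" using Suc.prems(6) T by (simp add: c_def)
  then have \<delta>: "0 \<le> \<delta>" by (smt (verit) norm_ge_zero)
  have rj: "norm (coeff r i) \<le> (5 / s) ^ D * (2 * \<delta> / s)" for i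
  proof (rule Suc.IH[of r T'])
    show "degree r \<le> D" using Suc.prems(1) by (simp add: r_def degree_synthetic_div)
    show "finite T'" "card T' = Suc D" "T' \<subseteq> {0..1}" using T Suc.prems by auto
    show "s \<le> \<bar>x - y\<bar>" if "x \<in> T'" "y \<in> T'" "x \<noteq> y" for x y
      using that Suc.prems(5) T by auto
    fix x assume x: "x \<in> T'"
    have sx: "s \<le> \<bar>x - x0\<bar>" using x T Suc.prems(5)[of x x0] by auto
    have "poly q (of_real x) - c = of_real (x - x0) * poly r (of_real x)"
      by (subst q) (simp add: algebra_simps)
    then have "norm (of_real (x - x0) * poly r (of_real x)) = norm (poly q (of_real x) - c)"
      by presburger
    also have "\<dots> \<le> \<delta> + \<delta>"
      using norm_triangle_ineq4[of "poly q (of_real x)" c] Suc.prems(6)[of x] x T c by auto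
    finally have "\<bar>x - x0\<bar> * norm (poly r (of_real x)) \<le> 2 * \<delta>"
      by (simp add: norm_mult del: of_real_diff)
    then have "s * norm (poly r (of_real x)) \<le> 2 * \<delta>"
      using sx mult_right_mono[OF sx norm_ge_zero[of "poly r (of_real x)"]] by linarith
    then show "norm (poly r (of_real x)) \<le> 2 * \<delta> / s"
      using s by (simp add: field_simps)
  qed
  have x01: "norm (complex_of_real x0) \<le> 1" using Suc.prems(4) T by auto
  \<comment> \<open>The induction hypothesis bounds the coefficients of \<open>r\<close> by
    \<open>2 * b\<close>. A coefficient of \<open>q\<close> combines two of them with factors at
    most 1, or one of them and \<open>c\<close>; so it is at most \<open>4 * b\<close> or
    \<open>2 * b + \<delta>\<close>, both within \<open>5 * b\<close>.\<close>
  define b where "b = (5 / s) ^ D * (\<delta> / s)"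
  have b: "\<delta> \<le> b"
  proof -
    have "1 * (\<delta> * 1) \<le> (5 / s) ^ D * (\<delta> * (1 / s))"
      using s \<delta> by (intro mult_mono one_le_power) (auto simp: field_simps)
    then show ?thesis by (simp add: b_def)
  qed
  have rj': "norm (coeff r i) \<le> 2 * b" for i using rj[of i] by (simp add: b_def mult_ac)
  have rx: "norm (of_real x0 * coeff r i) \<le> 2 * b" for i
    using mult_mono[OF x01 rj'[of i]] by (simp add: norm_mult)
  have "norm (coeff q j) \<le> 5 * b"
  proof (cases j)
    case 0
    have "coeff q j = c - of_real x0 * coeff r 0" by (subst q) (simp add: 0)
    then show ?thesis using norm_triangle_ineq4[of c "of_real x0 * coeff r 0"] rx[of 0] b c \<delta> by simp
  next
    case (Suc i)
    have "coeff q j = coeff r i - of_real x0 * coeff r j" by (subst q) (simp add: Suc)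
    then show ?thesis using norm_triangle_ineq4[of "coeff r i" "of_real x0 * coeff r j"]
        rx[of j] rj'[of i] b \<delta> by simp
  qed
  then show ?case by (simp add: b_def)
qed

text \<open>A maximal \<open>s\<close>-separated subset of the sublevel set has at most
  \<open>D\<close> points, since \<open>D + 1\<close> of them would contradict \<open>big\<close> by
  the interpolation bound. By maximality the intervals of radius \<open>s\<close> around its points
  cover the set.\<close>

lemma sublevel_set_cover:
  fixes q :: "complex poly"
  assumes "degree q \<le> D" "0 < s" "s \<le> 1" and big: "(5 / s) ^ D * \<delta> < norm (coeff q j)"
  obtains F where "finite F" "card F \<le> D"
    "{t \<in> {0..1}. norm (poly q (of_real t)) \<le> \<delta>} \<subseteq> (\<Union>x\<in>F. {x - s..x + s})"
proof -
  define S where "S = {t \<in> {0..1}. norm (poly q (of_real t)) \<le> \<delta>}"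
  define sep where "sep F \<longleftrightarrow> finite F \<and> F \<subseteq> S \<and> (\<forall>x\<in>F. \<forall>y\<in>F. x \<noteq> y \<longrightarrow> s \<le> \<bar>x - y\<bar>)" for F
  have card: "card F \<le> D" if "sep F" for F
  proof (rule ccontr)
    assume "\<not> card F \<le> D"
    then obtain T where T: "T \<subseteq> F" "card T = Suc D" "finite T"
      by (metis Suc_le_eq not_le obtain_subset_with_card_n)
    have "norm (coeff q j) \<le> (5 / s) ^ D * \<delta>"
      using T that assms(1-3)
      by (intro norm_coeff_le_of_separated[of q D T s]) (auto simp: sep_def S_def subset_iff)
    with big show False by simp
  qed
  have "sep {}" by (simp add: sep_def)
  with card obtain F where F: "sep F" "\<And>G. sep G \<Longrightarrow> card G \<le> card F"
    using ex_has_greatest_nat[of sep "{}" card "Suc D"] by (metis le_imp_less_Suc)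
  have "S \<subseteq> (\<Union>x\<in>F. {x - s..x + s})"
  proof (rule ccontr)
    assume "\<not> ?thesis"
    then obtain t where t: "t \<in> S" "\<And>x. x \<in> F \<Longrightarrow> t \<notin> {x - s..x + s}" by blast
    have "t \<notin> F" using t(2)[of t] assms(2) by auto
    moreover have "sep (insert t F)" unfolding sep_def
    proof (intro conjI ballI impI)
      show "finite (insert t F)" "insert t F \<subseteq> S" using F(1) t by (auto simp: sep_def)
      fix x y assume "x \<in> insert t F" "y \<in> insert t F" "x \<noteq> y"
      moreover have "s \<le> \<bar>t - x\<bar>" "s \<le> \<bar>x - t\<bar>" if "x \<in> F" for x using t(2)[OF that] by auto
      ultimately show "s \<le> \<bar>x - y\<bar>" using F(1) unfolding sep_def by blast
    qed
    ultimately show False using F(2)[of "insert t F"] F(1) by (auto simp: sep_def)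
  qed
  with F(1) card show ?thesis using that[of F] by (auto simp: sep_def S_def)
qed

text \<open>Union bound in Lebesgue measure: the \<open>k\<close>-th sublevel set has measure at
  most \<open>2 * D * s k\<close>, and these numbers sum to less than the length of the unit
  interval.\<close>

lemma common_non_small_point:
  fixes q :: "nat \<Rightarrow> complex poly"
  assumes "\<And>k. degree (q k) \<le> D" "\<And>k. 0 < s k" "\<And>k. s k \<le> 1"
    and "\<And>k. (5 / s k) ^ D * \<delta> k < norm (coeff (q k) (j k))"
    and "summable s" and small: "2 * real D * suminf s < 1"
  shows "\<exists>t\<in>{0..1}. \<forall>k. \<delta> k < norm (poly (q k) (of_real t))"
proof (rule ccontr)
  assume neg: "\<not> ?thesis"
  have "\<forall>k. \<exists>F. finite F \<and> card F \<le> D \<and>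
      {t \<in> {0..1}. norm (poly (q k) (of_real t)) \<le> \<delta> k} \<subseteq> (\<Union>x\<in>F. {x - s k..x + s k})"
  proof
    fix k
    show "\<exists>F. finite F \<and> card F \<le> D \<and>
      {t \<in> {0..1}. norm (poly (q k) (of_real t)) \<le> \<delta> k} \<subseteq> (\<Union>x\<in>F. {x - s k..x + s k})"
      by (rule sublevel_set_cover[OF assms(1-4), of k]) blast
  qed
  from choice[OF this] obtain F where F': "\<forall>k. finite (F k) \<and> card (F k) \<le> D \<and>
      {t \<in> {0..1}. norm (poly (q k) (of_real t)) \<le> \<delta> k} \<subseteq> (\<Union>x\<in>F k. {x - s k..x + s k})"
    by (elim exE)
  then have F: "finite (F k)" "card (F k) \<le> D"
    "{t \<in> {0..1}. norm (poly (q k) (of_real t)) \<le> \<delta> k} \<subseteq> (\<Union>x\<in>F k. {x - s k..x + s k})" for k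
    by blast+
  define B where "B k = (\<Union>x\<in>F k. {x - s k..x + s k})" for k
  have Bm: "B k \<in> sets lborel" for k unfolding B_def using F(1) by auto
  have eB: "emeasure lborel (B k) \<le> ennreal (2 * real D * s k)" for k
  proof -
    have "emeasure lborel (B k) \<le> (\<Sum>x\<in>F k. emeasure lborel {x - s k..x + s k})"
      unfolding B_def by (rule emeasure_subadditive_finite) (auto simp: F)
    also have "\<dots> = (\<Sum>x\<in>F k. ennreal (2 * s k))"
      using assms(2)[of k] by (intro sum.cong) auto
    also have "\<dots> = ennreal (real (card (F k)) * (2 * s k))"
      using assms(2)[of k] by (simp add: ennreal_mult ennreal_of_nat_eq_real_of_nat)
    also have "\<dots> \<le> ennreal (2 * real D * s k)"
      using assms(2)[of k] F(2)[of k] by (intro ennreal_leI) (simp add: mult_right_mono)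
    finally show ?thesis .
  qed
  have "{0..1} \<subseteq> (\<Union>k. B k)"
  proof
    fix t :: real assume "t \<in> {0..1}"
    with neg obtain k where "norm (poly (q k) (of_real t)) \<le> \<delta> k" by (meson not_less)
    with \<open>t \<in> {0..1}\<close> F(3)[of k] have "t \<in> B k" unfolding B_def by blast
    then show "t \<in> (\<Union>k. B k)" by blast
  qed
  then have "emeasure lborel {0..1::real} \<le> emeasure lborel (\<Union>k. B k)"
    using Bm by (intro emeasure_mono) auto
  also have "\<dots> \<le> (\<Sum>k. emeasure lborel (B k))"
    using Bm by (intro emeasure_subadditive_countably) auto
  also have "\<dots> \<le> (\<Sum>k. ennreal (2 * real D * s k))"
    using eB by (intro suminf_le) auto
  also have "\<dots> = ennreal (2 * real D * suminf s)"
    using assms(2,5) by (subst suminf_ennreal2) (auto simp: less_imp_le suminf_mult summable_mult)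
  finally have "1 \<le> ennreal (2 * real D * suminf s)" by simp
  with small show False by (simp add: ennreal_ge_1)
qed

section \<open>Kronecker substitution and the coefficients of shifted polynomials\<close>

text \<open>Mixed radix expansion: the weight \<open>b\<close> of a new index exceeds everything
  that the old indices can contribute, so division by \<open>b\<close> recovers the new entry.
  Substituting \<open>t ^ e i\<close> for the variables thus keeps distinct monomials
  distinct.\<close>

lemma exists_injective_weights:
  fixes I :: "'i set"
  assumes "finite I"
  shows "\<exists>e :: 'i \<Rightarrow> nat. \<forall>f g. (\<forall>i\<in>I. f i \<le> m \<and> g i \<le> m) \<longrightarrow>
    (\<Sum>i\<in>I. e i * f i) = (\<Sum>i\<in>I. e i * g i) \<longrightarrow> (\<forall>i\<in>I. f i = g i)"
  using assms
proof (induction I)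
  case empty
  then show ?case by simp
next
  case (insert x I)
  then obtain e :: "'i \<Rightarrow> nat" where e: "\<forall>f g. (\<forall>i\<in>I. f i \<le> m \<and> g i \<le> m) \<longrightarrow>
    (\<Sum>i\<in>I. e i * f i) = (\<Sum>i\<in>I. e i * g i) \<longrightarrow> (\<forall>i\<in>I. f i = g i)" by (elim exE)
  define b where "b = Suc (\<Sum>i\<in>I. e i * m)"
  define e' where "e' = e(x := b)"
  have sum: "(\<Sum>i\<in>insert x I. e' i * f i) = b * f x + (\<Sum>i\<in>I. e i * f i)" for f
    using insert by (auto simp: e'_def intro!: sum.cong)
  have lt: "(\<Sum>i\<in>I. e i * f i) < b" if "\<forall>i\<in>I. f i \<le> m" for f
    unfolding b_def using that by (auto intro!: sum_mono le_imp_less_Suc)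
  show ?case
  proof (intro exI[of _ e'] allI impI)
    fix f g assume le: "\<forall>i\<in>insert x I. f i \<le> m \<and> g i \<le> m"
      and eq: "(\<Sum>i\<in>insert x I. e' i * f i) = (\<Sum>i\<in>insert x I. e' i * g i)"
    have eq': "b * f x + (\<Sum>i\<in>I. e i * f i) = b * g x + (\<Sum>i\<in>I. e i * g i)"
      using eq by (simp only: sum)
    have L: "(\<Sum>i\<in>I. e i * f i) < b" "(\<Sum>i\<in>I. e i * g i) < b" using le lt by auto
    have "f x = (b * f x + (\<Sum>i\<in>I. e i * f i)) div b" using L by simp
    also have "\<dots> = g x" unfolding eq' using L by simp
    finally have fx: "f x = g x" .
    with eq' have "(\<Sum>i\<in>I. e i * f i) = (\<Sum>i\<in>I. e i * g i)" by simp
    with e le fx show "\<forall>i\<in>insert x I. f i = g i" by blast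
  qed
qed

lemma prod_monom: "(\<Prod>i\<in>I. monom (f i) (g i)) = monom (\<Prod>i\<in>I. f i :: 'a::comm_semiring_1) (\<Sum>i\<in>I. g i)"
  by (induction I rule: infinite_finite_induct) (auto simp: mult_monom)

text \<open>With \<open>t ^ e i\<close> in place of the \<open>i\<close>-th variable the product is
  a shifted monomial; its binomial expansion has one monomial in \<open>t\<close> for each
  \<open>g \<le> \<alpha>\<close>.\<close>

lemma kronecker_expansion:
  fixes c :: "'n::finite \<Rightarrow> complex" and \<alpha> :: "'n multiindex"
  shows "(\<Prod>i\<in>UNIV. (monom 1 (e i) + [:c i:]) ^ \<alpha> i) =
    (\<Sum>g\<in>Pi\<^sub>E UNIV (\<lambda>i. {..\<alpha> i}).
       monom (\<Prod>i\<in>UNIV. of_nat (\<alpha> i choose g i) * c i ^ (\<alpha> i - g i)) (\<Sum>i\<in>UNIV. e i * g i))"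
proof -
  have "(monom 1 (e i) + [:c i:]) ^ \<alpha> i =
      (\<Sum>k\<in>{..\<alpha> i}. monom (of_nat (\<alpha> i choose k) * c i ^ (\<alpha> i - k)) (e i * k))" for i
  proof -
    have "of_nat a * monom 1 (e i) ^ k * [:c i:] ^ l = monom (of_nat a * c i ^ l) (e i * k)" for a k l
    proof -
      have "of_nat a * monom 1 (e i) ^ k * [:c i:] ^ l
          = monom (of_nat a) 0 * (monom 1 (e i * k) * monom (c i ^ l) 0)"
        by (simp add: of_nat_poly monom_power monom_0 poly_const_pow mult_ac)
      then show ?thesis by (simp only: mult_monom) simp
    qed
    then show ?thesis by (subst binomial_ring) simp
  qed
  then show ?thesis by (simp add: prod_sum_PiE prod_monom)
qed

lemma mi_le_size: "\<alpha> i \<le> mi_size (\<alpha> :: 'n::finite multiindex)"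
  using member_le_sum[of i UNIV \<alpha>] by (simp add: mi_size_def)

text \<open>By injectivity of the weights only the term \<open>g = \<beta>\<close> of the expansion
  has this degree in \<open>t\<close>, so a coefficient in one variable is a coefficient of the
  shifted polynomial in \<open>n\<close> variables.\<close>

lemma coeff_kronecker:
  fixes c :: "'n::finite \<Rightarrow> complex" and \<alpha> :: "'n multiindex"
  assumes e: "\<forall>f g. (\<forall>i\<in>UNIV. f i \<le> m \<and> g i \<le> m) \<longrightarrow>
    (\<Sum>i\<in>UNIV. e i * f i) = (\<Sum>i\<in>UNIV. e i * g i) \<longrightarrow> (\<forall>i\<in>UNIV. f i = g i)"
    and "mi_size \<alpha> \<le> m" "mi_size \<beta> \<le> m"
  shows "coeff (\<Prod>i\<in>UNIV. (monom 1 (e i) + [:c i:]) ^ \<alpha> i) (\<Sum>i\<in>UNIV. e i * \<beta> i) =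
    (if \<forall>i. \<beta> i \<le> \<alpha> i then (\<Prod>i\<in>UNIV. of_nat (\<alpha> i choose \<beta> i) * c i ^ (\<alpha> i - \<beta> i)) else 0)"
proof -
  define h where "h g = (\<Prod>i\<in>UNIV. of_nat (\<alpha> i choose g i) * c i ^ (\<alpha> i - g i))" for g
  have iff: "(\<Sum>i\<in>UNIV. e i * g i) = (\<Sum>i\<in>UNIV. e i * \<beta> i) \<longleftrightarrow> g = \<beta>"
    if "g \<in> Pi\<^sub>E UNIV (\<lambda>i. {..\<alpha> i})" for g
  proof
    assume eq: "(\<Sum>i\<in>UNIV. e i * g i) = (\<Sum>i\<in>UNIV. e i * \<beta> i)"
    have "g i \<le> m \<and> \<beta> i \<le> m" for i
    proof -
      have "g i \<le> \<alpha> i" using that by (simp add: PiE_iff)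
      then show ?thesis using mi_le_size[of \<alpha> i] mi_le_size[of \<beta> i] assms(2,3) by linarith
    qed
    with e eq show "g = \<beta>" by blast
  qed simp
  have "coeff (\<Prod>i\<in>UNIV. (monom 1 (e i) + [:c i:]) ^ \<alpha> i) (\<Sum>i\<in>UNIV. e i * \<beta> i) =
     (\<Sum>g\<in>Pi\<^sub>E UNIV (\<lambda>i. {..\<alpha> i}). if g = \<beta> then h g else 0)"
    unfolding kronecker_expansion coeff_sum coeff_monom h_def
    by (intro sum.cong refl if_cong iff)
  also have "\<dots> = (if \<forall>i. \<beta> i \<le> \<alpha> i then h \<beta> else 0)"
    by (subst sum.delta) (auto intro!: finite_PiE simp: PiE_iff)
  finally show ?thesis by (simp add: h_def)
qed

lemma norm_binomial_prod_le:
  fixes c :: "'n::finite \<Rightarrow> complex"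
  assumes "\<And>i. norm (c i) \<le> H" "1 \<le> H" "\<forall>i. \<beta> i \<le> \<alpha> i"
  shows "norm (\<Prod>i\<in>UNIV. of_nat (\<alpha> i choose \<beta> i) * c i ^ (\<alpha> i - \<beta> i))
    \<le> 2 ^ mi_size \<alpha> * H ^ (mi_size \<alpha> - mi_size \<beta>)"
proof -
  have "norm (\<Prod>i\<in>UNIV. of_nat (\<alpha> i choose \<beta> i) * c i ^ (\<alpha> i - \<beta> i))
      \<le> (\<Prod>i\<in>UNIV. 2 ^ \<alpha> i * H ^ (\<alpha> i - \<beta> i))"
    unfolding prod_norm[symmetric]
  proof (intro prod_mono conjI norm_ge_zero)
    fix i
    have "real (\<alpha> i choose \<beta> i) \<le> 2 ^ \<alpha> i"
      by (metis binomial_le_pow2 of_nat_le_iff of_nat_numeral of_nat_power)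
    then show "norm (of_nat (\<alpha> i choose \<beta> i) * c i ^ (\<alpha> i - \<beta> i)) \<le> 2 ^ \<alpha> i * H ^ (\<alpha> i - \<beta> i)"
      using assms by (auto simp: norm_mult norm_power intro!: mult_mono power_mono)
  qed
  also have "\<dots> = 2 ^ mi_size \<alpha> * H ^ (\<Sum>i\<in>UNIV. \<alpha> i - \<beta> i)"
    by (simp add: prod.distrib power_sum mi_size_def)
  also have "(\<Sum>i\<in>UNIV. \<alpha> i - \<beta> i) = mi_size \<alpha> - mi_size \<beta>"
    using assms(3) by (simp add: mi_size_def sum_subtractf_nat)
  finally show ?thesis .
qed

text \<open>
  The index \<open>\<beta>\<close> maximizing \<open>|a\<^sub>\<beta>| L\<^bsup>|\<beta>|\<^esup>\<close> yields a coefficient of the shifted polynomial in which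
  \<open>a\<^sub>\<beta>\<close> dominates the contributions of all larger multi-indices.
\<close>

lemma shifted_coefficient_lower_bound:
  fixes a :: "'n::finite multiindex \<Rightarrow> complex" and c :: "'n \<Rightarrow> complex" and m :: nat and H :: real
  defines "M \<equiv> {\<alpha> :: 'n multiindex. mi_size \<alpha> \<le> m}"
  assumes c: "\<And>i. norm (c i) \<le> H" "1 \<le> H" and \<alpha>\<^sub>0: "mi_size \<alpha>\<^sub>0 \<le> m"
  shows "\<exists>\<beta>\<in>M. norm (a \<alpha>\<^sub>0) / (2 * (2 * real (card M) * 2 ^ m * H) ^ m) \<le>
    norm (\<Sum>\<alpha>\<in>M. a \<alpha> * (if \<forall>i. \<beta> i \<le> \<alpha> i
       then (\<Prod>i\<in>UNIV. of_nat (\<alpha> i choose \<beta> i) * c i ^ (\<alpha> i - \<beta> i)) else 0))"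
proof -
  have fin: "finite M" unfolding M_def by (rule finite_mi_size_le)
  have \<alpha>M: "\<alpha>\<^sub>0 \<in> M" using \<alpha>\<^sub>0 by (simp add: M_def)
  then have cardM: "1 \<le> card M" using fin by (simp add: Suc_le_eq card_gt_0_iff) blast
  \<comment> \<open>The value makes \<open>card M * (2 ^ m * H / L)\<close> equal to 1/2, so that
    all terms other than \<beta> together take away at most half of
    \<open>norm (a \<beta>)\<close>.\<close>
  define L where "L = 2 * real (card M) * 2 ^ m * H"
  have L1: "1 \<le> L"
  proof -
    have "1 * 1 * 1 * 1 \<le> 2 * real (card M) * 2 ^ m * H"
      using cardM c(2) by (intro mult_mono) auto
    then show ?thesis by (simp add: L_def)
  qed
  obtain \<beta> where \<beta>: "\<beta> \<in> M" "\<And>\<alpha>. \<alpha> \<in> M \<Longrightarrow> norm (a \<alpha>) * L ^ mi_size \<alpha> \<le> norm (a \<beta>) * L ^ mi_size \<beta>"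
  proof -
    let ?f = "\<lambda>\<alpha>. norm (a \<alpha>) * L ^ mi_size \<alpha>"
    have "Max (?f ` M) \<in> ?f ` M" using fin \<alpha>M by (intro Max_in) auto
    then obtain \<beta> where "\<beta> \<in> M" "Max (?f ` M) = ?f \<beta>" by blast
    then show thesis using fin by (intro that[of \<beta>]) (auto intro: Max_ge simp flip: \<open>Max (?f ` M) = ?f \<beta>\<close>)
  qed
  define h where "h \<alpha> = (if \<forall>i. \<beta> i \<le> \<alpha> i
       then (\<Prod>i\<in>UNIV. of_nat (\<alpha> i choose \<beta> i) * c i ^ (\<alpha> i - \<beta> i)) else 0)" for \<alpha>
  have h\<beta>: "h \<beta> = 1" by (simp add: h_def)
  have small: "norm (a \<alpha> * h \<alpha>) \<le> norm (a \<beta>) * (2 ^ m * H / L)" if \<alpha>: "\<alpha> \<in> M - {\<beta>}" for \<alpha>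
  proof (cases "\<forall>i. \<beta> i \<le> \<alpha> i")
    case True
    have "mi_size \<beta> < mi_size \<alpha>"
    proof -
      obtain i where "\<beta> i \<noteq> \<alpha> i" using \<alpha> by (metis DiffE ext singletonI)
      then have "\<beta> i < \<alpha> i" using True by (simp add: order_less_le)
      then show ?thesis unfolding mi_size_def using True by (intro sum_strict_mono_ex1) auto
    qed
    \<comment> \<open>Maximality of \<beta> gains one factor \<open>1 / L\<close> for each order by
      which \<alpha> exceeds \<beta>, and the shift costs one factor \<open>H\<close> per order. As
      \<open>H \<le> L\<close>, it is enough to keep one quotient \<open>H / L\<close>.\<close>
    then obtain d where d: "mi_size \<alpha> = mi_size \<beta> + Suc d" by (metis less_imp_Suc_add add_Suc_right)
    have "norm (a \<alpha>) * L ^ mi_size \<alpha> \<le> norm (a \<beta>) * L ^ mi_size \<beta>" using \<beta>(2) \<alpha> by auto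
    then have 1: "norm (a \<alpha>) \<le> norm (a \<beta>) / L ^ Suc d"
      using L1 unfolding d power_add by (simp add: field_simps)
    have "norm (h \<alpha>) \<le> 2 ^ mi_size \<alpha> * H ^ Suc d"
      using norm_binomial_prod_le[OF c True] True by (simp add: h_def d)
    also have "\<dots> \<le> 2 ^ m * H ^ Suc d"
      using \<alpha> c(2) by (intro mult_right_mono power_increasing) (auto simp: M_def)
    finally have 2: "norm (h \<alpha>) \<le> 2 ^ m * H ^ Suc d" .
    have HL: "H \<le> L"
    proof -
      have "1 * 1 * 1 * H \<le> 2 * real (card M) * 2 ^ m * H"
        using cardM c(2) by (intro mult_mono) auto
      then show ?thesis by (simp add: L_def)
    qed
    have "norm (a \<alpha> * h \<alpha>) \<le> norm (a \<beta>) / L ^ Suc d * (2 ^ m * H ^ Suc d)"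
      unfolding norm_mult using 1 2 L1 by (intro mult_mono) auto
    also have "\<dots> = norm (a \<beta>) * (2 ^ m * (H / L)) * (H / L) ^ d"
      by (simp add: power_divide)
    also have "\<dots> \<le> norm (a \<beta>) * (2 ^ m * (H / L)) * 1"
      using HL c(2) L1 by (intro mult_left_mono power_le_one) auto
    finally show ?thesis by simp
  next
    case False
    then have "h \<alpha> = 0" unfolding h_def by (rule if_not_P)
    then show ?thesis using c(2) L1 by simp
  qed
  have half: "card M * (2 ^ m * H / L) = 1 / 2"
    using cardM c(2) by (simp add: L_def)
  have "norm (\<Sum>\<alpha>\<in>M - {\<beta>}. a \<alpha> * h \<alpha>) \<le> card (M - {\<beta>}) * (norm (a \<beta>) * (2 ^ m * H / L))"
    by (rule sum_norm_bound[OF small])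
  also have "\<dots> \<le> card M * (norm (a \<beta>) * (2 ^ m * H / L))"
    using c(2) L1 fin by (intro mult_right_mono) (auto intro: card_mono)
  also have "\<dots> = norm (a \<beta>) / 2"
    using half by (metis mult.left_commute times_divide_eq_right mult.right_neutral)
  finally have rest: "norm (\<Sum>\<alpha>\<in>M - {\<beta>}. a \<alpha> * h \<alpha>) \<le> norm (a \<beta>) / 2" .
  have "(\<Sum>\<alpha>\<in>M. a \<alpha> * h \<alpha>) = a \<beta> + (\<Sum>\<alpha>\<in>M - {\<beta>}. a \<alpha> * h \<alpha>)"
    using fin \<beta>(1) by (subst sum.remove[of M \<beta>]) (auto simp: h\<beta>)
  then have lower: "norm (a \<beta>) / 2 \<le> norm (\<Sum>\<alpha>\<in>M. a \<alpha> * h \<alpha>)"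
    using rest norm_triangle_ineq2[of "a \<beta>" "- (\<Sum>\<alpha>\<in>M - {\<beta>}. a \<alpha> * h \<alpha>)"] by simp
  have "norm (a \<alpha>\<^sub>0) \<le> norm (a \<alpha>\<^sub>0) * L ^ mi_size \<alpha>\<^sub>0"
    using L1 by (simp add: mult_le_cancel_left1 one_le_power)
  also have "\<dots> \<le> norm (a \<beta>) * L ^ mi_size \<beta>" by (rule \<beta>(2)[OF \<alpha>M])
  also have "\<dots> \<le> norm (a \<beta>) * L ^ m"
    using \<beta>(1) L1 by (intro mult_left_mono power_increasing) (auto simp: M_def)
  finally have "norm (a \<alpha>\<^sub>0) / (2 * L ^ m) \<le> norm (a \<beta>) / 2"
    using L1 by (simp add: field_simps)
  with lower \<beta>(1) show ?thesis by (auto simp: h_def L_def intro!: bexI[of _ \<beta>])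
qed

section \<open>Summable weights on the integer lattice and the choice of the shift\<close>

text \<open>The product form, rather than a norm of \<open>k\<close>, lets sums over boxes factor
  into one-dimensional sums, while it still dominates every \<open>1 + |k i|\<close>.\<close>

definition lattice_weight :: "('n::finite \<Rightarrow> int) \<Rightarrow> real" where
  "lattice_weight k = (\<Prod>i\<in>UNIV. 1 + \<bar>real_of_int (k i)\<bar>)"

lemma lattice_weight_ge: "1 + \<bar>real_of_int (k i)\<bar> \<le> lattice_weight (k :: 'n::finite \<Rightarrow> int)"
proof -
  have "(1 + \<bar>real_of_int (k i)\<bar>) * 1 \<le>
    (1 + \<bar>real_of_int (k i)\<bar>) * (\<Prod>j\<in>UNIV - {i}. 1 + \<bar>real_of_int (k j)\<bar>)"
    by (intro mult_left_mono prod_ge_1) auto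
  also have "\<dots> = lattice_weight k" unfolding lattice_weight_def by (subst prod.remove[of UNIV i]) auto
  finally show ?thesis by simp
qed

lemma lattice_weight_ge_1: "1 \<le> lattice_weight (k :: 'n::finite \<Rightarrow> int)"
  unfolding lattice_weight_def by (intro prod_ge_1) auto

text \<open>The subtracted term lets the induction telescope: the two new summands add up to
  \<open>2 / (N + 2)^2\<close>, which is at most \<open>2 / (N + 1) - 2 / (N + 2)\<close>.\<close>

lemma sum_inverse_squares_le: "(\<Sum>j\<in>{-int N..int N}. 1 / (1 + \<bar>real_of_int j\<bar>)\<^sup>2) \<le> 4 - 2 / (real N + 1)"
proof (induction N)
  case (Suc N)
  have "{-int (Suc N)..int (Suc N)} = insert (- int (Suc N)) (insert (int (Suc N)) {-int N..int N})"
    by auto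
  then have "(\<Sum>j\<in>{-int (Suc N)..int (Suc N)}. 1 / (1 + \<bar>real_of_int j\<bar>)\<^sup>2) =
     2 / (real N + 2)\<^sup>2 + (\<Sum>j\<in>{-int N..int N}. 1 / (1 + \<bar>real_of_int j\<bar>)\<^sup>2)"
    by (simp add: add_ac)
  also have "2 / (real N + 2)\<^sup>2 \<le> 2 / (real N + 1) - 2 / (real N + 2)"
    by (simp add: divide_simps power2_eq_square)
  finally show ?case using Suc by (simp add: add_ac)
qed simp

text \<open>A finite set of lattice points lies in a box, and over a box the sum is a product of
  one-dimensional sums, each at most 4.\<close>

lemma summable_lattice_weight:
  "(\<lambda>k :: 'n::finite \<Rightarrow> int. 1 / (lattice_weight k)\<^sup>2) summable_on UNIV"
proof (rule nonneg_bounded_partial_sums_imp_summable_on)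
  show "\<forall>\<^sub>F F in finite_subsets_at_top UNIV. (\<Sum>k\<in>F. 1 / (lattice_weight (k :: 'n \<Rightarrow> int))\<^sup>2) \<le> 4 ^ CARD('n)"
  proof (rule eventually_finite_subsets_at_top_weakI)
    fix F :: "('n \<Rightarrow> int) set" assume F: "finite F"
    define N where "N = Max (insert 0 ((\<lambda>(k, i). nat \<bar>k i\<bar>) ` (F \<times> UNIV)))"
    have N: "\<bar>k i\<bar> \<le> int N" if "k \<in> F" for k i
    proof -
      have "nat \<bar>k i\<bar> \<le> N" unfolding N_def using that F by (intro Max_ge) auto
      then show ?thesis by linarith
    qed
    have "(\<Sum>k\<in>F. 1 / (lattice_weight k)\<^sup>2)
        \<le> (\<Sum>k\<in>Pi\<^sub>E (UNIV :: 'n set) (\<lambda>_. {-int N..int N}). 1 / (lattice_weight k)\<^sup>2)"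
    proof (rule sum_mono2)
      show "F \<subseteq> Pi\<^sub>E UNIV (\<lambda>_. {-int N..int N})"
      proof
        fix k assume "k \<in> F"
        then have "-int N \<le> k i \<and> k i \<le> int N" for i using N[of k i] by linarith
        then show "k \<in> Pi\<^sub>E UNIV (\<lambda>_. {-int N..int N})" by (simp add: PiE_iff)
      qed
    qed (auto intro!: finite_PiE)
    also have "\<dots> = (\<Sum>k\<in>Pi\<^sub>E (UNIV :: 'n set) (\<lambda>_. {-int N..int N}). \<Prod>i\<in>UNIV. 1 / (1 + \<bar>real_of_int (k i)\<bar>)\<^sup>2)"
      by (simp add: lattice_weight_def prod_dividef prod_power_distrib)
    also have "\<dots> = (\<Prod>i\<in>(UNIV :: 'n set). \<Sum>j\<in>{-int N..int N}. 1 / (1 + \<bar>real_of_int j\<bar>)\<^sup>2)"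
      by (rule prod_sum_PiE[symmetric]) auto
    also have "\<dots> \<le> (\<Prod>i\<in>(UNIV :: 'n set). 4)"
    proof (rule prod_mono, intro conjI)
      show "(\<Sum>j\<in>{-int N..int N}. 1 / (1 + \<bar>real_of_int j\<bar>)\<^sup>2) \<le> 4"
        using sum_inverse_squares_le[of N] by (smt (verit) divide_nonneg_nonneg of_nat_0_le_iff)
    qed (auto intro!: sum_nonneg)
    finally show "(\<Sum>k\<in>F. 1 / (lattice_weight k)\<^sup>2) \<le> 4 ^ CARD('n)" by simp
  qed
qed auto

text \<open>Numbering the lattice makes countable subadditivity of the measure and series indexed by
  \<open>nat\<close> applicable.\<close>

lemma lattice_enumeration:
  obtains kk :: "nat \<Rightarrow> 'n::finite \<Rightarrow> int"
  where "bij kk" "summable (\<lambda>j. 1 / (lattice_weight (kk j))\<^sup>2)"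
proof -
  have "infinite (UNIV :: ('n \<Rightarrow> int) set)"
    by (simp add: finite_UNIV_fun infinite_UNIV_int)
  then have "bij_betw (from_nat_into (UNIV :: ('n \<Rightarrow> int) set)) UNIV UNIV"
    by (intro bij_betw_from_nat_into) auto
  moreover from this have "(\<lambda>j. 1 / (lattice_weight (from_nat_into (UNIV :: ('n \<Rightarrow> int) set) j))\<^sup>2) summable_on UNIV"
    using summable_on_reindex_bij_betw[of _ UNIV UNIV "\<lambda>k :: 'n \<Rightarrow> int. 1 / (lattice_weight k)\<^sup>2"]
      summable_lattice_weight by blast
  ultimately show ?thesis
    by (intro that[of "from_nat_into UNIV"]) (auto simp: summable_on_UNIV_nonneg_real_iff)
qed

lemma degree_kronecker_le:
  fixes c :: "'n::finite \<Rightarrow> complex" and \<alpha> :: "'n multiindex"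
  assumes "mi_size \<alpha> \<le> m"
  shows "degree (\<Prod>i\<in>UNIV. (monom 1 (e i) + [:c i:]) ^ \<alpha> i) \<le> m * (\<Sum>i\<in>UNIV. e i)"
proof -
  have "degree (monom 1 (e i) + [:c i:]) \<le> e i" for i
    by (intro degree_add_le) (auto simp: degree_monom_le)
  then have "degree ((monom 1 (e i) + [:c i:]) ^ \<alpha> i) \<le> m * e i" for i
    using degree_power_le[of "monom 1 (e i) + [:c i:]" "\<alpha> i"] mi_le_size[of \<alpha> i] assms
    by (metis (no_types, lifting) le_trans mult.commute mult_le_mono)
  then have "(\<Sum>i\<in>UNIV. degree ((monom 1 (e i) + [:c i:]) ^ \<alpha> i)) \<le> (\<Sum>i\<in>UNIV. m * e i)"
    by (intro sum_mono)
  then show ?thesis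
    using degree_prod_sum_le[of UNIV "\<lambda>i. (monom 1 (e i) + [:c i:]) ^ \<alpha> i"]
    by (simp add: sum_distrib_left)
qed

text \<open>The order of the quantifiers is the point: \<open>c\<close> and \<open>N\<close> depend
  on the order and the dimension only, so the bound can be used for each \<epsilon> separately with
  its own coefficients. The shift may depend on \<open>a\<close>, \<epsilon> and the index, but it
  serves all \<open>k\<close> at once.\<close>

theorem exists_lattice_shift_avoiding_zeros:
  fixes m :: nat
  shows "\<exists>c>0. \<exists>N. \<forall>(a :: 'n::finite multiindex \<Rightarrow> complex) \<epsilon> \<alpha>\<^sub>0.
    0 \<le> \<epsilon> \<longrightarrow> \<epsilon> \<le> 1 \<longrightarrow> mi_size \<alpha>\<^sub>0 \<le> m \<longrightarrow> a \<alpha>\<^sub>0 \<noteq> 0 \<longrightarrow>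
    (\<exists>\<theta> :: 'n \<Rightarrow> real. (\<forall>i. 0 \<le> \<theta> i \<and> \<theta> i \<le> 1) \<and>
      (\<forall>k. c * norm (a \<alpha>\<^sub>0) / lattice_weight k ^ N \<le>
        norm (\<Sum>\<alpha> | mi_size \<alpha> \<le> m. a \<alpha> * of_real (mi_power (\<chi> i. \<theta> i + \<epsilon> * real_of_int (k i)) \<alpha>))))"
proof -
  obtain e :: "'n \<Rightarrow> nat" where e: "\<forall>f g. (\<forall>i\<in>UNIV. f i \<le> m \<and> g i \<le> m) \<longrightarrow>
      (\<Sum>i\<in>UNIV. e i * f i) = (\<Sum>i\<in>UNIV. e i * g i) \<longrightarrow> (\<forall>i\<in>UNIV. f i = g i)"
    using exists_injective_weights[of "UNIV :: 'n set" m, OF finite_class.finite_UNIV] by (elim exE)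
  obtain kk :: "nat \<Rightarrow> 'n \<Rightarrow> int" where kk: "bij kk" "summable (\<lambda>j. 1 / (lattice_weight (kk j))\<^sup>2)"
    by (rule lattice_enumeration)
  define M where "M = {\<alpha> :: 'n multiindex. mi_size \<alpha> \<le> m}"
  have finM: "finite M" unfolding M_def by (rule finite_mi_size_le)
  have "(\<lambda>_. 0) \<in> M" by (simp add: M_def mi_size_def)
  then have cardM: "0 < card M" using finM card_gt_0_iff by blast
  define D where "D = m * (\<Sum>i\<in>UNIV. e i)"
  define S where "S = (\<Sum>j. 1 / (lattice_weight (kk j))\<^sup>2)"
  have S0: "0 \<le> S" unfolding S_def by (intro suminf_nonneg kk) auto
  \<comment> \<open>With \<open>x = 2 * D * S\<close> this gives
    \<open>2 * D * suminf s = x / (x + 2)\<close>, which is below 1 as the union bound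
    requires.\<close>
  define \<sigma> where "\<sigma> = 1 / (2 * real D * S + 2)"
  have \<sigma>: "0 < \<sigma>" "\<sigma> \<le> 1"
  proof -
    define x where "x = 2 * real D * S"
    have "0 \<le> x" using S0 by (simp add: x_def)
    moreover have "\<sigma> = 1 / (x + 2)" by (simp add: \<sigma>_def x_def)
    ultimately show "0 < \<sigma>" "\<sigma> \<le> 1" by (simp_all add: divide_le_eq)
  qed
  define K where "K = 2 * real (card M) * 2 ^ m"
  have K0: "0 < K" using cardM by (simp add: K_def)
  define W where "W j = lattice_weight (kk j)" for j
  have W1: "1 \<le> W j" for j unfolding W_def by (rule lattice_weight_ge_1)
  then have W0: "0 < W j" for j using less_le_trans[OF zero_less_one] by blast
  \<comment> \<open>Radius of the intervals that cover the parameters bad for the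
    \<open>j\<close>-th frequency; the decay like the inverse square of the weight makes the total
    length finite.\<close>
  define s where "s j = \<sigma> / (W j)\<^sup>2" for j
  have s0: "0 < s j" for j unfolding s_def by (intro divide_pos_pos \<sigma>(1) zero_less_power W0)
  have s1: "s j \<le> 1" for j
  proof -
    have "\<sigma> / (W j)\<^sup>2 \<le> 1 / 1" using \<sigma> W1[of j] by (intro frac_le) auto
    then show ?thesis by (simp add: s_def)
  qed
  have ssum: "summable s"
    using summable_mult[OF kk(2), of \<sigma>] by (simp add: s_def[abs_def] W_def)
  have "suminf s = \<sigma> * S"
    using suminf_mult[OF kk(2), of \<sigma>] by (simp add: s_def[abs_def] W_def S_def)
  moreover have "2 * real D * (\<sigma> * S) < 1"
  proof -
    define x where "x = 2 * real D * S"
    have "0 \<le> x" using S0 by (simp add: x_def)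
    then have "x / (x + 2) < 1" by simp
    moreover have "2 * real D * (\<sigma> * S) = x / (x + 2)" by (simp add: \<sigma>_def x_def)
    ultimately show ?thesis by simp
  qed
  ultimately have small: "2 * real D * suminf s < 1" by simp
  \<comment> \<open>This is \<delta> below, freed of \<open>a\<close> and of the weight. The
    exponent \<open>m + 2 * D\<close> of the weight collects \<open>W ^ m\<close> from the shifted
    coefficient and \<open>W ^ (2 * D)\<close> from \<open>s ^ D\<close>.\<close>
  define c where "c = (\<sigma> / 5) ^ D / (4 * K ^ m)"
  have c0: "0 < c" using \<sigma> K0 by (simp add: c_def)
  have "\<exists>\<theta> :: 'n \<Rightarrow> real. (\<forall>i. 0 \<le> \<theta> i \<and> \<theta> i \<le> 1) \<and>
      (\<forall>k. c * norm (a \<alpha>\<^sub>0) / lattice_weight k ^ (m + 2 * D) \<le>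
        norm (\<Sum>\<alpha> | mi_size \<alpha> \<le> m. a \<alpha> * of_real (mi_power (\<chi> i. \<theta> i + \<epsilon> * real_of_int (k i)) \<alpha>)))"
    if \<epsilon>: "0 \<le> \<epsilon>" "\<epsilon> \<le> 1" and \<alpha>\<^sub>0: "mi_size \<alpha>\<^sub>0 \<le> m" "a \<alpha>\<^sub>0 \<noteq> 0"
    for a :: "'n multiindex \<Rightarrow> complex" and \<epsilon> \<alpha>\<^sub>0
  proof -
    \<comment> \<open>The symbol at the \<open>j\<close>-th lattice point, as a polynomial in the
      parameter \<open>t\<close> of the curve of shifts.\<close>
    define q where "q j = (\<Sum>\<alpha>\<in>M. smult (a \<alpha>)
      (\<Prod>i\<in>UNIV. (monom 1 (e i) + [:of_real (\<epsilon> * real_of_int (kk j i)):]) ^ \<alpha> i))" for j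
    define B where "B j = norm (a \<alpha>\<^sub>0) / (2 * (K * W j) ^ m)" for j
    have B0: "0 < B j" for j using \<alpha>\<^sub>0 K0 W0 by (simp add: B_def)
    \<comment> \<open>With this value \<open>(5 / s j) ^ D * \<delta> j\<close> is
      \<open>B j / 2\<close>, hence strictly below some coefficient of \<open>q j\<close>.\<close>
    define \<delta> where "\<delta> j = B j / 2 * (s j / 5) ^ D" for j
    have "\<exists>N. B j \<le> norm (coeff (q j) N)" for j
    proof -
      \<comment> \<open>By \<open>\<epsilon> \<le> 1\<close> the weight bounds the translations
        \<open>\<epsilon> * kk j i\<close>, so it can take the role of \<open>H\<close>.\<close>
      have 1: "norm (complex_of_real (\<epsilon> * real_of_int (kk j i))) \<le> W j" for i
      proof -
        have "\<epsilon> * \<bar>real_of_int (kk j i)\<bar> \<le> 1 * \<bar>real_of_int (kk j i)\<bar>"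
          using \<epsilon> by (intro mult_right_mono) auto
        then show ?thesis using lattice_weight_ge[of "kk j" i] \<epsilon>
          by (simp add: norm_mult W_def del: of_real_mult add: abs_mult)
      qed
      have "\<exists>\<beta>\<in>M. B j \<le> norm (\<Sum>\<alpha>\<in>M. a \<alpha> * (if \<forall>i. \<beta> i \<le> \<alpha> i
       then (\<Prod>i\<in>UNIV. of_nat (\<alpha> i choose \<beta> i) * of_real (\<epsilon> * real_of_int (kk j i)) ^ (\<alpha> i - \<beta> i)) else 0))"
        unfolding M_def B_def K_def by (rule shifted_coefficient_lower_bound[where a = a, OF 1 W1 \<alpha>\<^sub>0(1)])
      then obtain \<beta> where \<beta>: "\<beta> \<in> M" "B j \<le> norm (\<Sum>\<alpha>\<in>M. a \<alpha> * (if \<forall>i. \<beta> i \<le> \<alpha> i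
       then (\<Prod>i\<in>UNIV. of_nat (\<alpha> i choose \<beta> i) * of_real (\<epsilon> * real_of_int (kk j i)) ^ (\<alpha> i - \<beta> i)) else 0))"
        by (elim bexE)
      have "coeff (q j) (\<Sum>i\<in>UNIV. e i * \<beta> i) = (\<Sum>\<alpha>\<in>M. a \<alpha> * (if \<forall>i. \<beta> i \<le> \<alpha> i
       then (\<Prod>i\<in>UNIV. of_nat (\<alpha> i choose \<beta> i) * of_real (\<epsilon> * real_of_int (kk j i)) ^ (\<alpha> i - \<beta> i)) else 0))"
        unfolding q_def coeff_sum coeff_smult
        using \<beta>(1) by (intro sum.cong refl arg_cong2[where f = "(*)"] coeff_kronecker[OF e]) (auto simp: M_def)
      with \<beta>(2) show ?thesis by (intro exI) (erule ssubst)
    qed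
    then have "\<forall>j. \<exists>N. B j \<le> norm (coeff (q j) N)" ..
    from choice[OF this] obtain jj where jj: "\<And>j. B j \<le> norm (coeff (q j) (jj j))" by blast
    have big: "(5 / s j) ^ D * \<delta> j < norm (coeff (q j) (jj j))" for j
    proof -
      have "(5 / s j) ^ D * \<delta> j = B j / 2 * ((5 / s j) * (s j / 5)) ^ D"
        unfolding \<delta>_def power_mult_distrib by simp
      also have "(5 / s j) * (s j / 5) = 1" using s0[of j] by simp
      finally show ?thesis using B0[of j] jj[of j] by simp
    qed
    have deg: "degree (q j) \<le> D" for j
      unfolding q_def
    proof (rule degree_sum_le[OF finM])
      fix \<alpha> assume "\<alpha> \<in> M"
      then show "degree (smult (a \<alpha>) (\<Prod>i\<in>UNIV. (monom 1 (e i) + [:of_real (\<epsilon> * real_of_int (kk j i)):]) ^ \<alpha> i)) \<le> D"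
        unfolding D_def by (intro order_trans[OF degree_smult_le] degree_kronecker_le) (simp add: M_def)
    qed
    obtain t where t: "t \<in> {0..1}" "\<And>j. \<delta> j < norm (poly (q j) (of_real t))"
      using common_non_small_point[OF deg s0 s1 big ssum small] by blast
    define \<theta> where "\<theta> i = t ^ e i" for i
    have "c * norm (a \<alpha>\<^sub>0) / lattice_weight k ^ (m + 2 * D) \<le>
        norm (\<Sum>\<alpha> | mi_size \<alpha> \<le> m. a \<alpha> * of_real (mi_power (\<chi> i. \<theta> i + \<epsilon> * real_of_int (k i)) \<alpha>))" for k
    proof -
      obtain j where j: "k = kk j" using kk(1) by (metis bij_pointE)
      have "poly (q j) (of_real t) = (\<Sum>\<alpha> | mi_size \<alpha> \<le> m. a \<alpha> * of_real (mi_power (\<chi> i. \<theta> i + \<epsilon> * real_of_int (k i)) \<alpha>))"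
        by (simp add: q_def poly_sum poly_prod poly_monom mi_power_def M_def \<theta>_def j)
      moreover have "\<delta> j = c * norm (a \<alpha>\<^sub>0) / lattice_weight k ^ (m + 2 * D)"
        by (simp add: \<delta>_def B_def s_def c_def W_def[symmetric] j power_add power_mult power_mult_distrib power_divide mult_ac)
          (simp add: power_mult[symmetric] mult.commute)
      ultimately show ?thesis using t(2)[of j] by simp
    qed
    moreover have "0 \<le> \<theta> i \<and> \<theta> i \<le> 1" for i using t(1) by (auto simp: \<theta>_def power_le_one)
    ultimately show ?thesis by blast
  qed
  with c0 show ?thesis by blast
qed

section \<open>Calculus of iterated partial derivatives\<close>

lemma partial_has_derivative:
  assumes "(f has_derivative f') (at x)"
  shows "partial i f x = f' (axis i 1)"
proof -
  have "((\<lambda>t. x + t *\<^sub>R axis i (1::real)) has_derivative (\<lambda>t. t *\<^sub>R axis i 1)) (at 0)"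
    by (auto intro!: derivative_eq_intros)
  then have "((\<lambda>t. f (x + t *\<^sub>R axis i 1)) has_derivative (\<lambda>t. f' (t *\<^sub>R axis i 1))) (at 0)"
    by (rule has_derivative_compose) (use assms in simp)
  moreover have "f' (t *\<^sub>R axis i 1) = t *\<^sub>R f' (axis i 1)" for t
    using linear_scale[OF has_derivative_linear[OF assms]] by simp
  ultimately have "((\<lambda>t. f (x + t *\<^sub>R axis i 1)) has_vector_derivative f' (axis i 1)) (at 0)"
    by (simp add: has_vector_derivative_def)
  then show ?thesis unfolding partial_def by (rule vector_derivative_at)
qed

lemma partial_cong:
  assumes "open \<Omega>" "x \<in> \<Omega>" "\<And>y. y \<in> \<Omega> \<Longrightarrow> f y = g y"
  shows "partial i f x = partial i g x"
  unfolding partial_def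
proof (rule vector_derivative_cong_eq)
  have "isCont (\<lambda>t. x + t *\<^sub>R axis i (1::real)) 0" by (intro continuous_intros)
  then have "((\<lambda>t. x + t *\<^sub>R axis i (1::real)) \<longlongrightarrow> x) (nhds 0)"
    using tendsto_at_iff_tendsto_nhds[of "\<lambda>t. x + t *\<^sub>R axis i (1::real)" 0] by (simp add: isCont_def)
  then have "\<forall>\<^sub>F t in nhds 0. x + t *\<^sub>R axis i (1::real) \<in> \<Omega>"
    using assms(1,2) by (rule topological_tendstoD)
  then show "\<forall>\<^sub>F t in nhds 0. t \<in> UNIV \<longrightarrow> f (x + t *\<^sub>R axis i 1) = g (x + t *\<^sub>R axis i 1)"
    by eventually_elim (simp add: assms(3))
qed auto

lemma foldr_partial_cong:
  assumes "open \<Omega>" "x \<in> \<Omega>" "\<And>y. y \<in> \<Omega> \<Longrightarrow> f y = g y"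
  shows "foldr partial is f x = foldr partial is g x"
  using assms(2)
proof (induction "is" arbitrary: x)
  case (Cons i "is")
  show ?case unfolding foldr.simps o_apply
    by (rule partial_cong[OF assms(1) Cons.prems]) (rule Cons.IH)
qed (use assms(3) in simp)

lemma differentiable_on_cong_open:
  assumes "open \<Omega>" "\<And>y. y \<in> \<Omega> \<Longrightarrow> f y = g y" "f differentiable_on \<Omega>"
  shows "g differentiable_on \<Omega>"
  using assms(3) unfolding differentiable_on_def
  by (metis assms(2) differentiable_transform_within zero_less_one)

lemma partial_add:
  assumes "f differentiable (at x)" "g differentiable (at x)"
  shows "partial i (\<lambda>y. f y + g y) x = partial i f x + partial i g x"
proof -
  obtain f' g' where *: "(f has_derivative f') (at x)" "(g has_derivative g') (at x)"
    using assms by (auto simp: differentiable_def)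
  show ?thesis
    by (simp add: partial_has_derivative[OF has_derivative_add[OF *]] partial_has_derivative[OF *(1)]
        partial_has_derivative[OF *(2)])
qed

lemma partial_mult:
  assumes "f differentiable (at x)" "g differentiable (at x)"
  shows "partial i (\<lambda>y. f y * g y) x = partial i f x * g x + f x * partial i g x"
proof -
  obtain f' g' where *: "(f has_derivative f') (at x)" "(g has_derivative g') (at x)"
    using assms by (auto simp: differentiable_def)
  show ?thesis
    by (simp add: partial_has_derivative[OF has_derivative_mult[OF *]] partial_has_derivative[OF *(1)]
        partial_has_derivative[OF *(2)])
qed

lemma partial_const [simp]: "partial i (\<lambda>_. c) = (\<lambda>_. 0)"
  by (rule ext, subst partial_has_derivative[OF has_derivative_const]) simp

lemma foldr_partial_const: "foldr partial is (\<lambda>_. c) = (if is = [] then (\<lambda>_. c) else (\<lambda>_. 0))"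
  by (induction "is") auto

lemma partial_cmult:
  assumes "f differentiable (at x)"
  shows "partial i (\<lambda>y. c * f y) x = c * partial i f x"
  using partial_mult[of "\<lambda>_. c" x f i] assms by simp

lemma partial_sum_list:
  assumes "\<And>p. p \<in> set ps \<Longrightarrow> F p differentiable (at x)"
  shows "partial i (\<lambda>y. \<Sum>p\<leftarrow>ps. F p y) x = (\<Sum>p\<leftarrow>ps. partial i (F p) x) \<and>
    (\<lambda>y. \<Sum>p\<leftarrow>ps. F p y) differentiable (at x)"
  using assms
proof (induction ps)
  case (Cons p ps)
  then show ?case using partial_add[of "F p" x "\<lambda>y. \<Sum>p\<leftarrow>ps. F p y" i] by auto
qed auto

section \<open>Leibniz's rule for lists of directions and its consequences for smoothness\<close>

text \<open>Index set of Leibniz's rule: each pair consists of the directions that fall on the first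
  factor and of those left for the second, in their original order.\<close>

fun splits :: "'a list \<Rightarrow> ('a list \<times> 'a list) list" where
  "splits [] = [([], [])]"
| "splits (i # is) = map (\<lambda>(y, z). (i # y, z)) (splits is) @ map (\<lambda>(y, z). (y, i # z)) (splits is)"

lemma length_splits: "(y, z) \<in> set (splits is) \<Longrightarrow> length y + length z = length is"
  by (induction "is" arbitrary: y z) auto

lemma foldr_partial_mult:
  assumes \<Omega>: "open \<Omega>" "x \<in> \<Omega>"
    and "\<And>ys. length ys < length is \<Longrightarrow> foldr partial ys f differentiable_on \<Omega>"
    and "\<And>ys. length ys < length is \<Longrightarrow> foldr partial ys g differentiable_on \<Omega>"
  shows "foldr partial is (\<lambda>y. f y * g y) x =
    (\<Sum>(ys, zs)\<leftarrow>splits is. foldr partial ys f x * foldr partial zs g x)"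
  using assms(2-)
proof (induction "is" arbitrary: x)
  case (Cons i "is")
  let ?F = "\<lambda>p y. foldr partial (fst p) f y * foldr partial (snd p) g y"
  have d: "foldr partial (fst p) f differentiable (at x)" "foldr partial (snd p) g differentiable (at x)"
    if "p \<in> set (splits is)" for p
  proof -
    have "length (fst p) < length (i # is)" "length (snd p) < length (i # is)"
      using that length_splits[of "fst p" "snd p" "is"] by auto
    then show "foldr partial (fst p) f differentiable (at x)" "foldr partial (snd p) g differentiable (at x)"
      using Cons.prems by (auto simp: differentiable_on_eq_differentiable_at[OF \<Omega>(1)])
  qed
  have "foldr partial (i # is) (\<lambda>y. f y * g y) x = partial i (foldr partial is (\<lambda>y. f y * g y)) x" by simp
  also have "\<dots> = partial i (\<lambda>y. \<Sum>p\<leftarrow>splits is. ?F p y) x"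
    using Cons.prems by (intro partial_cong[OF \<Omega>(1)])
      (auto intro!: Cons.IH[THEN trans] simp: case_prod_unfold)
  also have "\<dots> = (\<Sum>p\<leftarrow>splits is. partial i (?F p) x)"
    using d by (intro partial_sum_list[THEN conjunct1]) auto
  also have "\<dots> = (\<Sum>p\<leftarrow>splits is. partial i (foldr partial (fst p) f) x * foldr partial (snd p) g x
      + foldr partial (fst p) f x * partial i (foldr partial (snd p) g) x)"
    using d by (intro arg_cong[where f = sum_list] map_cong refl partial_mult) auto
  also have "\<dots> = (\<Sum>(ys, zs)\<leftarrow>splits (i # is). foldr partial ys f x * foldr partial zs g x)"
    by (simp add: sum_list_addf o_def case_prod_unfold)
  finally show ?case .
qed auto

text \<open>Stated for a fixed order, with the factors known to be differentiable only up to it: the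
  induction for the reciprocal has no more than that about one of the factors.\<close>

lemma foldr_partial_mult_differentiable:
  assumes \<Omega>: "open \<Omega>"
    and "\<And>ys. length ys \<le> length is \<Longrightarrow> foldr partial ys f differentiable_on \<Omega>"
    and "\<And>ys. length ys \<le> length is \<Longrightarrow> foldr partial ys g differentiable_on \<Omega>"
  shows "foldr partial is (\<lambda>y. f y * g y) differentiable_on \<Omega>"
proof (rule differentiable_on_cong_open[OF \<Omega>])
  show "(\<Sum>p\<leftarrow>splits is. foldr partial (fst p) f x * foldr partial (snd p) g x) =
      foldr partial is (\<lambda>y. f y * g y) x" if "x \<in> \<Omega>" for x
    using assms that by (subst foldr_partial_mult[OF \<Omega>]) (auto simp: case_prod_unfold)
  have "foldr partial (fst p) f differentiable_on \<Omega> \<and> foldr partial (snd p) g differentiable_on \<Omega>"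
    if "p \<in> set (splits is)" for p
    using that length_splits[of "fst p" "snd p" "is"] assms(2,3) by auto
  then show "(\<lambda>x. \<Sum>p\<leftarrow>splits is. foldr partial (fst p) f x * foldr partial (snd p) g x) differentiable_on \<Omega>"
    unfolding differentiable_on_eq_differentiable_at[OF \<Omega>]
    by (intro ballI partial_sum_list[THEN conjunct2] differentiable_mult) auto
qed

lemma smooth_on_imp_differentiable:
  "smooth_on \<Omega> f \<Longrightarrow> open \<Omega> \<Longrightarrow> x \<in> \<Omega> \<Longrightarrow> foldr partial is f differentiable (at x)"
  unfolding smooth_on_def using differentiable_on_eq_differentiable_at by blast

lemma smooth_on_continuous: "smooth_on \<Omega> f \<Longrightarrow> continuous_on \<Omega> (foldr partial is f)"
  unfolding smooth_on_def by (simp add: differentiable_imp_continuous_on)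

lemma smooth_on_foldr_partial: "smooth_on \<Omega> f \<Longrightarrow> smooth_on \<Omega> (foldr partial is f)"
  unfolding smooth_on_def by (metis foldr_append comp_apply)

lemma smooth_on_mult:
  assumes "open \<Omega>" "smooth_on \<Omega> f" "smooth_on \<Omega> g"
  shows "smooth_on \<Omega> (\<lambda>x. f x * g x)"
  using assms unfolding smooth_on_def by (auto intro!: foldr_partial_mult_differentiable)

lemma smooth_on_const [simp]: "smooth_on \<Omega> (\<lambda>_. c)"
  unfolding smooth_on_def foldr_partial_const by auto

lemma smooth_on_cong:
  assumes "open \<Omega>" "\<And>y. y \<in> \<Omega> \<Longrightarrow> f y = g y" "smooth_on \<Omega> f"
  shows "smooth_on \<Omega> g"
  unfolding smooth_on_def
proof
  fix "is"
  show "foldr partial is g differentiable_on \<Omega>"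
    by (rule differentiable_on_cong_open[OF assms(1) foldr_partial_cong[OF assms(1) _ assms(2)]])
      (use assms(3) in \<open>auto simp: smooth_on_def\<close>)
qed

lemma smooth_on_subset: "smooth_on \<Omega> f \<Longrightarrow> V \<subseteq> \<Omega> \<Longrightarrow> smooth_on V f"
  unfolding smooth_on_def using differentiable_on_subset by blast

lemma foldr_partial_add:
  assumes "open \<Omega>" "smooth_on \<Omega> f" "smooth_on \<Omega> g" "x \<in> \<Omega>"
  shows "foldr partial is (\<lambda>y. f y + g y) x = foldr partial is f x + foldr partial is g x"
  using assms(4)
proof (induction "is" arbitrary: x)
  case (Cons i "is")
  have "foldr partial (i # is) (\<lambda>y. f y + g y) x = partial i (\<lambda>y. foldr partial is f y + foldr partial is g y) x"
    unfolding foldr.simps o_apply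
    by (rule partial_cong[OF assms(1) Cons.prems]) (rule Cons.IH)
  also have "\<dots> = foldr partial (i # is) f x + foldr partial (i # is) g x"
    unfolding foldr.simps o_apply
    by (intro partial_add smooth_on_imp_differentiable[OF _ assms(1) Cons.prems] assms)
  finally show ?case .
qed simp

lemma smooth_on_add:
  assumes "open \<Omega>" "smooth_on \<Omega> f" "smooth_on \<Omega> g"
  shows "smooth_on \<Omega> (\<lambda>x. f x + g x)"
  unfolding smooth_on_def
proof
  fix "is"
  show "foldr partial is (\<lambda>x. f x + g x) differentiable_on \<Omega>"
    using assms by (intro differentiable_on_cong_open[OF assms(1) foldr_partial_add[symmetric]])
      (auto simp: smooth_on_def)
qed

lemma foldr_partial_cmult:
  assumes "open \<Omega>" "smooth_on \<Omega> f" "x \<in> \<Omega>"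
  shows "foldr partial is (\<lambda>y. c * f y) x = c * foldr partial is f x"
  using assms(3)
proof (induction "is" arbitrary: x)
  case (Cons i "is")
  have "foldr partial (i # is) (\<lambda>y. c * f y) x = partial i (\<lambda>y. c * foldr partial is f y) x"
    unfolding foldr.simps o_apply
    by (rule partial_cong[OF assms(1) Cons.prems]) (rule Cons.IH)
  also have "\<dots> = c * foldr partial (i # is) f x"
    unfolding foldr.simps o_apply
    by (intro partial_cmult smooth_on_imp_differentiable[OF assms(2) assms(1) Cons.prems])
  finally show ?case .
qed simp

lemma smooth_on_cmult: "open \<Omega> \<Longrightarrow> smooth_on \<Omega> f \<Longrightarrow> smooth_on \<Omega> (\<lambda>x. c * f x)"
  by (rule smooth_on_mult) auto

lemma smooth_on_sum:
  assumes "open \<Omega>" "\<And>a. a \<in> I \<Longrightarrow> smooth_on \<Omega> (F a)"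
  shows "smooth_on \<Omega> (\<lambda>x. \<Sum>a\<in>I. F a x)"
  using assms(2) by (induction I rule: infinite_finite_induct) (auto intro!: smooth_on_add assms(1))

lemma foldr_partial_sum:
  assumes "open \<Omega>" "\<And>a. a \<in> I \<Longrightarrow> smooth_on \<Omega> (F a)" "x \<in> \<Omega>"
  shows "foldr partial is (\<lambda>y. \<Sum>a\<in>I. F a y) x = (\<Sum>a\<in>I. foldr partial is (F a) x)"
  using assms(2)
proof (induction I rule: infinite_finite_induct)
  case (insert a I)
  then show ?case
    by (simp add: foldr_partial_add[OF assms(1) _ smooth_on_sum[OF assms(1)] assms(3)])
qed (auto simp: foldr_partial_const)

lemma smooth_on_prod:
  assumes "open \<Omega>" "\<And>a. a \<in> I \<Longrightarrow> smooth_on \<Omega> (F a)"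
  shows "smooth_on \<Omega> (\<lambda>x. \<Prod>a\<in>I. F a x)"
  using assms(2) by (induction I rule: infinite_finite_induct) (auto intro!: smooth_on_mult assms(1))

text \<open>Induction on the order. The first derivative of \<open>1 / f\<close> is
  \<open>- f' * (1 / f)^2\<close>, and by Leibniz's rule a derivative of order \<open>N\<close> of
  this expression involves only derivatives of \<open>1 / f\<close> of order at most
  \<open>N\<close>.\<close>

lemma smooth_on_inverse:
  assumes \<Omega>: "open \<Omega>" and f: "smooth_on \<Omega> f" "\<And>x. x \<in> \<Omega> \<Longrightarrow> f x \<noteq> 0"
  shows "smooth_on \<Omega> (\<lambda>x. inverse (f x))"
proof -
  have "\<forall>is. length is \<le> N \<longrightarrow> foldr partial is (\<lambda>x. inverse (f x)) differentiable_on \<Omega>" for N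
  proof (induction N)
    case 0
    have "f differentiable_on \<Omega>" using f(1) unfolding smooth_on_def by (metis foldr_Nil id_apply)
    then show ?case using f(2) by (simp add: differentiable_on_def)
  next
    case (Suc N)
    show ?case
    proof (intro allI impI)
      fix "is" :: "'a list" assume len: "length is \<le> Suc N"
      show "foldr partial is (\<lambda>x. inverse (f x)) differentiable_on \<Omega>"
      \<comment> \<open>\<open>foldr\<close> applies the last entry of the list first, so that is
        the entry to split off.\<close>
      proof (cases "is" rule: rev_cases)
        case Nil
        then show ?thesis using Suc[rule_format, of "[]"] by simp
      next
        case (snoc js i)
        have js: "length js \<le> N" using len snoc by simp
        define p where "p x = - 1 * partial i f x" for x
        have eq: "partial i (\<lambda>x. inverse (f x)) x = p x * (inverse (f x) * inverse (f x))"
          if x: "x \<in> \<Omega>" for x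
        proof -
          obtain f' where f': "(f has_derivative f') (at x)"
            using smooth_on_imp_differentiable[OF f(1) \<Omega> x, of "[]"] by (auto simp: differentiable_def)
          show ?thesis
            by (simp add: p_def partial_has_derivative[OF Deriv.has_derivative_inverse[OF f(2)[OF x] f']]
                partial_has_derivative[OF f'])
        qed
        have s: "smooth_on \<Omega> p"
          unfolding p_def using smooth_on_foldr_partial[OF f(1), of "[i]"] by (intro smooth_on_cmult[OF \<Omega>]) simp
        have "foldr partial js (\<lambda>x. p x * (inverse (f x) * inverse (f x))) differentiable_on \<Omega>"
          using s Suc js by (intro foldr_partial_mult_differentiable[OF \<Omega>]) (auto simp: smooth_on_def)
        then have "foldr partial js (partial i (\<lambda>x. inverse (f x))) differentiable_on \<Omega>"
          by (rule differentiable_on_cong_open[OF \<Omega>, rotated])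
            (rule foldr_partial_cong[OF \<Omega>], auto simp: eq)
        then show ?thesis by (simp add: snoc)
      qed
    qed
  qed
  then show ?thesis unfolding smooth_on_def by blast
qed

section \<open>Symmetry of mixed partial derivatives; passage from lists to multi-indices\<close>

text \<open>The second difference is the increment along \<open>axis j 1\<close> of the first
  difference along \<open>axis i 1\<close>. The mean value inequality compares it with the
  first-order expansion of \<open>partial j f\<close> at \<open>x\<close>, the only second-order
  information that enters.\<close>

lemma second_difference_estimate:
  fixes f :: "real ^ 'n::finite \<Rightarrow> complex"
  assumes \<Omega>: "open \<Omega>" "x \<in> \<Omega>" and f: "f differentiable_on \<Omega>"
    and A: "(partial j f has_derivative A) (at x)" and e: "0 < e"
  shows "\<exists>d>0. \<forall>h. 0 < h \<and> h < d \<longrightarrow>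
    norm (f (x + h *\<^sub>R axis i 1 + h *\<^sub>R axis j 1) - f (x + h *\<^sub>R axis i 1) - (f (x + h *\<^sub>R axis j 1) - f x)
      - (h * h) *\<^sub>R A (axis i 1)) \<le> e * (h * h)"
proof -
  \<comment> \<open>A third of \<open>e\<close>, because the expansion is applied at distances at
    most \<open>2 * h\<close> and \<open>h\<close> from \<open>x\<close> and the two errors add up
    to \<open>e * h\<close>.\<close>
  have "\<exists>d>0. \<forall>y. norm (y - x) < d \<longrightarrow> norm (partial j f y - partial j f x - A (y - x)) \<le> e / 3 * norm (y - x)"
    using A e unfolding has_derivative_at_alt by (metis divide_pos_pos zero_less_numeral)
  then obtain d1 where d1: "0 < d1"
    "\<And>y. norm (y - x) < d1 \<Longrightarrow> norm (partial j f y - partial j f x - A (y - x)) \<le> e / 3 * norm (y - x)"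
    by blast
  obtain d2 where d2: "0 < d2" "ball x d2 \<subseteq> \<Omega>" using \<Omega> by (meson open_contains_ball)
  have linA: "linear A" by (rule has_derivative_linear[OF A])
  show ?thesis
  proof (intro exI[of _ "min d1 d2 / 2"] conjI allI impI)
    show "0 < min d1 d2 / 2" using d1 d2 by simp
    fix h :: real assume h: "0 < h \<and> h < min d1 d2 / 2"
    define u :: "real ^ 'n" where "u = axis i 1"
    define v :: "real ^ 'n" where "v = axis j 1"
    have nu: "norm u = 1" "norm v = 1" by (simp_all add: u_def v_def)
    have near: "norm (h *\<^sub>R u + t *\<^sub>R v) \<le> 2 * h" "norm (t *\<^sub>R v) \<le> h" if "t \<in> {0..h}" for t
      using that h norm_triangle_ineq[of "h *\<^sub>R u" "t *\<^sub>R v"] by (auto simp: nu)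
    have in\<Omega>: "x + h *\<^sub>R u + t *\<^sub>R v \<in> \<Omega>" "x + t *\<^sub>R v \<in> \<Omega>" if "t \<in> {0..h}" for t
    proof -
      have "dist x (x + (h *\<^sub>R u + t *\<^sub>R v)) < d2" "dist x (x + t *\<^sub>R v) < d2"
        using near[OF that] h unfolding dist_norm norm_minus_commute[of x] add_diff_cancel_left' by linarith+
      then show "x + h *\<^sub>R u + t *\<^sub>R v \<in> \<Omega>" "x + t *\<^sub>R v \<in> \<Omega>"
        using d2 by (auto simp: subset_iff add.assoc)
    qed
    have line: "((\<lambda>t. f (z + t *\<^sub>R v)) has_vector_derivative partial j f (z + t *\<^sub>R v)) (at t within {0..h})"
      if "z + t *\<^sub>R v \<in> \<Omega>" for z t
    proof -
      have "f differentiable at (z + t *\<^sub>R v)"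
        using f that by (simp add: differentiable_on_eq_differentiable_at[OF \<Omega>(1)])
      then obtain f' where f': "(f has_derivative f') (at (z + t *\<^sub>R v))"
        by (auto simp: differentiable_def)
      have "((\<lambda>t. z + t *\<^sub>R v) has_derivative (\<lambda>t. t *\<^sub>R v)) (at t within {0..h})"
        by (auto intro!: derivative_eq_intros)
      then have "((\<lambda>t. f (z + t *\<^sub>R v)) has_derivative (\<lambda>t. f' (t *\<^sub>R v))) (at t within {0..h})"
        by (rule has_derivative_compose) (use f' in simp)
      then show ?thesis
        using linear_scale[OF has_derivative_linear[OF f']] partial_has_derivative[OF f', of j]
        by (simp add: has_vector_derivative_def v_def)
    qed
    define \<psi> where "\<psi> t = f (x + h *\<^sub>R u + t *\<^sub>R v) - f (x + t *\<^sub>R v) - t *\<^sub>R (h *\<^sub>R A u)" for t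
    define \<psi>' where "\<psi>' t = partial j f (x + h *\<^sub>R u + t *\<^sub>R v) - partial j f (x + t *\<^sub>R v) - h *\<^sub>R A u" for t
    have d\<psi>: "(\<psi> has_vector_derivative \<psi>' t) (at t within {0..h})" if "t \<in> {0..h}" for t
      unfolding \<psi>_def \<psi>'_def using line in\<Omega>[OF that]
      by (auto intro!: derivative_eq_intros)
    have b\<psi>: "norm (\<psi>' t) \<le> e * h" if t: "t \<in> {0..h}" for t
    proof -
      have 1: "norm (partial j f (x + h *\<^sub>R u + t *\<^sub>R v) - partial j f x - A (h *\<^sub>R u + t *\<^sub>R v)) \<le> e / 3 * (2 * h)"
        using d1(2)[of "x + h *\<^sub>R u + t *\<^sub>R v"] near[OF t] h e
        by (simp add: add.assoc) (smt (verit, best) mult_left_mono divide_nonneg_pos)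
      have 2: "norm (partial j f (x + t *\<^sub>R v) - partial j f x - A (t *\<^sub>R v)) \<le> e / 3 * h"
        using d1(2)[of "x + t *\<^sub>R v"] near[OF t] h e
        by simp (smt (verit, best) mult_left_mono divide_nonneg_pos)
      have "\<psi>' t = (partial j f (x + h *\<^sub>R u + t *\<^sub>R v) - partial j f x - A (h *\<^sub>R u + t *\<^sub>R v))
         - (partial j f (x + t *\<^sub>R v) - partial j f x - A (t *\<^sub>R v))"
        by (simp add: \<psi>'_def linear_add[OF linA] linear_scale[OF linA])
      then have "norm (\<psi>' t) \<le> e / 3 * (2 * h) + e / 3 * h"
        using norm_triangle_ineq4 1 2 by (smt (verit))
      then show ?thesis by simp
    qed
    have "norm (\<psi> h - \<psi> 0) \<le> (e * h) * norm (h - 0)"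
    proof (rule differentiable_bound[where S = "{0..h}" and f' = "\<lambda>t s. s *\<^sub>R \<psi>' t"])
      show "(\<psi> has_derivative (\<lambda>s. s *\<^sub>R \<psi>' t)) (at t within {0..h})" if "t \<in> {0..h}" for t
        using d\<psi>[OF that] by (simp add: has_vector_derivative_def)
      show "onorm (\<lambda>s. s *\<^sub>R \<psi>' t) \<le> e * h" if "t \<in> {0..h}" for t
        using b\<psi>[OF that] by (intro onorm_le) (simp add: mult.commute mult_left_mono)
    qed (use h in auto)
    then show "norm (f (x + h *\<^sub>R axis i 1 + h *\<^sub>R axis j 1) - f (x + h *\<^sub>R axis i 1) - (f (x + h *\<^sub>R axis j 1) - f x)
      - (h * h) *\<^sub>R A (axis i 1)) \<le> e * (h * h)"
      using h by (simp add: \<psi>_def u_def v_def algebra_simps)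
  qed
qed

text \<open>The second difference is unchanged when \<open>i\<close> and \<open>j\<close> are
  exchanged, and divided by \<open>h * h\<close> it approximates both mixed derivatives.\<close>

lemma partial_commute:
  fixes f :: "real ^ 'n::finite \<Rightarrow> complex"
  assumes \<Omega>: "open \<Omega>" "x \<in> \<Omega>" and f: "smooth_on \<Omega> f"
  shows "partial i (partial j f) x = partial j (partial i f) x"
proof -
  have fd: "f differentiable_on \<Omega>" using f unfolding smooth_on_def by (metis foldr_Nil id_apply)
  obtain A B where A: "(partial j f has_derivative A) (at x)" and B: "(partial i f has_derivative B) (at x)"
    using smooth_on_imp_differentiable[OF f \<Omega>, of "[i]"] smooth_on_imp_differentiable[OF f \<Omega>, of "[j]"]
    by (auto simp: differentiable_def)
  have "norm (A (axis i 1) - B (axis j 1)) \<le> e" if e: "0 < e" for e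
  proof -
    obtain d1 where d1: "0 < d1" "\<And>h. 0 < h \<Longrightarrow> h < d1 \<Longrightarrow>
      norm (f (x + h *\<^sub>R axis i 1 + h *\<^sub>R axis j 1) - f (x + h *\<^sub>R axis i 1) - (f (x + h *\<^sub>R axis j 1) - f x)
      - (h * h) *\<^sub>R A (axis i 1)) \<le> e / 2 * (h * h)"
      using second_difference_estimate[OF \<Omega> fd A, of "e / 2" i] e by auto
    obtain d2 where d2: "0 < d2" "\<And>h. 0 < h \<Longrightarrow> h < d2 \<Longrightarrow>
      norm (f (x + h *\<^sub>R axis j 1 + h *\<^sub>R axis i 1) - f (x + h *\<^sub>R axis j 1) - (f (x + h *\<^sub>R axis i 1) - f x)
      - (h * h) *\<^sub>R B (axis j 1)) \<le> e / 2 * (h * h)"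
      using second_difference_estimate[OF \<Omega> fd B, of "e / 2" j] e by auto
    define h where "h = min d1 d2 / 2"
    have h: "0 < h" "h < d1" "h < d2" using d1(1) d2(1) by (auto simp: h_def)
    define P where "P = f (x + h *\<^sub>R axis i 1 + h *\<^sub>R axis j 1) - f (x + h *\<^sub>R axis i 1) - (f (x + h *\<^sub>R axis j 1) - f x)"
    have P: "P = f (x + h *\<^sub>R axis j 1 + h *\<^sub>R axis i 1) - f (x + h *\<^sub>R axis j 1) - (f (x + h *\<^sub>R axis i 1) - f x)"
      by (simp add: P_def add_ac)
    have "norm ((h * h) *\<^sub>R (A (axis i 1) - B (axis j 1))) =
        norm ((P - (h * h) *\<^sub>R B (axis j 1)) - (P - (h * h) *\<^sub>R A (axis i 1)))"
      by (simp add: scaleR_diff_right)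
    also have "\<dots> \<le> e / 2 * (h * h) + e / 2 * (h * h)"
      using d1(2)[OF h(1,2)] d2(2)[OF h(1,3)] unfolding P[symmetric] P_def[symmetric]
      by (rule order_trans[OF norm_triangle_ineq4 add_mono[rotated]])
    also have "\<dots> = (h * h) * e" by simp
    also have "norm ((h * h) *\<^sub>R (A (axis i 1) - B (axis j 1))) = (h * h) * norm (A (axis i 1) - B (axis j 1))"
      unfolding norm_scaleR by (simp add: abs_mult_self_eq)
    finally show ?thesis using h(1) by (simp add: mult_le_cancel_left_pos)
  qed
  then have "norm (A (axis i 1) - B (axis j 1)) \<le> 0" by (rule field_le_epsilon) simp
  then show ?thesis by (simp add: partial_has_derivative[OF A] partial_has_derivative[OF B])
qed

lemma foldr_partial_extract:
  assumes \<Omega>: "open \<Omega>" and f: "smooth_on \<Omega> f" and "x \<in> \<Omega>" "i \<in> set is"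
  shows "foldr partial is f x = partial i (foldr partial (remove1 i is) f) x"
  using assms(3-)
proof (induction "is" arbitrary: x)
  case (Cons j "is")
  show ?case
  proof (cases "i = j")
    case False
    with Cons.prems have "i \<in> set is" by simp
    then have "foldr partial (j # is) f x = partial j (partial i (foldr partial (remove1 i is) f)) x"
      unfolding foldr.simps o_apply
      by (intro partial_cong[OF \<Omega> Cons.prems(1)] Cons.IH)
    also have "\<dots> = partial i (partial j (foldr partial (remove1 i is) f)) x"
      using partial_commute[OF \<Omega> Cons.prems(1) smooth_on_foldr_partial[OF f]] .
    finally show ?thesis using False by simp
  qed simp
qed simp

text \<open>Smoothness speaks of lists of directions, the growth conditions of multi-indices; as
  derivatives commute, only the multiset of directions counts, and the two can be exchanged.\<close>

lemma foldr_partial_perm: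
  assumes \<Omega>: "open \<Omega>" and f: "smooth_on \<Omega> f" and "x \<in> \<Omega>" "mset is = mset js"
  shows "foldr partial is f x = foldr partial js f x"
  using assms(3-)
proof (induction js arbitrary: x "is")
  case (Cons j js)
  have j: "j \<in> set is" using Cons.prems(2) by (metis list.set_intros(1) mset_eq_setD)
  have m: "mset (remove1 j is) = mset js" using Cons.prems(2) by simp
  have "foldr partial is f x = partial j (foldr partial (remove1 j is) f) x"
    by (rule foldr_partial_extract[OF \<Omega> f Cons.prems(1) j])
  also have "\<dots> = partial j (foldr partial js f) x"
    by (rule partial_cong[OF \<Omega> Cons.prems(1)]) (rule Cons.IH[OF _ m])
  finally show ?case by simp
qed simp

definition mi_list :: "'n::finite multiindex \<Rightarrow> 'n list" where
  "mi_list \<alpha> = concat (map (\<lambda>i. replicate (\<alpha> i) i) coord_list)"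

lemma mi_deriv_eq_foldr: "mi_deriv \<alpha> f = foldr partial (mi_list \<alpha>) f"
proof -
  have "(partial i ^^ k) g = foldr partial (replicate k i) g" for i k g
    by (induction k) auto
  then have "foldr (\<lambda>i g. (partial i ^^ \<alpha> i) g) is f
      = foldr partial (concat (map (\<lambda>i. replicate (\<alpha> i) i) is)) f" for "is"
    by (induction "is") auto
  then show ?thesis by (simp add: mi_deriv_def mi_list_def)
qed

lemma count_mi_list: "count (mset (mi_list \<alpha>)) i = \<alpha> i"
proof -
  have "distinct is \<Longrightarrow> count (mset (concat (map (\<lambda>i. replicate (\<alpha> i) i) is))) i = (if i \<in> set is then \<alpha> i else 0)" for "is"
    by (induction "is") auto
  from this[OF coord_list(2)] show ?thesis by (simp add: mi_list_def coord_list(1))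
qed

lemma foldr_partial_eq_mi_deriv:
  assumes "open \<Omega>" "smooth_on \<Omega> f" "x \<in> \<Omega>"
  shows "foldr partial is f x = mi_deriv (count (mset is)) f x"
  unfolding mi_deriv_eq_foldr using assms
  by (intro foldr_partial_perm) (auto simp: multiset_eq_iff count_mi_list)

section \<open>Characters and trigonometric series\<close>

definition character :: "real ^ 'n::finite \<Rightarrow> real ^ 'n \<Rightarrow> complex" where
  "character \<xi> x = cis (\<xi> \<bullet> x)"

lemma norm_character [simp]: "norm (character \<xi> x) = 1"
  by (simp add: character_def)

lemma character_add: "character (\<xi> + \<eta>) x = character \<xi> x * character \<eta> x"
  by (simp add: character_def inner_add_left cis_mult)

lemma character_0 [simp]: "character 0 x = 1"
  by (simp add: character_def)

lemma continuous_on_character [continuous_intros]: "continuous_on S (character \<xi>)"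
  unfolding character_def by (intro continuous_intros)

lemma character_has_derivative:
  "(character \<xi> has_derivative (\<lambda>h. \<i> * of_real (\<xi> \<bullet> h) * character \<xi> x)) (at x within S)"
proof -
  have "((\<lambda>x. \<i> * of_real (\<xi> \<bullet> x)) has_derivative (\<lambda>h. \<i> * of_real (\<xi> \<bullet> h))) (at x within S)"
    by (intro has_derivative_mult_right has_derivative_of_real has_derivative_inner_right has_derivative_ident)
  from has_derivative_compose[OF this DERIV_exp[unfolded has_field_derivative_def]]
  show ?thesis by (simp add: character_def[abs_def] cis_conv_exp mult_ac)
qed

lemma partial_cmult_character: "partial i (\<lambda>x. c * character \<xi> x) = (\<lambda>x. (c * (\<i> * of_real (\<xi> $ i))) * character \<xi> x)"
proof
  fix x
  have "((\<lambda>x. c * character \<xi> x) has_derivative (\<lambda>h. c * (\<i> * of_real (\<xi> \<bullet> h) * character \<xi> x))) (at x)"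
    by (intro has_derivative_mult_right character_has_derivative)
  from partial_has_derivative[OF this]
  show "partial i (\<lambda>x. c * character \<xi> x) x = (c * (\<i> * of_real (\<xi> $ i))) * character \<xi> x"
    by (simp add: inner_axis mult_ac)
qed

lemma smooth_on_character: "smooth_on \<Omega> (character \<xi>)"
proof -
  have "\<exists>c. foldr partial is (character \<xi>) = (\<lambda>x. c * character \<xi> x)" for "is"
  proof (induction "is")
    case Nil
    then show ?case by (intro exI[of _ 1]) simp
  next
    case (Cons i "is")
    then show ?case by (auto simp: partial_cmult_character)
  qed
  moreover have "(\<lambda>x. c * character \<xi> x) differentiable_on \<Omega>" for c
    unfolding differentiable_on_def differentiable_def
    by (blast intro: has_derivative_mult_right character_has_derivative)
  ultimately show ?thesis unfolding smooth_on_def by metis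
qed

section \<open>Trigonometric series with rapidly decreasing coefficients\<close>

text \<open>\<open>W\<close> has two tasks: it bounds the frequencies, so that a derivative costs
  one power of \<open>W\<close>, and two more powers of it turn a bounded sequence into a summable
  one.\<close>

locale frequency_sequence =
  fixes \<xi> :: "nat \<Rightarrow> real ^ 'n::finite" and W :: "nat \<Rightarrow> real"
  assumes W1: "\<And>j. 1 \<le> W j" and W_sum: "summable (\<lambda>j. 1 / (W j)\<^sup>2)"
    and freq: "\<And>j i. \<bar>\<xi> j $ i\<bar> \<le> W j"
begin

definition rapid :: "(nat \<Rightarrow> complex) \<Rightarrow> bool" where
  "rapid b \<longleftrightarrow> (\<forall>M. \<exists>C. \<forall>j. norm (b j) * W j ^ M \<le> C)"

definition series :: "(nat \<Rightarrow> complex) \<Rightarrow> real ^ 'n \<Rightarrow> complex" where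
  "series b x = (\<Sum>j. b j * character (\<xi> j) x)"

lemma norm_le_of_weighted:
  assumes "norm (b j) * W j ^ (M + 2) \<le> C"
  shows "norm (b j) * W j ^ M \<le> C * (1 / (W j)\<^sup>2)"
proof -
  have "0 < (W j)\<^sup>2" using W1[of j] by simp
  moreover have "norm (b j) * W j ^ M * (W j)\<^sup>2 \<le> C"
    using assms by (simp only: power_add mult.assoc)
  ultimately show ?thesis by (simp add: pos_le_divide_eq)
qed

lemma rapid_summable:
  assumes "rapid b"
  shows "summable (\<lambda>j. norm (b j) * W j ^ M)"
proof -
  obtain C where C: "\<And>j. norm (b j) * W j ^ (M + 2) \<le> C"
    using assms unfolding rapid_def by blast
  show ?thesis
  proof (rule summable_comparison_test')
    show "summable (\<lambda>j. C * (1 / (W j)\<^sup>2))" by (intro summable_mult W_sum)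
    show "norm (norm (b j) * W j ^ M) \<le> C * (1 / (W j)\<^sup>2)" if "0 \<le> j" for j
    proof -
      have "0 \<le> norm (b j) * W j ^ M" using W1[of j] by simp
      then show ?thesis using norm_le_of_weighted[where b = b and M = M, OF C[of j]] by simp
    qed
  qed
qed

lemma rapid_mult_freq:
  assumes "rapid b"
  shows "rapid (\<lambda>j. b j * (\<i> * of_real (\<xi> j $ i)))"
  unfolding rapid_def
proof
  fix M
  obtain C where C: "\<And>j. norm (b j) * W j ^ Suc M \<le> C" using assms unfolding rapid_def by blast
  have "norm (b j * (\<i> * of_real (\<xi> j $ i))) * W j ^ M \<le> C" for j
  proof -
    have "norm (b j * (\<i> * of_real (\<xi> j $ i))) * W j ^ M = norm (b j) * (\<bar>\<xi> j $ i\<bar> * W j ^ M)"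
      by (simp add: norm_mult)
    also have "\<dots> \<le> norm (b j) * (W j * W j ^ M)"
      using W1[of j] freq[of j i] by (intro mult_left_mono mult_right_mono) auto
    finally show ?thesis using C[of j] by simp
  qed
  then show "\<exists>C. \<forall>j. norm (b j * (\<i> * of_real (\<xi> j $ i))) * W j ^ M \<le> C" by blast
qed

lemma summable_series:
  assumes "rapid b"
  shows "summable (\<lambda>j. b j * character (\<xi> j) x)"
proof (rule summable_norm_cancel)
  show "summable (\<lambda>j. norm (b j * character (\<xi> j) x))"
    using rapid_summable[OF assms, of 0] by (simp add: norm_mult)
qed

lemma norm_series_le:
  assumes "\<And>j. norm (b j) * (W j)\<^sup>2 \<le> C"
  shows "norm (series b x) \<le> C * (\<Sum>j. 1 / (W j)\<^sup>2)"
proof -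
  have le: "norm (b j * character (\<xi> j) x) \<le> C * (1 / (W j)\<^sup>2)" for j
  proof -
    have "norm (b j) * W j ^ 0 \<le> C * (1 / (W j)\<^sup>2)"
      by (rule norm_le_of_weighted) (use assms[of j] in \<open>simp only: add_0\<close>)
    then show ?thesis by (simp add: norm_mult)
  qed
  have "norm (series b x) \<le> (\<Sum>j. C * (1 / (W j)\<^sup>2))"
    unfolding series_def by (rule norm_suminf_le[OF le summable_mult[OF W_sum]])
  also have "\<dots> = C * (\<Sum>j. 1 / (W j)\<^sup>2)" by (rule suminf_mult[OF W_sum])
  finally show ?thesis .
qed

lemma norm_freq_le: "norm (\<xi> j) \<le> real CARD('n) * W j"
proof -
  have "norm (\<xi> j) \<le> (\<Sum>i\<in>UNIV. \<bar>\<xi> j $ i\<bar>)" by (rule norm_le_l1_cart)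
  also have "\<dots> \<le> (\<Sum>i\<in>(UNIV :: 'n set). W j)" by (intro sum_mono freq)
  finally show ?thesis by simp
qed

text \<open>The differentiated series is dominated by \<open>a j * norm h\<close> with
  \<open>a\<close> summable and independent of \<open>x\<close>, so its tails are uniformly small
  relative to \<open>norm h\<close> and it may be differentiated term by term.\<close>

lemma series_has_derivative:
  assumes "rapid b"
  shows "(series b has_derivative (\<lambda>h. \<Sum>j. b j * (\<i> * of_real (\<xi> j \<bullet> h) * character (\<xi> j) x))) (at x)"
proof -
  let ?f' = "\<lambda>j x h. b j * (\<i> * of_real (\<xi> j \<bullet> h) * character (\<xi> j) x)"
  define a where "a j = real CARD('n) * (norm (b j) * W j ^ 1)" for j
  have a: "summable a" unfolding a_def by (intro summable_mult rapid_summable assms)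
  have le: "norm (?f' j x h) \<le> a j * norm h" for j x h
  proof -
    have "norm (?f' j x h) = norm (b j) * \<bar>\<xi> j \<bullet> h\<bar>" by (simp add: norm_mult)
    also have "\<dots> \<le> norm (b j) * (real CARD('n) * W j * norm h)"
      using Cauchy_Schwarz_ineq2[of "\<xi> j" h] norm_freq_le[of j]
      by (intro mult_left_mono) (auto elim!: order_trans intro!: mult_right_mono)
    finally show ?thesis by (simp add: a_def mult_ac)
  qed
  have sm: "summable (\<lambda>j. ?f' j x h)" for x h
    by (rule summable_comparison_test'[OF summable_mult2[OF a]]) (rule le)
  have "\<exists>g. \<forall>x\<in>UNIV. (\<lambda>j. b j * character (\<xi> j) x) sums g x \<and>
      (g has_derivative (\<lambda>h. \<Sum>j. ?f' j x h)) (at x within UNIV)"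
  proof (rule has_derivative_series)
    show "((\<lambda>x. b j * character (\<xi> j) x) has_derivative ?f' j x) (at x within UNIV)" for j x
      by (intro has_derivative_mult_right character_has_derivative)
    show "\<forall>\<^sub>F n in sequentially. \<forall>x\<in>UNIV. \<forall>h.
       norm (sum (\<lambda>j. ?f' j x h) {..<n} - (\<Sum>j. ?f' j x h)) \<le> e * norm h" if e: "0 < e" for e
    proof -
      obtain N where N: "\<And>n. n \<ge> N \<Longrightarrow> norm (\<Sum>j. a (j + n)) < e"
        using suminf_exist_split[OF e a] by blast
      show ?thesis
      proof (rule eventually_sequentiallyI[of N], intro ballI allI)
        fix n x h assume n: "N \<le> n"
        have "norm (sum (\<lambda>j. ?f' j x h) {..<n} - (\<Sum>j. ?f' j x h)) = norm (\<Sum>j. ?f' (j + n) x h)"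
          by (subst suminf_minus_initial_segment[OF sm]) (simp add: norm_minus_commute)
        also have "\<dots> \<le> (\<Sum>j. a (j + n) * norm h)"
          by (rule norm_suminf_le[OF le]) (intro summable_mult2 summable_ignore_initial_segment a)
        also have "\<dots> = (\<Sum>j. a (j + n)) * norm h"
          by (rule suminf_mult2[symmetric]) (intro summable_ignore_initial_segment a)
        also have "\<dots> \<le> e * norm h"
          using N[OF n] by (intro mult_right_mono) auto
        finally show "norm (sum (\<lambda>j. ?f' j x h) {..<n} - (\<Sum>j. ?f' j x h)) \<le> e * norm h" .
      qed
    qed
    show "(\<lambda>j. b j * character (\<xi> j) 0) sums series b 0"
      unfolding series_def using summable_series[OF assms] by (rule summable_sums)
  qed auto
  then obtain g where g: "\<And>x. (\<lambda>j. b j * character (\<xi> j) x) sums g x"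
    "\<And>x. (g has_derivative (\<lambda>h. \<Sum>j. ?f' j x h)) (at x)" by auto
  have "g = series b" unfolding series_def using g(1) sums_unique by blast
  then show ?thesis using g(2) by simp
qed

lemma partial_series:
  assumes "rapid b"
  shows "partial i (series b) = series (\<lambda>j. b j * (\<i> * of_real (\<xi> j $ i)))"
proof
  fix x
  show "partial i (series b) x = series (\<lambda>j. b j * (\<i> * of_real (\<xi> j $ i))) x"
    using partial_has_derivative[OF series_has_derivative[OF assms]]
    by (simp add: series_def inner_axis mult.assoc)
qed

lemma rapid_foldr:
  assumes "rapid b"
  shows "rapid (\<lambda>j. b j * (\<Prod>i\<leftarrow>is. \<i> * of_real (\<xi> j $ i)))"
  using assms
proof (induction "is" arbitrary: b)
  case (Cons i "is")
  from Cons.IH[OF rapid_mult_freq[OF Cons.prems, of i]] show ?case by (simp add: mult_ac)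
qed simp

lemma foldr_partial_series:
  assumes "rapid b"
  shows "foldr partial is (series b) = series (\<lambda>j. b j * (\<Prod>i\<leftarrow>is. \<i> * of_real (\<xi> j $ i)))"
proof (induction "is")
  case (Cons i "is")
  then show ?case by (simp add: partial_series[OF rapid_foldr[OF assms]] mult_ac)
qed simp

lemma smooth_on_series:
  assumes "rapid b"
  shows "smooth_on \<Omega> (series b)"
  unfolding smooth_on_def foldr_partial_series[OF assms] differentiable_on_def differentiable_def
  using series_has_derivative[OF rapid_foldr[OF assms]] has_derivative_at_withinI by blast

lemma prod_freq_le: "norm (\<Prod>i\<leftarrow>is. \<i> * complex_of_real (\<xi> j $ i)) \<le> W j ^ length is"
proof (induction "is")
  case (Cons i "is")
  then show ?case using freq[of j i] W1[of j] by (auto simp: norm_mult intro!: mult_mono)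
qed simp

end

section \<open>Integration over cubes and orthogonality of characters\<close>

definition cube :: "real \<Rightarrow> (real ^ 'n::finite) set" where
  "cube T = cbox (vec (- T)) (vec T)"

lemma mem_cube: "x \<in> cube T \<longleftrightarrow> (\<forall>i. - T \<le> x $ i \<and> x $ i \<le> T)"
  by (simp add: cube_def mem_box_cart)

lemma content_cube: "0 \<le> T \<Longrightarrow> measure lborel (cube T :: (real ^ 'n::finite) set) = (2 * T) ^ CARD('n)"
  unfolding cube_def by (subst content_cbox_cart) (auto simp: mem_box_cart interval_ne_empty_cart)

lemma cube_mono: "R \<le> T \<Longrightarrow> cube R \<subseteq> (cube T :: (real ^ 'n::finite) set)"
proof
  fix x :: "real ^ 'n"
  assume RT: "R \<le> T" and "x \<in> cube R"
  then have "- R \<le> x $ i \<and> x $ i \<le> R" for i by (simp add: mem_cube)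
  then have "- T \<le> x $ i \<and> x $ i \<le> T" for i using RT by (meson order_trans neg_le_iff_le)
  then show "x \<in> cube T" by (simp add: mem_cube)
qed

lemma compact_cube [simp]: "compact (cube T)"
  by (simp add: cube_def)

text \<open>Translation pushes a slab of the cube out through one face; by periodicity the integral
  over it equals that over the slab left uncovered at the opposite face.\<close>

lemma integral_periodic_shift:
  fixes F :: "real ^ 'n::finite \<Rightarrow> complex"
  assumes F: "continuous_on UNIV F" and per: "\<And>x. F (x + (2 * T) *\<^sub>R axis i 1) = F x"
    and s: "0 \<le> s" "s \<le> 2 * T"
  shows "integral (cube T) (\<lambda>x. F (x + s *\<^sub>R axis i 1)) = integral (cube T) F"
proof -
  define e :: "real ^ 'n" where "e = axis i 1"
  have e: "e \<in> Basis" "x \<bullet> e = x $ i" for x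
    by (auto simp: e_def axis_in_Basis_iff inner_axis)
  have ei: "e $ j = (if j = i then 1 else 0)" for j
    by (auto simp: e_def axis_def)
  have mem: "x \<in> cbox p q \<longleftrightarrow> (p $ i \<le> x $ i \<and> x $ i \<le> q $ i) \<and>
      (\<forall>j. j \<noteq> i \<longrightarrow> p $ j \<le> x $ j \<and> x $ j \<le> q $ j)" for x p q :: "real ^ 'n"
    unfolding mem_box_cart by metis
  have int: "F integrable_on cbox a b" for a b
    by (rule integrable_continuous[OF continuous_on_subset[OF F]]) simp
  define a b :: "real ^ 'n" where "a = vec (- T)" and "b = vec T"
  \<comment> \<open>\<open>cbox a' (b + s *\<^sub>R e)\<close> is the slab beyond the face
    \<open>x $ i = T\<close>, and \<open>cbox a b'\<close> the slab of thickness \<open>s\<close> at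
    the face \<open>x $ i = - T\<close>. One is the other translated by the period.\<close>
  define a' b' :: "real ^ 'n" where "a' = (\<chi> j. if j = i then T else - T)"
    and "b' = (\<chi> j. if j = i then - T + s else T)"
  have s1: "integral (cube T) (\<lambda>x. F (x + s *\<^sub>R e)) = integral (cbox (a + s *\<^sub>R e) (b + s *\<^sub>R e)) F"
    using integral_shift_cbox_plus[of a b F "s *\<^sub>R e"]
    by (simp add: o_def add.commute cube_def a_def b_def)
  have "cbox (a + s *\<^sub>R e) (b + s *\<^sub>R e) \<inter> {x. x \<bullet> e \<le> T} = cbox (a + s *\<^sub>R e) b"
    "cbox (a + s *\<^sub>R e) (b + s *\<^sub>R e) \<inter> {x. x \<bullet> e \<ge> T} = cbox a' (b + s *\<^sub>R e)"
    using s by (auto simp: set_eq_iff e mem ei a_def b_def a'_def)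
  then have s2: "integral (cbox (a + s *\<^sub>R e) (b + s *\<^sub>R e)) F =
      integral (cbox (a + s *\<^sub>R e) b) F + integral (cbox a' (b + s *\<^sub>R e)) F"
    using integral_split[OF int e(1), of "a + s *\<^sub>R e" "b + s *\<^sub>R e" T] by simp
  have shifted: "a' = a + (2 * T) *\<^sub>R e" "b + s *\<^sub>R e = b' + (2 * T) *\<^sub>R e"
    by (auto simp: vec_eq_iff ei a_def b_def a'_def b'_def)
  have "integral (cbox a' (b + s *\<^sub>R e)) F = integral (cbox a b') (\<lambda>x. F (x + (2 * T) *\<^sub>R e))"
    using integral_shift_cbox_plus[of a b' F "(2 * T) *\<^sub>R e"]
    by (simp add: o_def add.commute shifted)
  also have "\<dots> = integral (cbox a b') F" using per by (simp add: e_def)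
  finally have s3: "integral (cbox a' (b + s *\<^sub>R e)) F = integral (cbox a b') F" .
  have "cbox a b \<inter> {x. x \<bullet> e \<le> - T + s} = cbox a b'"
    "cbox a b \<inter> {x. x \<bullet> e \<ge> - T + s} = cbox (a + s *\<^sub>R e) b"
    using s by (auto simp: set_eq_iff e mem ei a_def b_def b'_def)
  then have "integral (cbox a b) F = integral (cbox a b') F + integral (cbox (a + s *\<^sub>R e) b) F"
    using integral_split[OF int e(1), of a b "- T + s"] by simp
  then show ?thesis using s1 s2 s3 by (simp add: cube_def a_def b_def e_def)
qed

text \<open>Translation by half a wavelength in a direction with \<open>k i \<noteq> 0\<close>
  changes the sign of the character, but not its integral over a full period; so the integral is its
  own negative.\<close>

lemma integral_character_cube:
  fixes k :: "'n::finite \<Rightarrow> int"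
  assumes \<epsilon>: "0 < \<epsilon>" and k: "k \<noteq> (\<lambda>_. 0)"
  shows "integral (cube (pi / \<epsilon>)) (character (\<chi> i. \<epsilon> * of_int (k i))) = 0"
proof -
  define \<xi> :: "real ^ 'n" where "\<xi> = (\<chi> i. \<epsilon> * of_int (k i))"
  obtain i where i: "k i \<noteq> 0" using k by auto
  define s where "s = pi / (\<epsilon> * \<bar>of_int (k i)\<bar>)"
  have shift: "character \<xi> (x + r *\<^sub>R axis i 1) = character \<xi> x * cis (\<epsilon> * of_int (k i) * r)" for x r
    by (simp add: character_def inner_add_right inner_axis cis_mult \<xi>_def mult_ac add_ac)
  have per: "character \<xi> (x + (2 * (pi / \<epsilon>)) *\<^sub>R axis i 1) = character \<xi> x" for x
  proof -
    have "\<epsilon> * of_int (k i) * (2 * (pi / \<epsilon>)) = 2 * pi * of_int (k i)" using \<epsilon> by simp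
    then show ?thesis unfolding shift by (simp add: cis_multiple_2pi)
  qed
  have k1: "1 \<le> \<bar>real_of_int (k i)\<bar>" using i by linarith
  have s0: "0 \<le> s" using \<epsilon> by (simp add: s_def)
  have "pi / (\<epsilon> * \<bar>of_int (k i)\<bar>) \<le> pi / (\<epsilon> * 1)"
    using \<epsilon> k1 by (intro divide_left_mono mult_left_mono) (auto intro!: mult_pos_pos)
  also have "\<dots> \<le> 2 * (pi / \<epsilon>)" using \<epsilon> by (simp add: field_simps)
  finally have s2: "s \<le> 2 * (pi / \<epsilon>)" by (simp add: s_def)
  have "\<epsilon> * of_int (k i) * s = pi \<or> \<epsilon> * of_int (k i) * s = - pi"
    using \<epsilon> i by (auto simp: s_def abs_if field_simps)
  then have m1: "cis (\<epsilon> * of_int (k i) * s) = -1" by (auto simp: cis.ctr complex_eq_iff)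
  have "integral (cube (pi / \<epsilon>)) (character \<xi>) =
      integral (cube (pi / \<epsilon>)) (\<lambda>x. character \<xi> (x + s *\<^sub>R axis i 1))"
    by (rule integral_periodic_shift[where F = "character \<xi>", symmetric, OF _ per s0 s2]) (intro continuous_intros)
  also have "\<dots> = - integral (cube (pi / \<epsilon>)) (character \<xi>)"
    unfolding shift m1 by simp
  finally show ?thesis by (simp add: \<xi>_def)
qed

text \<open>The integral of a translate of \<open>F\<close> over the larger cube is constant for
  small translations, because the support stays inside. Differentiating under the integral sign at
  translation 0 gives the claim.\<close>

lemma integral_partial_eq_0:
  fixes F :: "real ^ 'n::finite \<Rightarrow> complex"
  assumes F: "F differentiable_on UNIV" and F': "continuous_on UNIV (partial i F)"
    and supp: "\<And>x. x \<notin> cube R \<Longrightarrow> F x = 0" and RT: "R < T"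
  shows "integral (cube T) (partial i F) = 0"
proof -
  have cF: "continuous_on UNIV F" by (rule differentiable_imp_continuous_on[OF F])
  have dF: "(F has_derivative frechet_derivative F (at x)) (at x)" for x
    using F frechet_derivative_works[of F "at x"] by (simp add: differentiable_on_def)
  define e :: "real ^ 'n" where "e = axis i 1"
  define d where "d = T - R"
  have d: "0 < d" using RT by (simp add: d_def)
  have const: "integral (cube T) (\<lambda>x. F (x + s *\<^sub>R e)) = integral (cube T) F" if s: "s \<in> {-d<..<d}" for s
  proof -
    have I: "(F has_integral integral (cube R) F) (cube R)"
      unfolding cube_def by (intro integrable_integral integrable_continuous continuous_on_subset[OF cF]) simp
    have sub: "cube R \<subseteq> cbox (vec (- T) + s *\<^sub>R e) (vec T + s *\<^sub>R e)" "cube R \<subseteq> (cube T :: (real ^ 'n) set)"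
    proof -
      have ei: "(vec r + s *\<^sub>R e) $ j = (if j = i then r + s else r)" for r j
        by (auto simp: e_def axis_def)
      show "cube R \<subseteq> cbox (vec (- T) + s *\<^sub>R e) (vec T + s *\<^sub>R e)"
      proof
        fix x :: "real ^ 'n" assume x: "x \<in> cube R"
        have "- T + s \<le> x $ j \<and> x $ j \<le> T + s \<and> - T \<le> x $ j \<and> x $ j \<le> T" for j
        proof -
          have "- R \<le> x $ j" "x $ j \<le> R" using x by (auto simp: mem_cube)
          then show ?thesis using s RT by (auto simp: d_def)
        qed
        then show "x \<in> cbox (vec (- T) + s *\<^sub>R e) (vec T + s *\<^sub>R e)"
          by (simp add: mem_box_cart ei del: vector_add_component vector_scaleR_component)
      qed
      show "cube R \<subseteq> (cube T :: (real ^ 'n) set)" using RT by (intro cube_mono) simp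
    qed
    have "integral (cube T) (\<lambda>x. F (x + s *\<^sub>R e)) = integral (cbox (vec (- T) + s *\<^sub>R e) (vec T + s *\<^sub>R e)) F"
      using integral_shift_cbox_plus[of "vec (- T)" "vec T" F "s *\<^sub>R e"]
      by (simp add: o_def add.commute cube_def)
    also have "\<dots> = integral (cube R) F"
      using has_integral_on_superset[OF I supp sub(1)] by (rule integral_unique)
    also have "\<dots> = integral (cube T) F"
      using has_integral_on_superset[OF I supp sub(2)] by (rule integral_unique[symmetric])
    finally show ?thesis .
  qed
  have "((\<lambda>s. integral (cbox (vec (- T)) (vec T)) (\<lambda>x. F (x + s *\<^sub>R e))) has_vector_derivative
      integral (cbox (vec (- T)) (vec T)) (\<lambda>x. partial i F (x + 0 *\<^sub>R e))) (at 0 within {-d<..<d})"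
  proof (rule leibniz_rule_vector_derivative[where fx = "\<lambda>s x. partial i F (x + s *\<^sub>R e)"])
    fix s x
    have "((\<lambda>s. x + s *\<^sub>R e) has_derivative (\<lambda>s. s *\<^sub>R e)) (at s within {-d<..<d})"
      by (auto intro!: derivative_eq_intros)
    then have "((\<lambda>s. F (x + s *\<^sub>R e)) has_derivative
        (\<lambda>t. frechet_derivative F (at (x + s *\<^sub>R e)) (t *\<^sub>R e))) (at s within {-d<..<d})"
      by (rule has_derivative_compose) (rule dF)
    then show "((\<lambda>s. F (x + s *\<^sub>R e)) has_vector_derivative partial i F (x + s *\<^sub>R e)) (at s within {-d<..<d})"
      using linear_scale[OF has_derivative_linear[OF dF]] partial_has_derivative[OF dF]
      by (simp add: has_vector_derivative_def e_def)
  next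
    fix s
    show "(\<lambda>x. F (x + s *\<^sub>R e)) integrable_on cbox (vec (- T)) (vec T)"
      by (intro integrable_continuous continuous_on_compose2[OF cF] continuous_intros) auto
  next
    show "continuous_on ({-d<..<d} \<times> cbox (vec (- T)) (vec T)) (\<lambda>(s, x). partial i F (x + s *\<^sub>R e))"
      unfolding case_prod_unfold by (intro continuous_on_compose2[OF F'] continuous_intros) auto
  qed (use d in auto)
  then have "((\<lambda>s. integral (cube T) (\<lambda>x. F (x + s *\<^sub>R e))) has_vector_derivative integral (cube T) (partial i F)) (at 0)"
    using d by (simp add: cube_def at_within_open[of _ "{-d<..<d}"])
  moreover have "((\<lambda>s. integral (cube T) (\<lambda>x. F (x + s *\<^sub>R e))) has_vector_derivative 0) (at 0)"
  proof (rule has_vector_derivative_transform_within_open[of "\<lambda>_. integral (cube T) F" _ _ "{-d<..<d}"])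
    show "((\<lambda>_. integral (cube T) F) has_vector_derivative 0) (at 0)" by (rule has_vector_derivative_const)
  qed (use d const in auto)
  ultimately show ?thesis by (rule vector_derivative_unique_at)
qed

section \<open>Fourier inversion on a cube\<close>

text \<open>
  A continuous function orthogonal to all characters is orthogonal to all powers of the
  trigonometric polynomial \<open>t\<close> below, which peaks at \<open>x\<^sub>0\<close> and is bounded by 1 away from \<open>x\<^sub>0\<close>.
\<close>

lemma fourier_uniqueness:
  fixes G :: "real ^ 'n::finite \<Rightarrow> complex"
  assumes \<epsilon>: "0 < \<epsilon>" and G: "continuous_on (cube (pi / \<epsilon>)) G"
    and ortho: "\<And>k :: 'n \<Rightarrow> int. integral (cube (pi / \<epsilon>)) (\<lambda>x. G x * character (\<chi> i. \<epsilon> * of_int (k i)) x) = 0"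
    and x0: "\<And>i. \<bar>x\<^sub>0 $ i\<bar> < pi / \<epsilon>"
  shows "G x\<^sub>0 = 0"
proof (rule ccontr)
  assume nz: "G x\<^sub>0 \<noteq> 0"
  define T where "T = pi / \<epsilon>"
  have \<epsilon>T: "\<epsilon> * T = pi" using \<epsilon> by (simp add: T_def)
  define n where "n = real CARD('n)"
  have n: "1 \<le> n" by (simp add: n_def Suc_le_eq card_gt_0_iff)
  \<comment> \<open>Multiplication by \<open>cnj (G x\<^sub>0)\<close> makes the value at the point
    positive, so that only real integrals have to be estimated.\<close>
  define h where "h x = Re (cnj (G x\<^sub>0) * G x)" for x
  have h: "continuous_on (cube T) h" unfolding h_def T_def by (intro continuous_intros G)
  define \<eta> where "\<eta> = (norm (G x\<^sub>0))\<^sup>2 / 2"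
  have \<eta>: "0 < \<eta>" using nz by (simp add: \<eta>_def)
  have h0: "h x\<^sub>0 = 2 * \<eta>"
    by (simp add: h_def \<eta>_def cmod_power2 flip: power2_eq_square)
  have x0T: "x\<^sub>0 \<in> cube T"
  proof -
    have "- T \<le> x\<^sub>0 $ i \<and> x\<^sub>0 $ i \<le> T" for i using x0[of i] unfolding T_def by linarith
    then show ?thesis by (simp add: mem_cube)
  qed
  obtain d0 where d0: "0 < d0" "\<And>x. x \<in> cube T \<Longrightarrow> dist x x\<^sub>0 < d0 \<Longrightarrow> \<bar>h x - h x\<^sub>0\<bar> < \<eta>"
    using h x0T \<eta> unfolding continuous_on_iff dist_real_def by meson
  define \<mu> where "\<mu> = Min (range (\<lambda>i. T - \<bar>x\<^sub>0 $ i\<bar>))"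
  have \<mu>: "0 < \<mu>" "\<And>i. \<mu> \<le> T - \<bar>x\<^sub>0 $ i\<bar>"
    using x0 by (auto simp: \<mu>_def T_def)
  \<comment> \<open>\<mu> keeps the box of radius \<open>d\<close> inside the cube and clear of the
    periodic images of the point, \<open>pi / (2 * \<epsilon>)\<close> keeps the cosines nonnegative
    on it, and \<open>d0 / (2 * n)\<close> keeps \<open>h\<close> above \<eta> there.\<close>
  define d where "d = min \<mu> (min (pi / (2 * \<epsilon>)) (d0 / (2 * n)))"
  have d: "0 < d" "d \<le> \<mu>" "d \<le> pi / (2 * \<epsilon>)" "d \<le> d0 / (2 * n)"
    using \<mu> \<epsilon> d0 n by (auto simp: d_def)
  have \<epsilon>d: "0 < \<epsilon> * d" "\<epsilon> * d \<le> pi / 2"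
    using d(1,3) \<epsilon> by (auto simp: field_simps)
  define c where "c = cos (\<epsilon> * d)"
  have c: "c < 1" "0 \<le> c"
    using cos_monotone_0_pi[of 0 "\<epsilon> * d"] \<epsilon>d cos_ge_zero[of "\<epsilon> * d"] by (auto simp: c_def)
  \<comment> \<open>Chosen so that \<open>t \<le> 1\<close> as soon as one of the \<open>n\<close>
    cosines is at most \<open>c\<close>, while the peak value is
    \<open>1 + \<delta>\<close>.\<close>
  define \<delta> where "\<delta> = (1 - c) / n"
  have \<delta>: "0 < \<delta>" using c n by (simp add: \<delta>_def)
  define t where "t x = \<delta> + (1 / n) * (\<Sum>i\<in>UNIV. cos (\<epsilon> * (x $ i - x\<^sub>0 $ i)))" for x :: "real ^ 'n"
  have t_cont: "continuous_on S t" for S unfolding t_def by (intro continuous_intros)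
  define fr :: "('n \<Rightarrow> int) \<Rightarrow> real ^ 'n" where "fr k = (\<chi> i. \<epsilon> * of_int (k i))" for k
  \<comment> \<open>Each cosine is a combination of two characters, so multiplication by
    \<open>t\<close> merely shifts the index \<open>k\<close>. The induction on the power of
    \<open>t\<close> rests on this.\<close>
  have t_eq: "complex_of_real (t x) = of_real \<delta> + (\<Sum>i\<in>UNIV.
      cis (- \<epsilon> * x\<^sub>0 $ i) / (2 * n) * character (fr (\<lambda>j. if j = i then 1 else 0)) x +
      cis (\<epsilon> * x\<^sub>0 $ i) / (2 * n) * character (fr (\<lambda>j. if j = i then -1 else 0)) x)" for x
  proof -
    have ch: "character (fr (\<lambda>j. if j = i then s else 0)) x = cis (\<epsilon> * of_int s * x $ i)" for i s
    proof -
      have "fr (\<lambda>j. if j = i then s else 0) = (\<epsilon> * of_int s) *\<^sub>R axis i 1"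
        by (auto simp: fr_def vec_eq_iff axis_def)
      then show ?thesis by (simp add: character_def inner_axis' )
    qed
    have "complex_of_real (cos (\<epsilon> * (x $ i - x\<^sub>0 $ i))) =
        (cis (- \<epsilon> * x\<^sub>0 $ i) * cis (\<epsilon> * x $ i) + cis (\<epsilon> * x\<^sub>0 $ i) * cis (- \<epsilon> * x $ i)) / 2" for i
      unfolding cis_mult by (simp add: complex_eq_iff algebra_simps cos_diff sin_diff)
    then show ?thesis using n
      by (simp add: t_def ch sum_distrib_left add_divide_distrib algebra_simps sum.distrib)
  qed
  have fr_add: "character (fr k) x * character (fr l) x = character (fr (\<lambda>i. k i + l i)) x" for k l x
    unfolding character_add[symmetric]
    by (rule arg_cong[where f = "\<lambda>\<xi>. character \<xi> x"]) (simp add: fr_def vec_eq_iff algebra_simps)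
  have orthoN: "((\<lambda>x. G x * character (fr k) x * of_real (t x) ^ N) has_integral 0) (cube T)" for k N
  proof (induction N arbitrary: k)
    case 0
    have "(\<lambda>x. G x * character (fr k) x) integrable_on cube T"
      unfolding cube_def by (intro integrable_continuous continuous_intros G[folded T_def, unfolded cube_def])
    then show ?case using ortho[of k] by (simp add: has_integral_iff fr_def T_def)
  next
    case (Suc N)
    have "((\<lambda>x. of_real \<delta> * (G x * character (fr k) x * of_real (t x) ^ N) + (\<Sum>i\<in>UNIV.
        cis (- \<epsilon> * x\<^sub>0 $ i) / (2 * n) * (G x * character (fr (\<lambda>j. k j + (if j = i then 1 else 0))) x * of_real (t x) ^ N) +
        cis (\<epsilon> * x\<^sub>0 $ i) / (2 * n) * (G x * character (fr (\<lambda>j. k j + (if j = i then -1 else 0))) x * of_real (t x) ^ N)))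
      has_integral of_real \<delta> * 0 + (\<Sum>i\<in>(UNIV :: 'n set). cis (- \<epsilon> * x\<^sub>0 $ i) / (2 * n) * 0 + cis (\<epsilon> * x\<^sub>0 $ i) / (2 * n) * 0)) (cube T)"
      by (intro has_integral_add has_integral_mult_right has_integral_sum Suc.IH) auto
    moreover have "G x * character (fr k) x * of_real (t x) ^ Suc N =
        of_real \<delta> * (G x * character (fr k) x * of_real (t x) ^ N) + (\<Sum>i\<in>UNIV.
        cis (- \<epsilon> * x\<^sub>0 $ i) / (2 * n) * (G x * character (fr (\<lambda>j. k j + (if j = i then 1 else 0))) x * of_real (t x) ^ N) +
        cis (\<epsilon> * x\<^sub>0 $ i) / (2 * n) * (G x * character (fr (\<lambda>j. k j + (if j = i then -1 else 0))) x * of_real (t x) ^ N))" for x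
    proof -
      have "G x * character (fr k) x * of_real (t x) ^ Suc N
          = (G x * character (fr k) x * of_real (t x) ^ N) * of_real (t x)" by simp
      also have "\<dots> = of_real \<delta> * (G x * character (fr k) x * of_real (t x) ^ N) + (\<Sum>i\<in>UNIV.
        cis (- \<epsilon> * x\<^sub>0 $ i) / (2 * n) * (G x * (character (fr k) x * character (fr (\<lambda>j. if j = i then 1 else 0)) x) * of_real (t x) ^ N) +
        cis (\<epsilon> * x\<^sub>0 $ i) / (2 * n) * (G x * (character (fr k) x * character (fr (\<lambda>j. if j = i then -1 else 0)) x) * of_real (t x) ^ N))"
        by (subst (2) t_eq) (simp only: distrib_left sum_distrib_left mult_ac)
      finally show ?thesis unfolding fr_add .
    qed
    ultimately show ?case by simp
  qed
  have hN: "((\<lambda>x. h x * t x ^ N) has_integral 0) (cube T)" for N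
  proof -
    have "fr (\<lambda>_. 0) = 0" by (simp add: fr_def vec_eq_iff)
    then have "((\<lambda>x. G x * of_real (t x) ^ N) has_integral 0) (cube T)"
      using orthoN[of "\<lambda>_. 0" N] by simp
    moreover have "bounded_linear (\<lambda>z. Re (cnj (G x\<^sub>0) * z))"
      by (rule bounded_linear_compose[OF bounded_linear_Re bounded_linear_mult_right])
    ultimately have "((\<lambda>x. Re (cnj (G x\<^sub>0) * (G x * of_real (t x) ^ N))) has_integral 0) (cube T)"
      using has_integral_linear[of "\<lambda>x. G x * of_real (t x) ^ N" 0 "cube T" "\<lambda>z. Re (cnj (G x\<^sub>0) * z)"]
      by (simp only: o_def mult_zero_right zero_complex.sel)
    moreover have "Re (cnj (G x\<^sub>0) * (G x * of_real (t x) ^ N)) = h x * t x ^ N" for x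
    proof -
      have "cnj (G x\<^sub>0) * (G x * of_real (t x) ^ N) = (cnj (G x\<^sub>0) * G x) * of_real (t x ^ N)" by simp
      also have "Re \<dots> = Re (cnj (G x\<^sub>0) * G x) * t x ^ N"
        by (simp only: times_complex.sel(1)[of _ "of_real _"] Re_complex_of_real Im_complex_of_real mult_zero_right diff_zero)
      finally show ?thesis by (simp only: h_def)
    qed
    ultimately show ?thesis by (simp only:)
  qed
  \<comment> \<open>The upper bound \<open>2 * T - d\<close> keeps the argument away from the period
    \<open>2 * T\<close>, where the cosine returns to 1.\<close>
  have cos_far: "cos (\<epsilon> * y) \<le> c" if "d < \<bar>y\<bar>" "\<bar>y\<bar> \<le> 2 * T - d" for y
  proof -
    have le: "\<epsilon> * d \<le> \<epsilon> * \<bar>y\<bar>" "\<epsilon> * \<bar>y\<bar> \<le> 2 * pi - \<epsilon> * d"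
    proof -
      show "\<epsilon> * d \<le> \<epsilon> * \<bar>y\<bar>" using that \<epsilon> by (intro mult_left_mono) auto
      have "\<epsilon> * \<bar>y\<bar> \<le> \<epsilon> * (2 * T - d)" using that \<epsilon> by (intro mult_left_mono) auto
      also have "\<dots> = 2 * (\<epsilon> * T) - \<epsilon> * d" by (simp add: algebra_simps)
      finally show "\<epsilon> * \<bar>y\<bar> \<le> 2 * pi - \<epsilon> * d" by (simp add: \<epsilon>T)
    qed
    have "cos (\<epsilon> * y) = cos (\<epsilon> * \<bar>y\<bar>)" by (simp add: abs_if)
    also have "\<dots> \<le> c"
    proof (cases "\<epsilon> * \<bar>y\<bar> \<le> pi")
      case True
      then show ?thesis unfolding c_def using le \<epsilon>d by (intro cos_monotone_0_pi_le) auto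
    next
      case False
      have "cos (\<epsilon> * \<bar>y\<bar>) = cos (2 * pi - \<epsilon> * \<bar>y\<bar>)" by (simp add: cos_diff)
      also have "\<dots> \<le> c" unfolding c_def using le \<epsilon>d False by (intro cos_monotone_0_pi_le) auto
      finally show ?thesis .
    qed
    finally show ?thesis .
  qed
  have far: "\<bar>t x\<bar> \<le> 1" if x: "x \<in> cube T" and i: "d < \<bar>x $ i - x\<^sub>0 $ i\<bar>" for x i
  proof -
    have "\<bar>x $ i\<bar> \<le> T" using x by (simp add: mem_cube abs_le_iff minus_le_iff)
    then have "\<bar>x $ i - x\<^sub>0 $ i\<bar> \<le> 2 * T - d" using \<mu>(2)[of i] d(2) by linarith
    then have ci: "cos (\<epsilon> * (x $ i - x\<^sub>0 $ i)) \<le> c" by (rule cos_far[OF i])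
    have "(\<Sum>j\<in>UNIV. cos (\<epsilon> * (x $ j - x\<^sub>0 $ j))) =
        cos (\<epsilon> * (x $ i - x\<^sub>0 $ i)) + (\<Sum>j\<in>UNIV - {i}. cos (\<epsilon> * (x $ j - x\<^sub>0 $ j)))"
      by (subst sum.remove[of UNIV i]) auto
    also have "\<dots> \<le> c + (\<Sum>j\<in>UNIV - {i}. 1)" by (intro add_mono ci sum_mono) auto
    also have "\<dots> = c + (n - 1)"
      by (simp add: n_def card_Diff_singleton of_nat_diff Suc_le_eq card_gt_0_iff)
    finally have up: "(\<Sum>j\<in>UNIV. cos (\<epsilon> * (x $ j - x\<^sub>0 $ j))) \<le> n - (1 - c)" by simp
    have lo: "- n \<le> (\<Sum>j\<in>UNIV. cos (\<epsilon> * (x $ j - x\<^sub>0 $ j)))"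
      using sum_mono[of "UNIV :: 'n set" "\<lambda>_. -1" "\<lambda>j. cos (\<epsilon> * (x $ j - x\<^sub>0 $ j))"]
      by (simp add: n_def)
    have "t x \<le> \<delta> + (1 / n) * (n - (1 - c))"
      unfolding t_def using n by (intro add_left_mono mult_left_mono up) auto
    also have "\<dots> = 1" using n by (simp add: \<delta>_def field_simps)
    finally have "t x \<le> 1" .
    moreover have "\<delta> + (1 / n) * (- n) \<le> t x"
      unfolding t_def using n by (intro add_left_mono mult_left_mono lo) auto
    ultimately show ?thesis using \<delta> n by simp
  qed
  have near_dist: "norm (x - x\<^sub>0) \<le> n * r" if "\<And>i. \<bar>x $ i - x\<^sub>0 $ i\<bar> \<le> r" for x r
  proof -
    have "norm (x - x\<^sub>0) \<le> (\<Sum>i\<in>UNIV. \<bar>(x - x\<^sub>0) $ i\<bar>)" by (rule norm_le_l1_cart)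
    also have "\<dots> \<le> (\<Sum>i\<in>(UNIV :: 'n set). r)" using that by (intro sum_mono) simp
    finally show ?thesis by (simp add: n_def)
  qed
  have h_near: "\<eta> \<le> h x" if "\<And>i. \<bar>x $ i - x\<^sub>0 $ i\<bar> \<le> d" "x \<in> cube T" for x
  proof -
    have "norm (x - x\<^sub>0) \<le> n * d" by (rule near_dist) (rule that)
    also have "\<dots> \<le> n * (d0 / (2 * n))" using d(4) n by (intro mult_left_mono) auto
    also have "\<dots> < d0" using n d0(1) by simp
    finally have "\<bar>h x - h x\<^sub>0\<bar> < \<eta>" by (intro d0(2) that(2)) (simp add: dist_norm)
    then show ?thesis unfolding h0 by linarith
  qed
  have t_near: "0 \<le> t x" if "\<And>i. \<bar>x $ i - x\<^sub>0 $ i\<bar> \<le> d" for x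
  proof -
    have "0 \<le> cos (\<epsilon> * (x $ i - x\<^sub>0 $ i))" for i
    proof -
      have "\<bar>\<epsilon> * (x $ i - x\<^sub>0 $ i)\<bar> \<le> \<epsilon> * d" using that[of i] \<epsilon> by (simp add: abs_mult)
      then show ?thesis using \<epsilon>d(2) by (intro cos_ge_zero) auto
    qed
    then show ?thesis using \<delta> n unfolding t_def by (intro add_nonneg_nonneg mult_nonneg_nonneg sum_nonneg) auto
  qed
  have t0: "t x\<^sub>0 = 1 + \<delta>" using n by (simp add: t_def n_def)
  obtain d1 where d1: "0 < d1" "\<And>x. dist x x\<^sub>0 < d1 \<Longrightarrow> \<bar>t x - t x\<^sub>0\<bar> < \<delta> / 2"
    using t_cont[of UNIV] \<delta> unfolding continuous_on_iff dist_real_def by (meson UNIV_I half_gt_zero)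
  define r where "r = min d (d1 / (2 * n))"
  have r: "0 < r" "r \<le> d" "n * r < d1"
  proof -
    show "0 < r" "r \<le> d" using d d1 n by (auto simp: r_def)
    have "n * r \<le> n * (d1 / (2 * n))" using n by (intro mult_left_mono) (auto simp: r_def)
    also have "\<dots> < d1" using n d1(1) by simp
    finally show "n * r < d1" .
  qed
  define D where "D = cbox (x\<^sub>0 - vec r) (x\<^sub>0 + vec r)"
  have memD: "\<bar>x $ i - x\<^sub>0 $ i\<bar> \<le> r" if "x \<in> D" for x i
    using that by (force simp: D_def mem_box_cart abs_le_iff algebra_simps)
  have DT: "D \<subseteq> cube T"
  proof
    fix x assume "x \<in> D"
    then have "\<bar>x $ i - x\<^sub>0 $ i\<bar> \<le> r" for i by (rule memD)
    then have "- T \<le> x $ i \<and> x $ i \<le> T" for i using \<mu>(2)[of i] d(2) r(2) by (smt (verit))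
    then show "x \<in> cube T" by (simp add: mem_cube)
  qed
  have contD: "0 < measure lborel D"
    unfolding D_def using r(1) by (subst content_cbox_cart) (auto simp: interval_ne_empty_cart intro!: prod_pos)
  have "bounded (h ` cube T)" by (intro compact_imp_bounded compact_continuous_image h) simp
  then obtain M where M: "\<And>x. x \<in> cube T \<Longrightarrow> \<bar>h x\<bar> \<le> M" unfolding bounded_iff by auto
  then have M0: "0 \<le> M" using x0T by (meson abs_ge_zero order_trans)
  define q where "q = 1 + \<delta> / 2"
  have q: "1 < q" using \<delta> by (simp add: q_def)
  \<comment> \<open>Adding \<open>M\<close> makes the integrand nonnegative on the whole cube: away
    from the peak \<open>|h * t ^ N| \<le> M\<close>, and near it both factors are nonnegative. Its
    integral is the same for all \<open>N\<close>, although it is at least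
    \<open>\<eta> * q ^ N\<close> on \<open>D\<close>.\<close>
  have key: "\<eta> * q ^ N * measure lborel D \<le> M * measure lborel (cube T :: (real ^ 'n) set)" for N
  proof -
    let ?F = "\<lambda>x. h x * t x ^ N + M"
    have Fc: "continuous_on (cube T) ?F" by (intro continuous_intros h t_cont)
    have I: "(?F has_integral 0 + measure lborel (cube T :: (real ^ 'n) set) *\<^sub>R M) (cube T)"
      unfolding cube_def by (intro has_integral_add hN[unfolded cube_def] has_integral_const)
    have ID: "?F integrable_on D"
      unfolding D_def by (intro integrable_continuous continuous_on_subset[OF Fc] DT[unfolded D_def])
    have "(\<lambda>_. \<eta> * q ^ N) integrable_on D" unfolding D_def by (rule integrable_const)
    then have "integral D (\<lambda>_. \<eta> * q ^ N) \<le> integral D ?F"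
    proof (rule integral_le[OF _ ID])
      fix x assume x: "x \<in> D"
      have xd: "\<bar>x $ i - x\<^sub>0 $ i\<bar> \<le> d" for i using memD[OF x, of i] r(2) by linarith
      have "\<eta> \<le> h x" by (rule h_near[OF xd]) (use x DT in auto)
      moreover have "q \<le> t x"
      proof -
        have "norm (x - x\<^sub>0) \<le> n * r" by (rule near_dist) (rule memD[OF x])
        then have "\<bar>t x - t x\<^sub>0\<bar> < \<delta> / 2" using r(3) by (intro d1(2)) (simp add: dist_norm)
        then show ?thesis unfolding t0 q_def by linarith
      qed
      ultimately have "\<eta> * q ^ N \<le> h x * t x ^ N"
        using \<eta> q by (intro mult_mono power_mono) auto
      then show "\<eta> * q ^ N \<le> ?F x" using M0 by simp
    qed
    also have "\<dots> \<le> integral (cube T) ?F"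
    proof (rule integral_subset_le[OF DT ID has_integral_integrable[OF I]], rule ballI)
      fix x :: "real ^ 'n" assume x: "x \<in> cube T"
      show "0 \<le> ?F x"
      proof (cases "\<exists>i. d < \<bar>x $ i - x\<^sub>0 $ i\<bar>")
        case True
        then have "\<bar>t x\<bar> \<le> 1" using far[OF x] by blast
        then have "\<bar>h x\<bar> * \<bar>t x\<bar> ^ N \<le> M * 1"
          using M[OF x] M0 by (intro mult_mono power_le_one) auto
        then have "\<bar>h x * t x ^ N\<bar> \<le> M" by (simp add: abs_mult power_abs)
        then show ?thesis by linarith
      next
        case False
        then have xd: "\<bar>x $ i - x\<^sub>0 $ i\<bar> \<le> d" for i by (simp add: not_less)
        have "0 \<le> h x" using h_near[OF xd x] \<eta> by linarith
        then show ?thesis using t_near[OF xd] M0 by simp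
      qed
    qed
    also have "\<dots> = measure lborel (cube T :: (real ^ 'n) set) * M" using I by (simp add: integral_unique)
    finally show ?thesis by (simp add: D_def mult_ac)
  qed
  define Q where "Q = M * measure lborel (cube T :: (real ^ 'n) set) / (\<eta> * measure lborel D)"
  obtain N where "Q < q ^ N" using real_arch_pow[OF q] by blast
  moreover have "q ^ N \<le> Q"
    using key[of N] \<eta> contD by (simp add: Q_def field_simps)
  ultimately show False by simp
qed

text \<open>Multiplication by the character of \<open>- \<theta>\<close> moves the shifted lattice
  back to the unshifted one. Absolute summability gives uniform convergence, so orthogonality shows
  that the series and \<open>g\<close> have the same Fourier coefficients, and uniqueness applies to
  their difference. As \<open>g\<close> is not periodic, the identity is claimed on the open cube
  only.\<close>

lemma fourier_inversion:
  fixes g :: "real ^ 'n::finite \<Rightarrow> complex" and kk :: "nat \<Rightarrow> 'n \<Rightarrow> int" and \<theta> :: "'n \<Rightarrow> real" and \<epsilon> :: real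
  defines "\<xi> \<equiv> \<lambda>j. \<chi> i. \<theta> i + \<epsilon> * of_int (kk j i)"
  defines "c \<equiv> \<lambda>j. of_real ((\<epsilon> / (2 * pi)) ^ CARD('n)) * integral (cube (pi / \<epsilon>)) (\<lambda>x. g x * character (- \<xi> j) x)"
  assumes \<epsilon>: "0 < \<epsilon>" and g: "continuous_on UNIV g" and kk: "bij kk"
    and c: "summable (\<lambda>j. norm (c j))" and x0: "\<And>i. \<bar>x\<^sub>0 $ i\<bar> < pi / \<epsilon>"
  shows "(\<Sum>j. c j * character (\<xi> j) x\<^sub>0) = g x\<^sub>0"
proof -
  define T where "T = pi / \<epsilon>"
  have T: "0 < T" using \<epsilon> by (simp add: T_def)
  define h where "h x = (\<Sum>j. c j * character (\<xi> j) x)" for x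
  have sm: "summable (\<lambda>j. c j * character (\<xi> j) x)" for x
    by (rule summable_norm_cancel) (use c in \<open>simp add: norm_mult\<close>)
  have "uniform_limit UNIV (\<lambda>n x. \<Sum>j<n. c j * character (\<xi> j) x) h sequentially"
    unfolding h_def by (rule Weierstrass_m_test[OF _ c]) (simp add: norm_mult)
  then have h: "continuous_on UNIV h"
    by (rule uniform_limit_theorem[rotated]) (auto intro!: always_eventually continuous_intros)
  define \<theta>v :: "real ^ 'n" where "\<theta>v = (\<chi> i. \<theta> i)"
  define G where "G x = (h x - g x) * character (- \<theta>v) x" for x
  have "G x\<^sub>0 = 0"
  proof (rule fourier_uniqueness[OF \<epsilon> _ _ x0])
    show "continuous_on (cube (pi / \<epsilon>)) G"
      unfolding G_def by (intro continuous_intros continuous_on_subset[OF h] continuous_on_subset[OF g]) auto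
    fix k :: "'n \<Rightarrow> int"
    \<comment> \<open>Uniqueness tests against characters, whereas \<open>c\<close> is defined with
      conjugate characters; hence the index that belongs to \<open>- k\<close>.\<close>
    obtain j where j: "kk j = (\<lambda>i. - k i)" using kk by (metis bij_pointE)
    have freq: "- \<theta>v + (\<chi> i. \<epsilon> * of_int (k i)) = - \<xi> j"
      by (simp add: vec_eq_iff \<theta>v_def \<xi>_def j)
    have "uniform_limit (cube T) (\<lambda>n x. \<Sum>l<n. c l * character (\<xi> l - \<xi> j) x)
        (\<lambda>x. \<Sum>l. c l * character (\<xi> l - \<xi> j) x) sequentially"
      by (rule Weierstrass_m_test[OF _ c]) (simp add: norm_mult)
    moreover have "(\<Sum>l. c l * character (\<xi> l - \<xi> j) x) = h x * character (- \<xi> j) x" for x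
    proof -
      have "c l * character (\<xi> l - \<xi> j) x = (c l * character (\<xi> l) x) * character (- \<xi> j) x" for l
        using character_add[of "\<xi> l" "- \<xi> j" x] by simp
      then have "(\<Sum>l. c l * character (\<xi> l - \<xi> j) x) = (\<Sum>l. (c l * character (\<xi> l) x) * character (- \<xi> j) x)"
        by (rule suminf_cong)
      also have "\<dots> = h x * character (- \<xi> j) x" unfolding h_def by (rule suminf_mult2[OF sm, symmetric])
      finally show ?thesis .
    qed
    ultimately have ul: "uniform_limit (cbox (vec (- T)) (vec T)) (\<lambda>n x. \<Sum>l<n. c l * character (\<xi> l - \<xi> j) x)
        (\<lambda>x. h x * character (- \<xi> j) x) sequentially" by (simp add: cube_def)
    obtain I J where IJ: "\<And>n. ((\<lambda>x. \<Sum>l<n. c l * character (\<xi> l - \<xi> j) x) has_integral I n) (cbox (vec (- T)) (vec T))"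
      "((\<lambda>x. h x * character (- \<xi> j) x) has_integral J) (cbox (vec (- T)) (vec T))" "I \<longlonglongrightarrow> J"
      by (rule uniform_limit_integral_cbox[OF ul]) (auto intro!: continuous_intros)
    have each: "(character (\<xi> l - \<xi> j) has_integral (if l = j then of_real ((2 * T) ^ CARD('n)) else 0))
        (cbox (vec (- T)) (vec T))" for l
    proof (cases "l = j")
      case True
      have "((\<lambda>x. 1 :: complex) has_integral measure lborel (cube T :: (real ^ 'n) set) *\<^sub>R 1) (cube T :: (real ^ 'n) set)"
        unfolding cube_def by (rule has_integral_const)
      then show ?thesis using True T
        by (simp add: content_cube cube_def[symmetric] scaleR_conv_of_real character_def[abs_def])
    next
      case False
      have "(\<lambda>i. kk l i - kk j i) \<noteq> (\<lambda>_. 0)"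
      proof
        assume "(\<lambda>i. kk l i - kk j i) = (\<lambda>_. 0)"
        then have "kk l = kk j" by (auto simp: fun_eq_iff)
        then show False using False kk by (auto simp: bij_def inj_def)
      qed
      from integral_character_cube[OF \<epsilon> this]
      have "integral (cube T) (character (\<xi> l - \<xi> j)) = 0"
        by (simp add: T_def \<xi>_def algebra_simps minus_vec_def)
      moreover have "character (\<xi> l - \<xi> j) integrable_on (cube T)"
        unfolding cube_def by (intro integrable_continuous continuous_intros)
      ultimately show ?thesis using False by (simp add: has_integral_iff cube_def)
    qed
    have In: "I n = c j * of_real ((2 * T) ^ CARD('n))" if "j < n" for n
    proof -
      have "((\<lambda>x. \<Sum>l<n. c l * character (\<xi> l - \<xi> j) x) has_integral
          (\<Sum>l<n. c l * (if l = j then of_real ((2 * T) ^ CARD('n)) else 0))) (cbox (vec (- T)) (vec T))"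
        by (intro has_integral_sum has_integral_mult_right each) auto
      then have "I n = (\<Sum>l<n. c l * (if l = j then of_real ((2 * T) ^ CARD('n)) else 0))"
        using IJ(1)[of n] by (rule has_integral_unique[symmetric])
      also have "\<dots> = (\<Sum>l<n. if l = j then c l * of_real ((2 * T) ^ CARD('n)) else 0)"
        by (intro sum.cong) auto
      also have "\<dots> = c j * of_real ((2 * T) ^ CARD('n))" using that by (subst sum.delta) auto
      finally show ?thesis .
    qed
    have "I \<longlonglongrightarrow> c j * of_real ((2 * T) ^ CARD('n))"
      by (rule tendsto_eventually, rule eventually_sequentiallyI[of "Suc j"]) (simp add: In)
    then have J: "J = c j * of_real ((2 * T) ^ CARD('n))" using IJ(3) LIMSEQ_unique by blast
    have "J = integral (cube T) (\<lambda>x. g x * character (- \<xi> j) x)"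
    proof -
      have "(\<epsilon> / (2 * pi)) ^ CARD('n) * (2 * T) ^ CARD('n) = 1"
        using \<epsilon> by (simp add: T_def flip: power_mult_distrib)
      then have 1: "complex_of_real ((\<epsilon> / (2 * pi)) ^ CARD('n)) * of_real ((2 * T) ^ CARD('n)) = 1"
        by (metis of_real_1 of_real_mult)
      have "J = (complex_of_real ((\<epsilon> / (2 * pi)) ^ CARD('n)) * of_real ((2 * T) ^ CARD('n))) *
          integral (cube T) (\<lambda>x. g x * character (- \<xi> j) x)"
        unfolding J c_def T_def[symmetric] by (simp only: mult_ac)
      then show ?thesis by (simp only: 1 mult_1)
    qed
    moreover have "(\<lambda>x. g x * character (- \<xi> j) x) integrable_on cube T"
      unfolding cube_def by (intro integrable_continuous continuous_intros continuous_on_subset[OF g]) auto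
    ultimately have "((\<lambda>x. g x * character (- \<xi> j) x) has_integral J) (cube T)"
      by (simp add: has_integral_iff)
    from has_integral_diff[OF IJ(2)[folded cube_def] this]
    have diff: "((\<lambda>x. h x * character (- \<xi> j) x - g x * character (- \<xi> j) x) has_integral 0) (cube T)"
      by simp
    have "G x * character (\<chi> i. \<epsilon> * of_int (k i)) x =
        h x * character (- \<xi> j) x - g x * character (- \<xi> j) x" for x
      unfolding freq[symmetric] character_add G_def by (simp only: left_diff_distrib mult.assoc)
    with diff have "((\<lambda>x. G x * character (\<chi> i. \<epsilon> * of_int (k i)) x) has_integral 0) (cube T)"
      by (simp only:)
    then show "integral (cube (pi / \<epsilon>)) (\<lambda>x. G x * character (\<chi> i. \<epsilon> * of_int (k i)) x) = 0"
      by (simp add: T_def integral_unique)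
  qed
  moreover have "character (- \<theta>v) x\<^sub>0 \<noteq> 0" using norm_character[of "- \<theta>v" x\<^sub>0] by (metis norm_zero zero_neq_one)
  ultimately show ?thesis by (simp add: G_def h_def)
qed

section \<open>Solving the equation on a large cube\<close>

lemma foldr_partial_outside:
  assumes "closed K" "\<And>x. x \<notin> K \<Longrightarrow> g x = 0" "x \<notin> K"
  shows "foldr partial is g x = 0"
proof -
  have "foldr partial is g x = foldr partial is (\<lambda>_. 0) x"
    by (rule foldr_partial_cong[of "- K"]) (use assms in auto)
  then show ?thesis by (simp add: foldr_partial_const split: if_splits)
qed

lemma closed_cube: "closed (cube R)"
  by (simp add: cube_def closed_cbox)

section \<open>Fourier coefficients of functions supported in a fixed cube\<close>

definition fourier :: "real \<Rightarrow> (real ^ 'n::finite \<Rightarrow> complex) \<Rightarrow> real ^ 'n \<Rightarrow> complex" where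
  "fourier T g \<xi> = integral (cube T) (\<lambda>x. g x * character (- \<xi>) x)"

text \<open>Integration by parts: the support lies strictly inside the cube of integration, so the
  derivative of \<open>g\<close> times the character has integral zero.\<close>

lemma fourier_partial:
  assumes g: "smooth_on UNIV g" and supp: "\<And>x. x \<notin> cube R \<Longrightarrow> g x = 0" and RT: "R < T"
  shows "fourier T (partial i g) \<xi> = \<i> * of_real (\<xi> $ i) * fourier T g \<xi>"
proof -
  let ?F = "\<lambda>x. g x * character (- \<xi>) x"
  have F: "smooth_on UNIV ?F" by (intro smooth_on_mult g smooth_on_character) simp
  have c: "continuous_on S g" "continuous_on S (partial i g)" for S
    using smooth_on_continuous[OF g, of "[]"] smooth_on_continuous[OF g, of "[i]"]
    by (auto intro: continuous_on_subset)
  have int: "(\<lambda>x. g x * character (- \<xi>) x) integrable_on cube T"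
    "(\<lambda>x. partial i g x * character (- \<xi>) x) integrable_on cube T"
    unfolding cube_def by (intro integrable_continuous continuous_intros c)+
  have dF: "partial i ?F x = partial i g x * character (- \<xi>) x - \<i> * of_real (\<xi> $ i) * (g x * character (- \<xi>) x)" for x
  proof -
    have "partial i ?F x = partial i g x * character (- \<xi>) x + g x * partial i (character (- \<xi>)) x"
      using smooth_on_imp_differentiable[OF g open_UNIV UNIV_I, of "[]" x]
        smooth_on_imp_differentiable[OF smooth_on_character open_UNIV UNIV_I, of "[]"]
      by (intro partial_mult) simp_all
    moreover have "partial i (character (- \<xi>)) x = - \<i> * of_real (\<xi> $ i) * character (- \<xi>) x"
      using partial_cmult_character[of i 1 "- \<xi>"] by simp
    ultimately show ?thesis by (simp add: algebra_simps)
  qed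
  have "integral (cube T) (partial i ?F) = 0"
  proof (rule integral_partial_eq_0[OF _ _ _ RT])
    show "?F differentiable_on UNIV" using F unfolding smooth_on_def by (metis foldr_Nil id_apply)
    show "continuous_on UNIV (partial i ?F)" using smooth_on_continuous[OF F, of "[i]"] by simp
  qed (simp add: supp)
  then have "fourier T (partial i g) \<xi> - \<i> * of_real (\<xi> $ i) * fourier T g \<xi> = 0"
    unfolding dF fourier_def using int integrable_on_mult_right[OF int(1)]
    by (subst (asm) integral_diff) auto
  then show ?thesis by simp
qed

lemma fourier_foldr_partial:
  assumes g: "smooth_on UNIV g" and supp: "\<And>x. x \<notin> cube R \<Longrightarrow> g x = 0" and RT: "R < T"
  shows "fourier T (foldr partial is g) \<xi> = (\<Prod>i\<leftarrow>is. \<i> * of_real (\<xi> $ i)) * fourier T g \<xi>"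
proof (induction "is")
  case (Cons i "is")
  have "fourier T (partial i (foldr partial is g)) \<xi> = \<i> * of_real (\<xi> $ i) * fourier T (foldr partial is g) \<xi>"
    by (rule fourier_partial[OF smooth_on_foldr_partial[OF g] _ RT])
      (rule foldr_partial_outside[OF closed_cube supp])
  then show ?case by (simp add: Cons)
qed simp

text \<open>The volume that enters is that of the support cube, not of the cube of integration, so
  the bound does not deteriorate as \<open>T\<close> grows.\<close>

lemma norm_fourier_le:
  fixes g :: "real ^ 'n::finite \<Rightarrow> complex"
  assumes g: "continuous_on UNIV g" and supp: "\<And>x. x \<notin> cube R \<Longrightarrow> g x = 0" and RT: "0 \<le> R" "R < T"
    and G: "\<And>x. norm (g x) \<le> G"
  shows "norm (fourier T g \<xi>) \<le> G * (2 * R) ^ CARD('n)"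
proof -
  have G0: "0 \<le> G" using G norm_ge_zero order_trans by blast
  let ?F = "\<lambda>x. g x * character (- \<xi>) x"
  have I: "(?F has_integral integral (cube R) ?F) (cube R)"
    unfolding cube_def by (intro integrable_integral integrable_continuous continuous_intros continuous_on_subset[OF g]) simp
  have "(?F has_integral integral (cube R) ?F) (cube T)"
    by (rule has_integral_on_superset[OF I]) (use supp RT cube_mono[of R T] in auto)
  then have "fourier T g \<xi> = integral (cube R) ?F" unfolding fourier_def by (rule integral_unique)
  also have "norm \<dots> \<le> G * measure lborel (cube R :: (real ^ 'n) set)"
    using I[unfolded cube_def] G G0 unfolding cube_def by (intro has_integral_bound) (auto simp: norm_mult)
  finally show ?thesis by (simp add: content_cube RT)
qed

lemma norm_prod_list_replicate:
  assumes "distinct xs"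
  shows "norm (\<Prod>i\<leftarrow>concat (map (replicate M) xs). \<i> * complex_of_real (f i)) = (\<Prod>i\<in>set xs. \<bar>f i\<bar> ^ M)"
proof -
  have "norm (\<Prod>i\<leftarrow>replicate M j. \<i> * complex_of_real (f i)) = \<bar>f j\<bar> ^ M" for j
    by (induction M) (auto simp: norm_mult)
  then show ?thesis using assms by (induction xs) (auto simp: norm_mult)
qed

lemma power_1_plus_le: "0 \<le> a \<Longrightarrow> (1 + a) ^ M \<le> 2 ^ M * (1 + a ^ M)" for a :: real
proof (cases "a \<le> 1")
  case True
  moreover assume "0 \<le> a"
  ultimately have "(1 + a) ^ M \<le> 2 ^ M" by (intro power_mono) auto
  also have "\<dots> \<le> 2 ^ M * (1 + a ^ M)" using \<open>0 \<le> a\<close> by simp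
  finally show ?thesis .
next
  case False
  then have "(1 + a) ^ M \<le> (2 * a) ^ M" by (intro power_mono) auto
  also have "\<dots> = 2 ^ M * a ^ M" by (rule power_mult_distrib)
  also have "\<dots> \<le> 2 ^ M * (1 + a ^ M)" by simp
  finally show ?thesis .
qed

text \<open>Up to powers of 2 the product is bounded by that of the
  \<open>1 + |\<xi> $ i| ^ M\<close>, which expands into a sum over subsets of the coordinates. The
  term of a subset is controlled by differentiating \<open>g\<close> \<open>M\<close> times in each
  of its directions.\<close>

lemma fourier_decay:
  fixes g :: "real ^ 'n::finite \<Rightarrow> complex"
  assumes g: "smooth_on UNIV g" and supp: "\<And>x. x \<notin> cube R \<Longrightarrow> g x = 0" and RT: "0 \<le> R" "R < T"
    and G: "\<And>js x. length js \<le> CARD('n) * M \<Longrightarrow> norm (foldr partial js g x) \<le> G"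
  shows "(\<Prod>i\<in>UNIV. (1 + \<bar>\<xi> $ i\<bar>) ^ M) * norm (fourier T g \<xi>)
    \<le> (2 ^ M) ^ CARD('n) * 2 ^ CARD('n) * (G * (2 * R) ^ CARD('n))"
proof -
  define B where "B = G * (2 * R) ^ CARD('n)"
  have each: "(\<Prod>i\<in>S. \<bar>\<xi> $ i\<bar> ^ M) * norm (fourier T g \<xi>) \<le> B" for S :: "'n set"
  proof -
    obtain xs where xs: "set xs = S" "distinct xs" using finite_distinct_list[of S] by auto
    define js where "js = concat (map (replicate M) xs)"
    have "length js = M * card S"
      using distinct_card[OF xs(2)] xs(1) by (simp add: js_def length_concat o_def sum_list_triv)
    also have "\<dots> \<le> CARD('n) * M" by (simp add: card_mono)
    finally have len: "length js \<le> CARD('n) * M" .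
    have "norm (fourier T (foldr partial js g) \<xi>) \<le> B"
      unfolding B_def
      by (rule norm_fourier_le[OF smooth_on_continuous[OF g] foldr_partial_outside[OF closed_cube supp] RT G[OF len]])
    also have "fourier T (foldr partial js g) \<xi> = (\<Prod>i\<leftarrow>js. \<i> * of_real (\<xi> $ i)) * fourier T g \<xi>"
      by (rule fourier_foldr_partial[OF g supp RT(2)])
    finally show ?thesis
      unfolding norm_mult js_def norm_prod_list_replicate[OF xs(2)] xs(1) .
  qed
  have "(\<Prod>i\<in>UNIV. (1 + \<bar>\<xi> $ i\<bar>) ^ M) \<le> (\<Prod>i\<in>(UNIV :: 'n set). 2 ^ M * (1 + \<bar>\<xi> $ i\<bar> ^ M))"
    by (intro prod_mono conjI power_1_plus_le) auto
  also have "\<dots> = (2 ^ M) ^ CARD('n) * (\<Prod>i\<in>(UNIV :: 'n set). \<bar>\<xi> $ i\<bar> ^ M + 1)"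
    by (simp add: prod.distrib add.commute)
  also have "(\<Prod>i\<in>(UNIV :: 'n set). \<bar>\<xi> $ i\<bar> ^ M + 1) = (\<Sum>S\<in>Pow UNIV. \<Prod>i\<in>S. \<bar>\<xi> $ i\<bar> ^ M)"
    by (subst prod_add) auto
  finally have "(\<Prod>i\<in>UNIV. (1 + \<bar>\<xi> $ i\<bar>) ^ M) * norm (fourier T g \<xi>) \<le>
      (2 ^ M) ^ CARD('n) * (\<Sum>S\<in>Pow UNIV. \<Prod>i\<in>S. \<bar>\<xi> $ i\<bar> ^ M) * norm (fourier T g \<xi>)"
    by (intro mult_right_mono) auto
  also have "\<dots> = (2 ^ M) ^ CARD('n) * (\<Sum>S\<in>Pow UNIV. (\<Prod>i\<in>S. \<bar>\<xi> $ i\<bar> ^ M) * norm (fourier T g \<xi>))"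
    by (simp add: sum_distrib_right mult.assoc)
  also have "\<dots> \<le> (2 ^ M) ^ CARD('n) * (\<Sum>S\<in>Pow (UNIV :: 'n set). B)"
    by (intro mult_left_mono sum_mono each) auto
  also have "\<dots> = (2 ^ M) ^ CARD('n) * 2 ^ CARD('n) * B" by (simp add: card_Pow)
  finally show ?thesis by (simp add: B_def)
qed

lemma prod_list_count:
  fixes f :: "'n::finite \<Rightarrow> 'a::comm_monoid_mult"
  shows "(\<Prod>i\<leftarrow>is. f i) = (\<Prod>i\<in>UNIV. f i ^ count (mset is) i)"
proof (induction "is")
  case (Cons j "is")
  have "(\<Prod>i\<in>UNIV. f i ^ count (mset (j # is)) i) = (\<Prod>i\<in>UNIV. (if i = j then f i else 1) * f i ^ count (mset is) i)"
    by (intro prod.cong) auto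
  also have "\<dots> = f j * (\<Prod>i\<in>UNIV. f i ^ count (mset is) i)"
    unfolding prod.distrib by (simp add: prod.delta)
  finally show ?case using Cons by simp
qed simp

lemma prod_list_mi_list:
  "(\<Prod>i\<leftarrow>mi_list \<alpha>. \<i> * complex_of_real (\<xi> $ i)) = \<i> ^ mi_size \<alpha> * of_real (mi_power \<xi> \<alpha>)"
  by (simp add: prod_list_count count_mi_list power_mult_distrib prod.distrib power_sum mi_size_def mi_power_def)

text \<open>A qualitative bound for a single function, used only to establish convergence; the
  quantitative estimates refer to a given bound \<open>G\<close>.\<close>

lemma compactly_supported_bound:
  fixes g :: "real ^ 'n::finite \<Rightarrow> complex"
  assumes g: "smooth_on UNIV g" and supp: "\<And>x. x \<notin> cube R \<Longrightarrow> g x = 0"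
  shows "\<exists>G. \<forall>js x. length js \<le> L \<longrightarrow> norm (foldr partial js g x) \<le> G"
proof -
  have "\<exists>G\<ge>0. \<forall>x. norm (foldr partial js g x) \<le> G" for js
  proof -
    have "bounded (foldr partial js g ` cube R)"
      by (intro compact_imp_bounded compact_continuous_image continuous_on_subset[OF smooth_on_continuous[OF g]]) auto
    then obtain G where G: "\<And>x. x \<in> cube R \<Longrightarrow> norm (foldr partial js g x) \<le> G" unfolding bounded_iff by auto
    moreover have "foldr partial js g x = 0" if "x \<notin> cube R" for x
      using that by (intro foldr_partial_outside[OF closed_cube supp])
    ultimately have "norm (foldr partial js g x) \<le> max G 0" for x
      by (cases "x \<in> cube R") (auto simp: max.coboundedI1)
    then show ?thesis by (intro exI[of _ "max G 0"]) auto
  qed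
  then have "\<forall>js. \<exists>G. 0 \<le> G \<and> (\<forall>x. norm (foldr partial js g x) \<le> G)" by blast
  from choice[OF this] obtain G where G: "\<And>js. 0 \<le> G js" "\<And>js x. norm (foldr partial js g x) \<le> G js" by blast
  have fin: "finite {js :: 'n list. length js \<le> L}"
    using finite_lists_length_le[of "UNIV :: 'n set" L] by simp
  have "norm (foldr partial js g x) \<le> (\<Sum>js | length js \<le> L. G js)" if "length js \<le> L" for js x
  proof -
    have "G js \<le> (\<Sum>js | length js \<le> L. G js)"
      by (rule member_le_sum) (use that G(1) fin in auto)
    then show ?thesis by (rule order_trans[OF G(2)])
  qed
  then show ?thesis by blast
qed

text \<open>\<open>C\<close>, \<open>E\<close> and \<open>L\<close> are fixed before \<epsilon>, the
  coefficients and the data. The loss is one factor \<open>1 / norm (a \<alpha>\<^sub>0)\<close>, a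
  power of \<open>1 / \<epsilon>\<close> and finitely many derivatives, which is the form in which
  moderateness passes from \<open>g\<close> to \<open>u\<close>.\<close>

theorem solve_on_cube:
  fixes m :: nat and R :: real
  assumes R: "0 \<le> R"
  shows "\<exists>C :: nat \<Rightarrow> real. \<exists>E L :: nat \<Rightarrow> nat.
    \<forall>\<epsilon> (a :: 'n::finite multiindex \<Rightarrow> complex) \<alpha>\<^sub>0 g.
      0 < \<epsilon> \<longrightarrow> \<epsilon> \<le> 1 \<longrightarrow> R < pi / \<epsilon> \<longrightarrow> mi_size \<alpha>\<^sub>0 \<le> m \<longrightarrow> a \<alpha>\<^sub>0 \<noteq> 0 \<longrightarrow>
      smooth_on UNIV g \<longrightarrow> (\<forall>x. x \<notin> cube R \<longrightarrow> g x = 0) \<longrightarrow>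
      (\<exists>u. smooth_on UNIV u \<and>
        (\<forall>x. (\<forall>i. \<bar>x $ i\<bar> < pi / \<epsilon>) \<longrightarrow>
           (\<Sum>\<alpha> | mi_size \<alpha> \<le> m. a \<alpha> * ((- \<i>) ^ mi_size \<alpha> * mi_deriv \<alpha> u x)) = g x) \<and>
        (\<forall>is G. (\<forall>js x. length js \<le> L (length is) \<longrightarrow> norm (foldr partial js g x) \<le> G) \<longrightarrow>
           (\<forall>x. norm (foldr partial is u x) \<le> C (length is) * G / (norm (a \<alpha>\<^sub>0) * \<epsilon> ^ E (length is)))))"
proof -
  obtain c0 N0 where c0: "0 < c0" and shift: "\<forall>(a :: 'n multiindex \<Rightarrow> complex) \<epsilon> \<alpha>\<^sub>0.
    0 \<le> \<epsilon> \<longrightarrow> \<epsilon> \<le> 1 \<longrightarrow> mi_size \<alpha>\<^sub>0 \<le> m \<longrightarrow> a \<alpha>\<^sub>0 \<noteq> 0 \<longrightarrow>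
    (\<exists>\<theta> :: 'n \<Rightarrow> real. (\<forall>i. 0 \<le> \<theta> i \<and> \<theta> i \<le> 1) \<and>
      (\<forall>k. c0 * norm (a \<alpha>\<^sub>0) / lattice_weight k ^ N0 \<le>
        norm (\<Sum>\<alpha> | mi_size \<alpha> \<le> m. a \<alpha> * of_real (mi_power (\<chi> i. \<theta> i + \<epsilon> * real_of_int (k i)) \<alpha>))))"
    using exists_lattice_shift_avoiding_zeros[of m, where 'n = 'n] by (elim exE conjE)
  obtain kk :: "nat \<Rightarrow> 'n \<Rightarrow> int" where kk: "bij kk" "summable (\<lambda>j. 1 / (lattice_weight (kk j))\<^sup>2)"
    by (rule lattice_enumeration)
  define W where "W j = lattice_weight (kk j)" for j
  have W1: "1 \<le> W j" for j unfolding W_def by (rule lattice_weight_ge_1)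
  have Wsum: "summable (\<lambda>j. 1 / (W j)\<^sup>2)" using kk(2) by (simp add: W_def)
  define S where "S = (\<Sum>j. 1 / (W j)\<^sup>2)"
  define n where "n = CARD('n)"
  \<comment> \<open>\<open>N0\<close> powers of the weight pay for the division by the symbol,
    \<open>l\<close> for the derivatives of the solution and 2 for summability. Decay of order
    \<open>M l\<close> in every coordinate takes \<open>n * M l\<close> derivatives of
    \<open>g\<close>, which explains \<open>L\<close>.\<close>
  define M where "M l = N0 + l + 2" for l
  define L where "L l = n * M l" for l
  define K where "K l = (2 ^ M l) ^ n * 2 ^ n * (2 * R) ^ n * (2 ^ (n * M l))" for l
  define C where "C l = K l / c0 * S" for l
  show ?thesis
  \<comment> \<open>\<open>E\<close> and \<open>L\<close> are both instantiated with
    \<open>L\<close>: the decay of total order \<open>n * M l\<close> costs equally many factors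
    \<open>1 / \<epsilon>\<close> in the comparison \<open>W_le\<close>.\<close>
  proof (intro exI[of _ C] exI[of _ L] allI impI)
    fix \<epsilon> :: real and a :: "'n multiindex \<Rightarrow> complex" and \<alpha>\<^sub>0 and g :: "real ^ 'n \<Rightarrow> complex"
    assume \<epsilon>: "0 < \<epsilon>" "\<epsilon> \<le> 1" "R < pi / \<epsilon>" and \<alpha>\<^sub>0: "mi_size \<alpha>\<^sub>0 \<le> m" "a \<alpha>\<^sub>0 \<noteq> 0"
      and g: "smooth_on UNIV g" and supp': "\<forall>x. x \<notin> cube R \<longrightarrow> g x = 0"
    then have supp: "\<And>x. x \<notin> cube R \<Longrightarrow> g x = 0" by blast
    define T where "T = pi / \<epsilon>"
    have RT: "R < T" using \<epsilon>(3) by (simp add: T_def)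
    obtain \<theta> :: "'n \<Rightarrow> real" where \<theta>: "\<And>i. 0 \<le> \<theta> i \<and> \<theta> i \<le> 1"
      and lower: "\<And>k. c0 * norm (a \<alpha>\<^sub>0) / lattice_weight k ^ N0 \<le>
        norm (\<Sum>\<alpha> | mi_size \<alpha> \<le> m. a \<alpha> * of_real (mi_power (\<chi> i. \<theta> i + \<epsilon> * real_of_int (k i)) \<alpha>))"
      using shift[rule_format, of \<epsilon> \<alpha>\<^sub>0 a] \<epsilon> \<alpha>\<^sub>0 by auto
    define \<xi> :: "nat \<Rightarrow> real ^ 'n" where "\<xi> j = (\<chi> i. \<theta> i + \<epsilon> * real_of_int (kk j i))" for j
    have freq: "\<bar>\<xi> j $ i\<bar> \<le> W j" for j i
    proof -
      have "\<bar>\<epsilon> * real_of_int (kk j i)\<bar> \<le> 1 * \<bar>real_of_int (kk j i)\<bar>"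
        unfolding abs_mult using \<epsilon> by (intro mult_right_mono) auto
      then have "\<bar>\<theta> i + \<epsilon> * real_of_int (kk j i)\<bar> \<le> 1 + \<bar>real_of_int (kk j i)\<bar>"
        using \<theta>[of i] by linarith
      then show ?thesis using lattice_weight_ge[of "kk j" i] by (simp add: \<xi>_def W_def)
    qed
    \<comment> \<open>The weight measures the lattice index \<open>k\<close>, but the Fourier
      transform decays in the frequency \<theta> + \<epsilon>k. Passing from one to the other costs
      \<open>2 / \<epsilon>\<close> per coordinate and power; this is where the powers of
      \<open>1 / \<epsilon>\<close> come from.\<close>
    have W_le: "W j ^ q \<le> (2 / \<epsilon>) ^ (n * q) * (\<Prod>i\<in>UNIV. (1 + \<bar>\<xi> j $ i\<bar>) ^ q)" for j q
    proof -
      have "1 + \<bar>real_of_int (kk j i)\<bar> \<le> (2 / \<epsilon>) * (1 + \<bar>\<xi> j $ i\<bar>)" for i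
      proof -
        have "\<epsilon> * real_of_int (kk j i) = \<xi> j $ i - \<theta> i" by (simp add: \<xi>_def)
        moreover have "\<epsilon> * \<bar>real_of_int (kk j i)\<bar> = \<bar>\<epsilon> * real_of_int (kk j i)\<bar>"
          using \<epsilon>(1) by (simp add: abs_mult)
        ultimately have "\<epsilon> * \<bar>real_of_int (kk j i)\<bar> = \<bar>\<xi> j $ i - \<theta> i\<bar>" by simp
        moreover have "\<bar>\<xi> j $ i - \<theta> i\<bar> \<le> \<bar>\<xi> j $ i\<bar> + 1" using \<theta>[of i] by linarith
        ultimately have "\<epsilon> * \<bar>real_of_int (kk j i)\<bar> \<le> \<bar>\<xi> j $ i\<bar> + 1" by simp
        then have "\<epsilon> + \<epsilon> * \<bar>real_of_int (kk j i)\<bar> \<le> 1 + (\<bar>\<xi> j $ i\<bar> + 1)"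
          using \<epsilon>(2) by (intro add_mono)
        also have "\<dots> \<le> 2 * (1 + \<bar>\<xi> j $ i\<bar>)" by simp
        finally have "\<epsilon> * (1 + \<bar>real_of_int (kk j i)\<bar>) \<le> 2 * (1 + \<bar>\<xi> j $ i\<bar>)"
          by (simp add: distrib_left)
        then show ?thesis using \<epsilon> by (simp add: field_simps)
      qed
      then have "W j \<le> (\<Prod>i\<in>(UNIV :: 'n set). (2 / \<epsilon>) * (1 + \<bar>\<xi> j $ i\<bar>))"
        unfolding W_def lattice_weight_def by (intro prod_mono) auto
      also have "\<dots> = (2 / \<epsilon>) ^ n * (\<Prod>i\<in>UNIV. 1 + \<bar>\<xi> j $ i\<bar>)"
        unfolding prod.distrib n_def by simp
      finally have "W j ^ q \<le> ((2 / \<epsilon>) ^ n * (\<Prod>i\<in>UNIV. 1 + \<bar>\<xi> j $ i\<bar>)) ^ q"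
        using W1[of j] by (intro power_mono) auto
      then show ?thesis by (simp add: power_mult_distrib power_mult prod_power_distrib)
    qed
    interpret frequency_sequence \<xi> W by unfold_locales (rule W1 Wsum freq)+
    define c where "c j = of_real ((\<epsilon> / (2 * pi)) ^ CARD('n)) * integral (cube (pi / \<epsilon>)) (\<lambda>x. g x * character (- \<xi> j) x)" for j
    define p where "p j = (\<Sum>\<alpha> | mi_size \<alpha> \<le> m. a \<alpha> * of_real (mi_power (\<xi> j) \<alpha>))" for j
    define A where "A = norm (a \<alpha>\<^sub>0)"
    have A: "0 < A" using \<alpha>\<^sub>0 by (simp add: A_def)
    have p_lower: "c0 * A / W j ^ N0 \<le> norm (p j)" for j
      using lower[of "kk j"] by (simp add: p_def \<xi>_def W_def A_def)
    have p0: "0 < norm (p j)" for j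
      by (rule less_le_trans[OF _ p_lower]) (use c0 A W1[of j] in \<open>auto intro!: divide_pos_pos mult_pos_pos zero_less_power\<close>)
    \<comment> \<open>The operator multiplies the \<open>j\<close>-th character by
      \<open>p j\<close>, so dividing the Fourier coefficients of \<open>g\<close> by it solves the
      equation term by term.\<close>
    define b where "b j = c j / p j" for j
    have norm_c: "norm (c j) \<le> norm (fourier T g (\<xi> j))" for j
    proof -
      have "(\<epsilon> / (2 * pi)) ^ CARD('n) \<le> 1"
        using \<epsilon> pi_ge_two by (intro power_le_one) (auto simp: divide_le_eq)
      then have "\<bar>(\<epsilon> / (2 * pi)) ^ CARD('n)\<bar> * norm (fourier T g (\<xi> j)) \<le> 1 * norm (fourier T g (\<xi> j))"
        using \<epsilon> by (intro mult_right_mono) auto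
      then show ?thesis unfolding c_def fourier_def T_def norm_mult norm_of_real by simp
    qed
    have b_le: "norm (b j) * W j ^ (l + 2) \<le> K l * G / (c0 * A * \<epsilon> ^ L l)"
      if G: "\<And>js x. length js \<le> L l \<Longrightarrow> norm (foldr partial js g x) \<le> G" for j l G
    proof -
      have "norm (b j) * W j ^ (l + 2) = norm (c j) * W j ^ (l + 2) / norm (p j)"
        by (simp add: b_def norm_divide)
      also have "\<dots> \<le> norm (c j) * W j ^ (l + 2) / (c0 * A / W j ^ N0)"
        using W1[of j] c0 A p0[of j]
        by (intro divide_left_mono p_lower) (auto intro!: divide_pos_pos mult_pos_pos zero_less_power)
      also have "\<dots> = norm (c j) * W j ^ M l / (c0 * A)" by (simp add: M_def power_add mult_ac)
      also have "\<dots> \<le> (K l * G / \<epsilon> ^ L l) / (c0 * A)"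
      proof (rule divide_right_mono)
        have "norm (c j) * W j ^ M l \<le>
            norm (fourier T g (\<xi> j)) * ((2 / \<epsilon>) ^ (n * M l) * (\<Prod>i\<in>UNIV. (1 + \<bar>\<xi> j $ i\<bar>) ^ M l))"
          using W1[of j] by (intro mult_mono norm_c W_le) auto
        also have "\<dots> = (2 / \<epsilon>) ^ (n * M l) * ((\<Prod>i\<in>UNIV. (1 + \<bar>\<xi> j $ i\<bar>) ^ M l) * norm (fourier T g (\<xi> j)))"
          by (simp add: mult_ac)
        also have "\<dots> \<le> (2 / \<epsilon>) ^ (n * M l) * ((2 ^ M l) ^ n * 2 ^ n * (G * (2 * R) ^ n))"
          unfolding n_def using G \<epsilon>
          by (intro mult_left_mono fourier_decay[OF g supp R RT]) (auto simp: L_def n_def)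
        also have "\<dots> = K l * G / \<epsilon> ^ L l"
          by (simp add: K_def L_def power_divide mult_ac)
        finally show "norm (c j) * W j ^ M l \<le> K l * G / \<epsilon> ^ L l" .
      qed (use c0 A in simp)
      finally show ?thesis by (simp add: mult_ac)
    qed
    have b: "rapid b"
      unfolding rapid_def
    proof
      fix l
      obtain G where G: "\<And>js x. length js \<le> L l \<Longrightarrow> norm (foldr partial js g x) \<le> G"
        using compactly_supported_bound[OF g supp, of R "L l"] by blast
      have "norm (b j) * W j ^ l \<le> K l * G / (c0 * A * \<epsilon> ^ L l)" for j
      proof -
        have "norm (b j) * W j ^ l \<le> norm (b j) * W j ^ (l + 2)"
          using W1[of j] by (intro mult_left_mono power_increasing) auto
        also note b_le[OF G]
        finally show ?thesis .
      qed
      then show "\<exists>C. \<forall>j. norm (b j) * W j ^ l \<le> C" by blast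
    qed
    \<comment> \<open>The inversion formula needs summability of the undivided coefficients, for
      which decay of order 2 suffices.\<close>
    have c: "summable (\<lambda>j. norm (c j))"
    proof -
      obtain G where G: "\<And>js x. length js \<le> n * 2 \<Longrightarrow> norm (foldr partial js g x) \<le> G"
        using compactly_supported_bound[OF g supp, of R "n * 2"] by blast
      define B where "B = (2 / \<epsilon>) ^ (n * 2) * ((2 ^ 2) ^ n * 2 ^ n * (G * (2 * R) ^ n))"
      show ?thesis
      proof (rule summable_comparison_test'[OF summable_mult[OF Wsum]])
        fix j
        have "norm (c j) * W j ^ 2 \<le>
            norm (fourier T g (\<xi> j)) * ((2 / \<epsilon>) ^ (n * 2) * (\<Prod>i\<in>UNIV. (1 + \<bar>\<xi> j $ i\<bar>) ^ 2))"
          using W1[of j] by (intro mult_mono norm_c W_le) auto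
        also have "\<dots> = (2 / \<epsilon>) ^ (n * 2) * ((\<Prod>i\<in>UNIV. (1 + \<bar>\<xi> j $ i\<bar>) ^ 2) * norm (fourier T g (\<xi> j)))"
          by (simp add: mult_ac)
        also have "\<dots> \<le> B"
          unfolding n_def B_def using G \<epsilon>
          by (intro mult_left_mono fourier_decay[OF g supp R RT]) (auto simp: n_def)
        finally show "norm (norm (c j)) \<le> B * (1 / (W j)\<^sup>2)"
          using W1[of j] by (simp add: pos_le_divide_eq)
      qed
    qed
    define u where "u = series b"
    have u: "smooth_on UNIV u" unfolding u_def by (rule smooth_on_series[OF b])
    have Pu: "(\<Sum>\<alpha> | mi_size \<alpha> \<le> m. a \<alpha> * ((- \<i>) ^ mi_size \<alpha> * mi_deriv \<alpha> u x)) = g x"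
      if x: "\<And>i. \<bar>x $ i\<bar> < pi / \<epsilon>" for x
    proof -
      let ?t = "\<lambda>\<alpha> j. (b j * (\<Prod>i\<leftarrow>mi_list \<alpha>. \<i> * of_real (\<xi> j $ i))) * character (\<xi> j) x"
      have sm: "summable (?t \<alpha>)" for \<alpha> by (rule summable_series[OF rapid_foldr[OF b]])
      have "a \<alpha> * ((- \<i>) ^ mi_size \<alpha> * mi_deriv \<alpha> u x) = (\<Sum>j. (a \<alpha> * (- \<i>) ^ mi_size \<alpha>) * ?t \<alpha> j)" for \<alpha>
        unfolding mi_deriv_eq_foldr u_def foldr_partial_series[OF b] series_def
        by (subst suminf_mult[OF sm]) (simp add: mult.assoc)
      then have "(\<Sum>\<alpha> | mi_size \<alpha> \<le> m. a \<alpha> * ((- \<i>) ^ mi_size \<alpha> * mi_deriv \<alpha> u x)) =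
          (\<Sum>\<alpha> | mi_size \<alpha> \<le> m. \<Sum>j. (a \<alpha> * (- \<i>) ^ mi_size \<alpha>) * ?t \<alpha> j)"
        by (simp only:)
      also have "\<dots> = (\<Sum>j. \<Sum>\<alpha> | mi_size \<alpha> \<le> m. (a \<alpha> * (- \<i>) ^ mi_size \<alpha>) * ?t \<alpha> j)"
        by (rule suminf_sum[symmetric]) (rule summable_mult[OF sm])
      also have "\<dots> = (\<Sum>j. c j * character (\<xi> j) x)"
      proof (rule suminf_cong)
        fix j
        have "(a \<alpha> * (- \<i>) ^ mi_size \<alpha>) * ?t \<alpha> j = (b j * character (\<xi> j) x) * (a \<alpha> * of_real (mi_power (\<xi> j) \<alpha>))" for \<alpha>
        proof -
          \<comment> \<open>Each factor \<open>D\<close> carries \<open>- \<i>\<close>, each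
            derivative of a character produces \<open>\<i>\<close>; they cancel and leave the real
            monomial of the symbol.\<close>
          have 1: "(- \<i>) ^ mi_size \<alpha> * \<i> ^ mi_size \<alpha> = 1" by (simp flip: power_mult_distrib)
          have "(a \<alpha> * (- \<i>) ^ mi_size \<alpha>) * ?t \<alpha> j =
              (((- \<i>) ^ mi_size \<alpha> * \<i> ^ mi_size \<alpha>) * (b j * character (\<xi> j) x)) * (a \<alpha> * of_real (mi_power (\<xi> j) \<alpha>))"
            unfolding prod_list_mi_list by (simp only: mult_ac)
          then show ?thesis by (simp only: 1 mult_1)
        qed
        then have "(\<Sum>\<alpha> | mi_size \<alpha> \<le> m. (a \<alpha> * (- \<i>) ^ mi_size \<alpha>) * ?t \<alpha> j) = (b j * character (\<xi> j) x) * p j"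
          by (simp only: p_def sum_distrib_left)
        also have "\<dots> = c j * character (\<xi> j) x" using p0[of j] by (simp add: b_def)
        finally show "(\<Sum>\<alpha> | mi_size \<alpha> \<le> m. (a \<alpha> * (- \<i>) ^ mi_size \<alpha>) * ?t \<alpha> j) = c j * character (\<xi> j) x" .
      qed
      also have "\<dots> = g x"
        using fourier_inversion[OF \<epsilon>(1) _ kk(1), of g \<theta> x] smooth_on_continuous[OF g, of "[]"] c x
        by (simp add: c_def \<xi>_def)
      finally show ?thesis .
    qed
    have bound: "norm (foldr partial is u x) \<le> C (length is) * G / (norm (a \<alpha>\<^sub>0) * \<epsilon> ^ L (length is))"
      if G: "\<forall>js x. length js \<le> L (length is) \<longrightarrow> norm (foldr partial js g x) \<le> G" for "is" G x
    proof -
      define l where "l = length is"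
      have "norm (b j * (\<Prod>i\<leftarrow>is. \<i> * of_real (\<xi> j $ i))) * (W j)\<^sup>2 \<le> K l * G / (c0 * A * \<epsilon> ^ L l)" for j
      proof -
        have "norm (b j * (\<Prod>i\<leftarrow>is. \<i> * of_real (\<xi> j $ i))) * (W j)\<^sup>2 \<le> norm (b j) * W j ^ l * (W j)\<^sup>2"
          unfolding norm_mult l_def using prod_freq_le[of j "is"] by (intro mult_right_mono mult_left_mono) auto
        also have "\<dots> = norm (b j) * W j ^ (l + 2)" by (simp only: power_add mult.assoc)
        also have "\<dots> \<le> K l * G / (c0 * A * \<epsilon> ^ L l)" by (rule b_le) (use G in \<open>auto simp: l_def\<close>)
        finally show ?thesis .
      qed
      from norm_series_le[OF this] have "norm (foldr partial is u x) \<le> K l * G / (c0 * A * \<epsilon> ^ L l) * S"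
        unfolding u_def foldr_partial_series[OF b] S_def .
      also have "\<dots> = C l * G / (A * \<epsilon> ^ L l)" by (simp add: C_def mult_ac)
      finally show ?thesis by (simp add: l_def A_def)
    qed
    show "\<exists>u. smooth_on UNIV u \<and>
        (\<forall>x. (\<forall>i. \<bar>x $ i\<bar> < pi / \<epsilon>) \<longrightarrow>
           (\<Sum>\<alpha> | mi_size \<alpha> \<le> m. a \<alpha> * ((- \<i>) ^ mi_size \<alpha> * mi_deriv \<alpha> u x)) = g x) \<and>
        (\<forall>is G. (\<forall>js x. length js \<le> L (length is) \<longrightarrow> norm (foldr partial js g x) \<le> G) \<longrightarrow>
           (\<forall>x. norm (foldr partial is u x) \<le> C (length is) * G / (norm (a \<alpha>\<^sub>0) * \<epsilon> ^ L (length is))))"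
      by (intro exI[of _ u] conjI u allI impI Pu bound) auto
  qed
qed

section \<open>Smooth cutoff functions\<close>

text \<open>The functions \<open>p(1/t) exp(-1/t)\<close>, extended by zero, form a family closed
  under differentiation, so that smoothness follows from a single derivative formula.\<close>

definition flat :: "real poly \<Rightarrow> real \<Rightarrow> real" where
  "flat p t = (if 0 < t then poly p (1 / t) * exp (- 1 / t) else 0)"

text \<open>The additional power of \<open>x\<close> is carried along for the induction on the
  coefficients of \<open>p\<close>.\<close>

lemma poly_times_exp_neg_tendsto_0: "((\<lambda>x :: real. x ^ k * poly p x * exp (- x)) \<longlongrightarrow> 0) at_top"
proof (induction p arbitrary: k)
  case (pCons a p)
  have "((\<lambda>x :: real. a * (x ^ k / exp x) + x ^ Suc k * poly p x * exp (- x)) \<longlongrightarrow> a * 0 + 0) at_top"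
    by (intro tendsto_add tendsto_mult tendsto_const tendsto_power_div_exp_0 pCons.IH)
  then show ?case by (simp add: algebra_simps exp_minus divide_inverse)
qed simp

lemma flat_tendsto_0: "(flat p \<longlongrightarrow> 0) (at 0)"
proof (rule filterlim_split_at)
  show "(flat p \<longlongrightarrow> 0) (at_left 0)"
    by (rule tendsto_eventually, rule eventually_at_leftI[of "-1"]) (auto simp: flat_def)
  have "((\<lambda>x. flat p (inverse x)) \<longlongrightarrow> 0) at_top"
  proof (rule Lim_transform_eventually)
    show "((\<lambda>x. x ^ 0 * poly p x * exp (- x)) \<longlongrightarrow> 0) at_top" by (rule poly_times_exp_neg_tendsto_0)
    show "\<forall>\<^sub>F x in at_top. x ^ 0 * poly p x * exp (- x) = flat p (inverse x)"
      using eventually_gt_at_top[of 0] by eventually_elim (simp add: flat_def field_simps)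
  qed
  then show "(flat p \<longlongrightarrow> 0) (at_right 0)" by (simp add: filterlim_at_right_to_top)
qed

text \<open>In the variable \<open>x = 1/t\<close>, differentiation in \<open>t\<close> is
  \<open>- x^2 d/dx\<close>, which sends \<open>p exp(-x)\<close> to
  \<open>x^2 (p - p') exp(-x)\<close>.\<close>

lemma flat_has_derivative:
  "(flat p has_real_derivative flat ([:0, 0, 1:] * (p - pderiv p)) t) (at t)"
proof (cases t "0 :: real" rule: linorder_cases)
  case less
  have "((\<lambda>_. 0) has_real_derivative 0) (at t)" by simp
  then have "(flat p has_real_derivative 0) (at t)"
    by (rule has_field_derivative_transform_within_open[of _ _ _ "{..<0}"]) (use less in \<open>auto simp: flat_def\<close>)
  then show ?thesis using less by (simp add: flat_def)
next
  case equal
  \<comment> \<open>Division by \<open>h\<close> is multiplication by \<open>1/h\<close>, so the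
    difference quotient at 0 is again a function of the family, with polynomial \<open>X p\<close>,
    and tends to 0.\<close>
  have "((\<lambda>h. (flat p (0 + h) - flat p 0) / h) \<longlongrightarrow> 0) (at 0)"
  proof (rule Lim_transform_eventually[OF flat_tendsto_0[of "[:0, 1:] * p"]])
    show "\<forall>\<^sub>F h in at 0. flat ([:0, 1:] * p) h = (flat p (0 + h) - flat p 0) / h"
      by (rule always_eventually) (simp add: flat_def)
  qed
  then show ?thesis using equal by (simp add: DERIV_def flat_def)
next
  case greater
  have "((\<lambda>t. poly p (1 / t) * exp (- 1 / t)) has_real_derivative
      poly ([:0, 0, 1:] * (p - pderiv p)) (1 / t) * exp (- 1 / t)) (at t)"
    using greater
    by (auto intro!: derivative_eq_intros DERIV_chain2[OF poly_DERIV] simp: field_simps power2_eq_square)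
  then have "(flat p has_real_derivative poly ([:0, 0, 1:] * (p - pderiv p)) (1 / t) * exp (- 1 / t)) (at t)"
    by (rule has_field_derivative_transform_within_open[of _ _ _ "{0<..}"]) (use greater in \<open>auto simp: flat_def\<close>)
  then show ?thesis using greater by (simp add: flat_def)
qed

lemma smooth_on_flat: "smooth_on \<Omega> (\<lambda>x :: real ^ 'n::finite. of_real (flat p (\<alpha> * x $ i + \<beta>)))"
proof -
  have D: "((\<lambda>x :: real ^ 'n. c * complex_of_real (flat q (\<alpha> * x $ i + \<beta>))) has_derivative
      (\<lambda>h. c * of_real (flat ([:0, 0, 1:] * (q - pderiv q)) (\<alpha> * x $ i + \<beta>) * (\<alpha> * h $ i)))) (at x)"
    for c q x
  proof -
    have "((\<lambda>x :: real ^ 'n. \<alpha> * x $ i + \<beta>) has_derivative (\<lambda>h. \<alpha> * h $ i)) (at x)"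
      by (auto intro!: derivative_eq_intros bounded_linear_imp_has_derivative[OF bounded_linear_vec_nth])
    from has_derivative_compose[OF this flat_has_derivative[unfolded has_field_derivative_def]]
    show ?thesis by (intro has_derivative_mult_right has_derivative_of_real)
  qed
  have "\<exists>c q. foldr partial is (\<lambda>x :: real ^ 'n. of_real (flat p (\<alpha> * x $ i + \<beta>))) =
      (\<lambda>x. c * of_real (flat q (\<alpha> * x $ i + \<beta>)))" for "is"
  proof (induction "is")
    case Nil
    show ?case by (intro exI[of _ 1] exI[of _ p]) simp
  next
    case (Cons j "is")
    then obtain c q where IH: "foldr partial is (\<lambda>x :: real ^ 'n. of_real (flat p (\<alpha> * x $ i + \<beta>))) =
      (\<lambda>x. c * of_real (flat q (\<alpha> * x $ i + \<beta>)))" by blast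
    show ?case
    proof (intro exI ext)
      fix x :: "real ^ 'n"
      show "foldr partial (j # is) (\<lambda>x. of_real (flat p (\<alpha> * x $ i + \<beta>))) x =
        (c * of_real (\<alpha> * (axis j 1 :: real ^ 'n) $ i)) * of_real (flat ([:0, 0, 1:] * (q - pderiv q)) (\<alpha> * x $ i + \<beta>))"
        using partial_has_derivative[OF D[of c q x], of j] by (simp add: IH)
    qed
  qed
  moreover have "(\<lambda>x :: real ^ 'n. c * complex_of_real (flat q (\<alpha> * x $ i + \<beta>))) differentiable_on \<Omega>" for c q
    unfolding differentiable_on_def differentiable_def using has_derivative_at_withinI[OF D] by blast
  ultimately show ?thesis unfolding smooth_on_def by metis
qed

definition smooth_step :: "real \<Rightarrow> real" where
  "smooth_step t = flat 1 t / (flat 1 t + flat 1 (1 - t))"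

lemma flat_nonneg: "0 \<le> flat 1 t" and flat_pos: "0 < t \<Longrightarrow> 0 < flat 1 t"
  by (simp_all add: flat_def)

lemma flat_add_pos: "0 < flat 1 t + flat 1 (1 - t)"
  using flat_nonneg[of t] flat_nonneg[of "1 - t"] flat_pos[of t] flat_pos[of "1 - t"] by (cases "0 < t") auto

lemma smooth_step_0: "t \<le> 0 \<Longrightarrow> smooth_step t = 0"
  by (simp add: smooth_step_def flat_def)

lemma smooth_step_1: "1 \<le> t \<Longrightarrow> smooth_step t = 1"
  using flat_add_pos[of t] by (simp add: smooth_step_def flat_def split: if_splits)

lemma smooth_on_smooth_step:
  "smooth_on UNIV (\<lambda>x :: real ^ 'n::finite. of_real (smooth_step (\<alpha> * x $ i + \<beta>)))"
proof -
  let ?a = "\<lambda>x :: real ^ 'n. complex_of_real (flat 1 (\<alpha> * x $ i + \<beta>))"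
  let ?b = "\<lambda>x :: real ^ 'n. complex_of_real (flat 1 ((- \<alpha>) * x $ i + (1 - \<beta>)))"
  have "smooth_on UNIV (\<lambda>x. ?a x * inverse (?a x + ?b x))"
  proof (intro smooth_on_mult smooth_on_inverse smooth_on_add smooth_on_flat open_UNIV)
    fix x :: "real ^ 'n"
    have "1 - (\<alpha> * x $ i + \<beta>) = (- \<alpha>) * x $ i + (1 - \<beta>)" by simp
    then show "?a x + ?b x \<noteq> 0"
      using flat_add_pos[of "\<alpha> * x $ i + \<beta>"] by (metis less_irrefl of_real_add of_real_eq_0_iff)
  qed
  moreover have "?a x * inverse (?a x + ?b x) = of_real (smooth_step (\<alpha> * x $ i + \<beta>))" for x
  proof -
    have "1 - (\<alpha> * x $ i + \<beta>) = (- \<alpha>) * x $ i + (1 - \<beta>)" by simp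
    then show ?thesis by (simp only: smooth_step_def divide_inverse of_real_mult of_real_inverse of_real_add)
  qed
  ultimately show ?thesis by (simp only:)
qed

lemma box_cutoff:
  fixes x :: "real ^ 'n::finite"
  assumes r: "0 < r"
  obtains \<psi> where "smooth_on UNIV \<psi>" "\<And>y. (\<forall>i. \<bar>y $ i - x $ i\<bar> < r) \<Longrightarrow> \<psi> y = 1"
    "\<And>y. y \<notin> cbox (x - vec (2 * r)) (x + vec (2 * r)) \<Longrightarrow> \<psi> y = 0"
proof -
  \<comment> \<open>In each coordinate the two arguments are \<open>2 + (y - x) / r\<close> and
    \<open>2 - (y - x) / r\<close>: both are at least 1 within distance \<open>r\<close> of
    \<open>x\<close>, and one is at most 0 beyond distance \<open>2 * r\<close>.\<close>
  let ?s = "\<lambda>a i y. complex_of_real (smooth_step (a * y $ i + (2 - a * x $ i)))"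
  define \<psi> where "\<psi> y = (\<Prod>i\<in>UNIV. ?s (1 / r) i y * ?s (- 1 / r) i y)" for y :: "real ^ 'n"
  have arg: "a * y $ i + (2 - a * x $ i) = 2 + a * (y $ i - x $ i)" for a i and y :: "real ^ 'n"
    by (simp add: algebra_simps)
  show ?thesis
  proof (rule that[of \<psi>])
    show "smooth_on UNIV \<psi>"
      unfolding \<psi>_def by (intro smooth_on_prod smooth_on_mult smooth_on_smooth_step open_UNIV)
    show "\<psi> y = 1" if y: "\<forall>i. \<bar>y $ i - x $ i\<bar> < r" for y
    proof -
      have "?s (1 / r) i y * ?s (- 1 / r) i y = 1" for i
      proof -
        have "- r \<le> y $ i - x $ i" "y $ i - x $ i \<le> r" using y[rule_format, of i] by linarith+
        then have "1 \<le> 2 + (1 / r) * (y $ i - x $ i)" "1 \<le> 2 + (- 1 / r) * (y $ i - x $ i)"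
          using r by (simp_all add: field_simps)
        then show ?thesis unfolding arg by (simp only: smooth_step_1) simp
      qed
      then show ?thesis unfolding \<psi>_def by (simp only: prod.neutral_const)
    qed
    show "\<psi> y = 0" if y: "y \<notin> cbox (x - vec (2 * r)) (x + vec (2 * r))" for y
    proof -
      obtain i where i: "y $ i < x $ i - 2 * r \<or> x $ i + 2 * r < y $ i"
        using y by (auto simp: mem_box_cart not_le)
      then have "?s (1 / r) i y * ?s (- 1 / r) i y = 0"
      proof
        assume "y $ i < x $ i - 2 * r"
        then have "2 + (1 / r) * (y $ i - x $ i) \<le> 0" using r by (simp add: field_simps)
        then show ?thesis unfolding arg by (simp only: smooth_step_0) simp
      next
        assume "x $ i + 2 * r < y $ i"
        then have "2 + (- 1 / r) * (y $ i - x $ i) \<le> 0" using r by (simp add: field_simps)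
        then show ?thesis unfolding arg by (simp only: smooth_step_0) simp
      qed
      then show ?thesis unfolding \<psi>_def by (intro prod_zero) auto
    qed
  qed
qed

text \<open>Finitely many boxes cover \<open>S\<close>. The function
  \<open>1 - \<Prod>(1 - \<psi>)\<close> is 1 wherever one of the box functions is 1, and it
  vanishes where all of them do.\<close>

lemma exists_cutoff:
  fixes S :: "(real ^ 'n::finite) set"
  assumes S: "compact S" and \<Omega>: "open \<Omega>" "S \<subseteq> \<Omega>"
  obtains \<kappa> W K where "smooth_on UNIV \<kappa>" "open W" "S \<subseteq> W" "\<And>x. x \<in> W \<Longrightarrow> \<kappa> x = 1"
    "compact K" "K \<subseteq> \<Omega>" "\<And>x. x \<notin> K \<Longrightarrow> \<kappa> x = 0"
proof -
  have "\<exists>r>0. cbox (x - vec (2 * r)) (x + vec (2 * r)) \<subseteq> \<Omega>" if x: "x \<in> S" for x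
  proof -
    obtain e where e: "0 < e" "cball x e \<subseteq> \<Omega>" using \<Omega> x by (meson open_contains_cball subsetD)
    define r where "r = e / (2 * real CARD('n))"
    have "cbox (x - vec (2 * r)) (x + vec (2 * r)) \<subseteq> cball x e"
    proof
      fix y assume "y \<in> cbox (x - vec (2 * r)) (x + vec (2 * r))"
      then have "\<bar>(x - y) $ i\<bar> \<le> 2 * r" for i by (force simp: mem_box_cart abs_le_iff algebra_simps)
      then have "norm (x - y) \<le> (\<Sum>i\<in>(UNIV :: 'n set). 2 * r)"
        by (intro order_trans[OF norm_le_l1_cart] sum_mono)
      also have "\<dots> = e" by (simp add: r_def)
      finally show "y \<in> cball x e" by (simp add: dist_norm)
    qed
    moreover have "0 < r" using e(1) by (simp add: r_def)
    ultimately show ?thesis using e(2) by blast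
  qed
  then obtain r where r: "\<And>x. x \<in> S \<Longrightarrow> 0 < r x" "\<And>x. x \<in> S \<Longrightarrow> cbox (x - vec (2 * r x)) (x + vec (2 * r x)) \<subseteq> \<Omega>"
    by metis
  have "\<forall>x. \<exists>\<psi>. x \<in> S \<longrightarrow> smooth_on UNIV \<psi> \<and> (\<forall>y. (\<forall>i. \<bar>y $ i - x $ i\<bar> < r x) \<longrightarrow> \<psi> y = 1) \<and>
      (\<forall>y. y \<notin> cbox (x - vec (2 * r x)) (x + vec (2 * r x)) \<longrightarrow> \<psi> y = 0)"
  proof
    fix x
    show "\<exists>\<psi>. x \<in> S \<longrightarrow> smooth_on UNIV \<psi> \<and> (\<forall>y. (\<forall>i. \<bar>y $ i - x $ i\<bar> < r x) \<longrightarrow> \<psi> y = 1) \<and>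
      (\<forall>y. y \<notin> cbox (x - vec (2 * r x)) (x + vec (2 * r x)) \<longrightarrow> \<psi> y = 0)"
    proof (cases "x \<in> S")
      case True
      show ?thesis by (rule box_cutoff[OF r(1)[OF True], of x]) blast
    qed simp
  qed
  from choice[OF this] obtain \<psi> where "\<forall>x. x \<in> S \<longrightarrow> smooth_on UNIV (\<psi> x) \<and>
      (\<forall>y. (\<forall>i. \<bar>y $ i - x $ i\<bar> < r x) \<longrightarrow> \<psi> x y = 1) \<and>
      (\<forall>y. y \<notin> cbox (x - vec (2 * r x)) (x + vec (2 * r x)) \<longrightarrow> \<psi> x y = 0)" by (elim exE)
  then have \<psi>: "\<And>x. x \<in> S \<Longrightarrow> smooth_on UNIV (\<psi> x)"
    "\<And>x y. x \<in> S \<Longrightarrow> (\<forall>i. \<bar>y $ i - x $ i\<bar> < r x) \<Longrightarrow> \<psi> x y = 1"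
    "\<And>x y. x \<in> S \<Longrightarrow> y \<notin> cbox (x - vec (2 * r x)) (x + vec (2 * r x)) \<Longrightarrow> \<psi> x y = 0"
    by blast+
  define B where "B x = box (x - vec (r x)) (x + vec (r x))" for x
  have B: "y \<in> B x \<longleftrightarrow> (\<forall>i. \<bar>y $ i - x $ i\<bar> < r x)" for x y
    unfolding B_def mem_box_cart by (auto simp: abs_less_iff algebra_simps)
  have cover: "S \<subseteq> (\<Union>x\<in>S. B x)" using r(1) B by fastforce
  obtain T where T: "T \<subseteq> S" "finite T" "S \<subseteq> (\<Union>x\<in>T. B x)"
    by (rule compactE_image[OF S _ cover]) (auto simp: B_def intro: open_box)
  define \<kappa> where "\<kappa> y = 1 + (- 1) * (\<Prod>x\<in>T. 1 + (- 1) * \<psi> x y)" for y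
  show ?thesis
  proof (rule that[of \<kappa> "\<Union>x\<in>T. B x" "\<Union>x\<in>T. cbox (x - vec (2 * r x)) (x + vec (2 * r x))"])
    show "smooth_on UNIV \<kappa>" unfolding \<kappa>_def
      using T(1) by (intro smooth_on_add smooth_on_cmult smooth_on_prod smooth_on_const \<psi>(1) open_UNIV) auto
    show "\<kappa> y = 1" if y: "y \<in> (\<Union>x\<in>T. B x)" for y
    proof -
      obtain x where x: "x \<in> T" "\<psi> x y = 1" using y T(1) \<psi>(2) B by blast
      then have "(\<Prod>x\<in>T. 1 + (- 1) * \<psi> x y) = 0" using T(2) by (intro prod_zero) (auto intro!: bexI[of _ x])
      then show ?thesis by (simp add: \<kappa>_def)
    qed
    show "\<kappa> y = 0" if "y \<notin> (\<Union>x\<in>T. cbox (x - vec (2 * r x)) (x + vec (2 * r x)))" for y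
    proof -
      have "\<psi> x y = 0" if "x \<in> T" for x using that T(1) \<psi>(3) \<open>y \<notin> _\<close> by blast
      then show ?thesis by (simp add: \<kappa>_def)
    qed
  qed (use T r(2) in \<open>auto simp: B_def intro!: compact_UN open_UN open_box\<close>)
qed

section \<open>Growth of nets and classes in the Colombeau algebra\<close>

lemma eventually_unit_interval: "\<forall>\<^sub>F \<epsilon> in at_right 0. \<epsilon> \<in> {0<..1 :: real}"
  using eventually_at_right_real[of 0 1, OF zero_less_one] by (rule eventually_mono) auto

text \<open>An eventual pointwise bound replaces the supremum, so that \<open>K\<close> may be empty
  or unbounded. With exponents of either sign, moderate means some \<open>r\<close> and negligible
  means every \<open>r\<close>.\<close>

definition grows :: "real \<Rightarrow> 'a set \<Rightarrow> (real \<Rightarrow> 'a \<Rightarrow> complex) \<Rightarrow> bool" where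
  "grows r K u \<longleftrightarrow> (\<exists>C. \<forall>\<^sub>F \<epsilon> in at_right 0. \<forall>x\<in>K. norm (u \<epsilon> x) \<le> C * \<epsilon> powr r)"

lemma growsI:
  assumes "\<forall>\<^sub>F \<epsilon> in at_right 0. \<forall>x\<in>K. norm (u \<epsilon> x) \<le> C * \<epsilon> powr r"
  shows "grows r K u"
  using assms unfolding grows_def by blast

lemma growsE:
  assumes "grows r K u"
  obtains C where "0 < C" "\<forall>\<^sub>F \<epsilon> in at_right 0. \<epsilon> \<in> {0<..1} \<and> (\<forall>x\<in>K. norm (u \<epsilon> x) \<le> C * \<epsilon> powr r)"
proof -
  obtain C where C: "\<forall>\<^sub>F \<epsilon> in at_right 0. \<forall>x\<in>K. norm (u \<epsilon> x) \<le> C * \<epsilon> powr r"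
    using assms unfolding grows_def by blast
  have "\<forall>\<^sub>F \<epsilon> in at_right 0. \<epsilon> \<in> {0<..1} \<and> (\<forall>x\<in>K. norm (u \<epsilon> x) \<le> max C 1 * \<epsilon> powr r)"
    using C eventually_unit_interval
  proof eventually_elim
    case (elim \<epsilon>)
    have "C * \<epsilon> powr r \<le> max C 1 * \<epsilon> powr r" by (intro mult_right_mono) auto
    then show ?case using elim by (auto intro: order_trans)
  qed
  then show ?thesis by (intro that[of "max C 1"]) auto
qed

lemma growsD:
  assumes "grows r K u"
  shows "\<exists>C>0. \<forall>\<^sub>F \<epsilon> in at_right 0. \<epsilon> \<in> {0<..1} \<and> (\<forall>x\<in>K. norm (u \<epsilon> x) \<le> C * \<epsilon> powr r)"
  by (rule growsE[OF assms]) (intro exI conjI)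

lemma grows_mono_exponent:
  assumes "grows r K u" "s \<le> r"
  shows "grows s K u"
proof -
  obtain C where C: "0 < C" "\<forall>\<^sub>F \<epsilon> in at_right 0. \<epsilon> \<in> {0<..1} \<and> (\<forall>x\<in>K. norm (u \<epsilon> x) \<le> C * \<epsilon> powr r)"
    by (rule growsE[OF assms(1)])
  have "\<forall>\<^sub>F \<epsilon> in at_right 0. \<forall>x\<in>K. norm (u \<epsilon> x) \<le> C * \<epsilon> powr s"
    using C(2)
  proof eventually_elim
    case (elim \<epsilon>)
    have "\<epsilon> powr r \<le> \<epsilon> powr s" using elim assms(2) by (intro powr_mono') auto
    then have "C * \<epsilon> powr r \<le> C * \<epsilon> powr s" using C(1) by simp
    then show ?case using elim by (auto intro: order_trans)
  qed
  then show ?thesis by (rule growsI)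
qed

lemma grows_subset: "grows r K u \<Longrightarrow> L \<subseteq> K \<Longrightarrow> grows r L u"
  unfolding grows_def by (elim exE, rule_tac x = C in exI, erule eventually_mono) blast

lemma grows_cong:
  assumes "\<And>\<epsilon> x. \<epsilon> \<in> {0<..1} \<Longrightarrow> x \<in> K \<Longrightarrow> u \<epsilon> x = v \<epsilon> x" "grows r K u"
  shows "grows r K v"
proof -
  obtain C where C: "\<forall>\<^sub>F \<epsilon> in at_right 0. \<epsilon> \<in> {0<..1} \<and> (\<forall>x\<in>K. norm (u \<epsilon> x) \<le> C * \<epsilon> powr r)"
    using growsD[OF assms(2)] by (elim exE conjE)
  show ?thesis by (rule growsI, rule eventually_mono[OF C]) (auto simp: assms(1)[symmetric])
qed

lemma grows_zero: "grows r K (\<lambda>_ _. 0)"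
  by (rule growsI[of _ _ 0]) simp

lemma grows_bounded:
  assumes "\<And>x. x \<in> K \<Longrightarrow> norm (f x) \<le> C"
  shows "grows 0 K (\<lambda>_. f)"
  by (rule growsI, rule eventually_mono[OF eventually_unit_interval]) (use assms in auto)

lemma grows_add:
  assumes "grows r K u" "grows r K v"
  shows "grows r K (\<lambda>\<epsilon> x. u \<epsilon> x + v \<epsilon> x)"
proof -
  obtain C where C: "\<forall>\<^sub>F \<epsilon> in at_right 0. \<epsilon> \<in> {0<..1} \<and> (\<forall>x\<in>K. norm (u \<epsilon> x) \<le> C * \<epsilon> powr r)"
    using growsD[OF assms(1)] by (elim exE conjE)
  obtain D where D: "\<forall>\<^sub>F \<epsilon> in at_right 0. \<epsilon> \<in> {0<..1} \<and> (\<forall>x\<in>K. norm (v \<epsilon> x) \<le> D * \<epsilon> powr r)"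
    using growsD[OF assms(2)] by (elim exE conjE)
  have "\<forall>\<^sub>F \<epsilon> in at_right 0. \<forall>x\<in>K. norm (u \<epsilon> x + v \<epsilon> x) \<le> (C + D) * \<epsilon> powr r"
    using C D
  proof eventually_elim
    case (elim \<epsilon>)
    show ?case
    proof
      fix x assume "x \<in> K"
      then have "norm (u \<epsilon> x) \<le> C * \<epsilon> powr r" "norm (v \<epsilon> x) \<le> D * \<epsilon> powr r" using elim by auto
      then show "norm (u \<epsilon> x + v \<epsilon> x) \<le> (C + D) * \<epsilon> powr r"
        using norm_triangle_ineq[of "u \<epsilon> x" "v \<epsilon> x"] by (simp add: distrib_right)
    qed
  qed
  then show ?thesis by (rule growsI)
qed

lemma grows_mult:
  assumes "grows r K u" "grows s K v"
  shows "grows (r + s) K (\<lambda>\<epsilon> x. u \<epsilon> x * v \<epsilon> x)"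
proof -
  obtain C where C: "0 < C" "\<forall>\<^sub>F \<epsilon> in at_right 0. \<epsilon> \<in> {0<..1} \<and> (\<forall>x\<in>K. norm (u \<epsilon> x) \<le> C * \<epsilon> powr r)"
    by (rule growsE[OF assms(1)])
  obtain D where D: "0 < D" "\<forall>\<^sub>F \<epsilon> in at_right 0. \<epsilon> \<in> {0<..1} \<and> (\<forall>x\<in>K. norm (v \<epsilon> x) \<le> D * \<epsilon> powr s)"
    by (rule growsE[OF assms(2)])
  have "\<forall>\<^sub>F \<epsilon> in at_right 0. \<forall>x\<in>K. norm (u \<epsilon> x * v \<epsilon> x) \<le> (C * D) * \<epsilon> powr (r + s)"
    using C(2) D(2)
  proof eventually_elim
    case (elim \<epsilon>)
    show ?case
    proof
      fix x assume "x \<in> K"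
      then have "norm (u \<epsilon> x) * norm (v \<epsilon> x) \<le> (C * \<epsilon> powr r) * (D * \<epsilon> powr s)"
        using elim C(1) by (intro mult_mono) auto
      then show "norm (u \<epsilon> x * v \<epsilon> x) \<le> (C * D) * \<epsilon> powr (r + s)"
        by (simp add: norm_mult powr_add mult_ac)
    qed
  qed
  then show ?thesis by (rule growsI)
qed

lemma grows_Un:
  assumes "grows r K u" "grows r L u"
  shows "grows r (K \<union> L) u"
proof -
  obtain C where C: "\<forall>\<^sub>F \<epsilon> in at_right 0. \<epsilon> \<in> {0<..1} \<and> (\<forall>x\<in>K. norm (u \<epsilon> x) \<le> C * \<epsilon> powr r)"
    using growsD[OF assms(1)] by (elim exE conjE)
  obtain D where D: "\<forall>\<^sub>F \<epsilon> in at_right 0. \<epsilon> \<in> {0<..1} \<and> (\<forall>x\<in>L. norm (u \<epsilon> x) \<le> D * \<epsilon> powr r)"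
    using growsD[OF assms(2)] by (elim exE conjE)
  have "\<forall>\<^sub>F \<epsilon> in at_right 0. \<forall>x\<in>K \<union> L. norm (u \<epsilon> x) \<le> max C D * \<epsilon> powr r"
    using C D
  proof eventually_elim
    case (elim \<epsilon>)
    have "C * \<epsilon> powr r \<le> max C D * \<epsilon> powr r" "D * \<epsilon> powr r \<le> max C D * \<epsilon> powr r"
      by (auto intro!: mult_right_mono)
    then show ?case using elim by (auto intro: order_trans)
  qed
  then show ?thesis by (rule growsI)
qed

lemma grows_UN:
  assumes "finite I" "\<And>i. i \<in> I \<Longrightarrow> grows r (K i) u"
  shows "grows r (\<Union>i\<in>I. K i) u"
  using assms
proof (induction I)
  case empty
  show ?case by (rule growsI[of _ _ 0]) simp
next
  case (insert i I)
  then show ?case by (simp add: grows_Un)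
qed

lemma grows_sum_ex:
  assumes "\<And>i. i \<in> I \<Longrightarrow> \<exists>r. grows r K (\<lambda>\<epsilon>. F i \<epsilon>)"
  shows "\<exists>r. grows r K (\<lambda>\<epsilon> x. \<Sum>i\<in>I. F i \<epsilon> x)"
  using assms
proof (induction I rule: infinite_finite_induct)
  case (insert i I)
  obtain r where r: "grows r K (\<lambda>\<epsilon>. F i \<epsilon>)" using insert.prems[of i] by auto
  obtain s where s: "grows s K (\<lambda>\<epsilon> x. \<Sum>i\<in>I. F i \<epsilon> x)" using insert.IH insert.prems by blast
  from r s have "grows (min r s) K (\<lambda>\<epsilon> x. F i \<epsilon> x + (\<Sum>i\<in>I. F i \<epsilon> x))"
    by (intro grows_add) (auto elim: grows_mono_exponent)
  then show ?case using insert(1,2) by auto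
qed (auto intro: grows_zero)

lemma grows_sum_list:
  assumes "\<And>p. p \<in> set ps \<Longrightarrow> grows r K (\<lambda>\<epsilon>. F p \<epsilon>)"
  shows "grows r K (\<lambda>\<epsilon> x. \<Sum>p\<leftarrow>ps. F p \<epsilon> x)"
  using assms by (induction ps) (auto intro: grows_zero grows_add)

lemma grows_sum_list_ex:
  assumes "\<And>p. p \<in> set ps \<Longrightarrow> \<exists>r. grows r K (\<lambda>\<epsilon>. F p \<epsilon>)"
  shows "\<exists>r. grows r K (\<lambda>\<epsilon> x. \<Sum>p\<leftarrow>ps. F p \<epsilon> x)"
  using assms
proof (induction ps)
  case (Cons p ps)
  obtain r where r: "grows r K (\<lambda>\<epsilon>. F p \<epsilon>)" using Cons.prems[of p] by auto
  obtain s where s: "grows s K (\<lambda>\<epsilon> x. \<Sum>p\<leftarrow>ps. F p \<epsilon> x)" using Cons.IH Cons.prems by fastforce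
  from r s have "grows (min r s) K (\<lambda>\<epsilon> x. F p \<epsilon> x + (\<Sum>p\<leftarrow>ps. F p \<epsilon> x))"
    by (intro grows_add) (auto elim: grows_mono_exponent)
  then show ?case by auto
qed (auto intro: grows_zero)

section \<open>Moderate and negligible nets expressed by growth bounds\<close>

text \<open>The two hypotheses make the real supremum a genuine least upper bound; for nonempty
  compact sets and smooth nets both hold.\<close>

lemma SUP_bigo_iff_grows:
  fixes K :: "'a set" and u :: "real \<Rightarrow> 'a \<Rightarrow> complex"
  assumes K: "K \<noteq> {}" and bdd: "\<And>\<epsilon>. \<epsilon> \<in> {0<..1} \<Longrightarrow> bdd_above ((\<lambda>x. norm (u \<epsilon> x)) ` K)"
  shows "(\<lambda>\<epsilon>. SUP x\<in>K. norm (u \<epsilon> x)) \<in> O[at_right 0](\<lambda>\<epsilon>. \<epsilon> powr r) \<longleftrightarrow> grows r K u"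
proof
  assume "(\<lambda>\<epsilon>. SUP x\<in>K. norm (u \<epsilon> x)) \<in> O[at_right 0](\<lambda>\<epsilon>. \<epsilon> powr r)"
  then obtain c where c: "\<forall>\<^sub>F \<epsilon> in at_right 0. norm (SUP x\<in>K. norm (u \<epsilon> x)) \<le> c * norm (\<epsilon> powr r)"
    by (auto simp: bigo_def)
  show "grows r K u"
  proof (rule growsI)
    show "\<forall>\<^sub>F \<epsilon> in at_right 0. \<forall>x\<in>K. norm (u \<epsilon> x) \<le> c * \<epsilon> powr r"
      using c eventually_unit_interval
    proof eventually_elim
      case (elim \<epsilon>)
      have "norm (u \<epsilon> x) \<le> c * \<epsilon> powr r" if "x \<in> K" for x
        using cSUP_upper[OF that bdd[OF elim(2)]] elim(1) by (simp add: abs_le_iff)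
      then show ?case by blast
    qed
  qed
next
  assume "grows r K u"
  from growsD[OF this] obtain C where
    C: "\<forall>\<^sub>F \<epsilon> in at_right 0. \<epsilon> \<in> {0<..1} \<and> (\<forall>x\<in>K. norm (u \<epsilon> x) \<le> C * \<epsilon> powr r)"
    by (elim exE conjE)
  show "(\<lambda>\<epsilon>. SUP x\<in>K. norm (u \<epsilon> x)) \<in> O[at_right 0](\<lambda>\<epsilon>. \<epsilon> powr r)"
  proof (rule bigoI)
    show "\<forall>\<^sub>F \<epsilon> in at_right 0. norm (SUP x\<in>K. norm (u \<epsilon> x)) \<le> C * norm (\<epsilon> powr r)"
      using C
    proof eventually_elim
      case (elim \<epsilon>)
      obtain x where x: "x \<in> K" using K by blast
      have "0 \<le> (SUP x\<in>K. norm (u \<epsilon> x))"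
        by (rule order_trans[OF norm_ge_zero cSUP_upper[OF x bdd]]) (use elim in auto)
      moreover have "(SUP x\<in>K. norm (u \<epsilon> x)) \<le> C * \<epsilon> powr r"
        using elim K by (intro cSUP_least) auto
      ultimately show ?case by simp
    qed
  qed
qed

definition smooth_net :: "(real ^ 'n::finite) set \<Rightarrow> 'n net \<Rightarrow> bool" where
  "smooth_net \<Omega> u \<longleftrightarrow> (\<forall>\<epsilon>\<in>{0<..1}. smooth_on \<Omega> (u \<epsilon>))"

text \<open>Lists of directions stand in for multi-indices because Leibniz's rule was set up for
  lists.\<close>

definition moderate_on :: "(real ^ 'n::finite) set \<Rightarrow> 'n net \<Rightarrow> bool" where
  "moderate_on K u \<longleftrightarrow> (\<forall>is. \<exists>r. grows r K (\<lambda>\<epsilon>. foldr partial is (u \<epsilon>)))"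

definition negligible_on :: "(real ^ 'n::finite) set \<Rightarrow> 'n net \<Rightarrow> bool" where
  "negligible_on K u \<longleftrightarrow> (\<forall>is r. grows r K (\<lambda>\<epsilon>. foldr partial is (u \<epsilon>)))"

lemma foldr_partial_net_eq_mi_deriv:
  assumes "open \<Omega>" "smooth_net \<Omega> u" "K \<subseteq> \<Omega>"
  shows "grows r K (\<lambda>\<epsilon>. foldr partial is (u \<epsilon>)) \<longleftrightarrow> grows r K (\<lambda>\<epsilon>. mi_deriv (count (mset is)) (u \<epsilon>))"
proof -
  have "foldr partial is (u \<epsilon>) x = mi_deriv (count (mset is)) (u \<epsilon>) x" if "\<epsilon> \<in> {0<..1}" "x \<in> K" for \<epsilon> x
    using assms that by (intro foldr_partial_eq_mi_deriv[of \<Omega>]) (auto simp: smooth_net_def)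
  then show ?thesis
    using grows_cong[of K "\<lambda>\<epsilon>. foldr partial is (u \<epsilon>)" "\<lambda>\<epsilon>. mi_deriv (count (mset is)) (u \<epsilon>)" r]
      grows_cong[of K "\<lambda>\<epsilon>. mi_deriv (count (mset is)) (u \<epsilon>)" "\<lambda>\<epsilon>. foldr partial is (u \<epsilon>)" r] by auto
qed

lemma SUP_mi_deriv_bigo_iff:
  assumes "open \<Omega>" "smooth_net \<Omega> u" "K \<subseteq> \<Omega>" "compact K" "K \<noteq> {}"
  shows "(\<lambda>\<epsilon>. SUP x\<in>K. norm (mi_deriv \<alpha> (u \<epsilon>) x)) \<in> O[at_right 0](\<lambda>\<epsilon>. \<epsilon> powr r) \<longleftrightarrow>
    grows r K (\<lambda>\<epsilon>. mi_deriv \<alpha> (u \<epsilon>))"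
proof (rule SUP_bigo_iff_grows[OF assms(5)])
  fix \<epsilon> :: real assume "\<epsilon> \<in> {0<..1}"
  then have "continuous_on K (mi_deriv \<alpha> (u \<epsilon>))"
    using assms(2,3) unfolding mi_deriv_eq_foldr
    by (intro continuous_on_subset[OF smooth_on_continuous]) (auto simp: smooth_net_def)
  then have "compact ((\<lambda>x. norm (mi_deriv \<alpha> (u \<epsilon>) x)) ` K)"
    by (intro compact_continuous_image assms(4) continuous_intros)
  then show "bdd_above ((\<lambda>x. norm (mi_deriv \<alpha> (u \<epsilon>) x)) ` K)"
    by (intro bounded_imp_bdd_above compact_imp_bounded)
qed

lemma grows_empty: "grows r {} u"
  by (rule growsI[of _ _ 0]) simp

text \<open>The definition asks for \<open>p \<ge> 0\<close> in \<open>\<epsilon> powr (-p)\<close>,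
  so an arbitrary exponent \<open>r\<close> is lowered to \<open>- max 0 (- r)\<close>, which only
  weakens a bound for \<open>\<epsilon> \<le> 1\<close>.\<close>

lemma carrier_moderate_nets:
  assumes \<Omega>: "open \<Omega>"
  shows "u \<in> carrier (moderate_nets \<Omega>) \<longleftrightarrow>
    smooth_net \<Omega> u \<and> (\<forall>K. compact K \<longrightarrow> K \<subseteq> \<Omega> \<longrightarrow> moderate_on K u)"
proof (cases "smooth_net \<Omega> u")
  case True
  show ?thesis
  proof
    assume u: "u \<in> carrier (moderate_nets \<Omega>)"
    have "moderate_on K u" if K: "compact K" "K \<subseteq> \<Omega>" for K
      unfolding moderate_on_def
    proof
      fix "is" :: "'a list"
      show "\<exists>r. grows r K (\<lambda>\<epsilon>. foldr partial is (u \<epsilon>))"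
      proof (cases "K = {}")
        case False
        have "\<forall>K \<alpha>. compact K \<and> K \<noteq> {} \<and> K \<subseteq> \<Omega> \<longrightarrow>
           (\<exists>p\<ge>0. (\<lambda>\<epsilon>. SUP x\<in>K. norm (mi_deriv \<alpha> (u \<epsilon>) x)) \<in> O[at_right 0](\<lambda>\<epsilon>. \<epsilon> powr (-p)))"
          using u by (simp add: moderate_nets_def)
        with K False obtain p where "(\<lambda>\<epsilon>. SUP x\<in>K. norm (mi_deriv (count (mset is)) (u \<epsilon>) x)) \<in> O[at_right 0](\<lambda>\<epsilon>. \<epsilon> powr (-p))"
          by blast
        then show ?thesis
          unfolding SUP_mi_deriv_bigo_iff[OF \<Omega> True K(2,1) False]
            foldr_partial_net_eq_mi_deriv[OF \<Omega> True K(2)] by blast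
      qed (auto simp: grows_empty)
    qed
    then show "smooth_net \<Omega> u \<and> (\<forall>K. compact K \<longrightarrow> K \<subseteq> \<Omega> \<longrightarrow> moderate_on K u)" using True by blast
  next
    assume u: "smooth_net \<Omega> u \<and> (\<forall>K. compact K \<longrightarrow> K \<subseteq> \<Omega> \<longrightarrow> moderate_on K u)"
    have "\<exists>p\<ge>0. (\<lambda>\<epsilon>. SUP x\<in>K. norm (mi_deriv \<alpha> (u \<epsilon>) x)) \<in> O[at_right 0](\<lambda>\<epsilon>. \<epsilon> powr (-p))"
      if K: "compact K" "K \<noteq> {}" "K \<subseteq> \<Omega>" for K \<alpha>
    proof -
      obtain r where "grows r K (\<lambda>\<epsilon>. mi_deriv \<alpha> (u \<epsilon>))"
        using u K unfolding moderate_on_def mi_deriv_eq_foldr by blast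
      then have "grows (- max 0 (- r)) K (\<lambda>\<epsilon>. mi_deriv \<alpha> (u \<epsilon>))" by (rule grows_mono_exponent) simp
      then show ?thesis
        using SUP_mi_deriv_bigo_iff[OF \<Omega> True K(3,1,2)] by (intro exI[of _ "max 0 (- r)"]) auto
    qed
    then show "u \<in> carrier (moderate_nets \<Omega>)"
      using True by (auto simp: moderate_nets_def smooth_net_def)
  qed
qed (auto simp: moderate_nets_def smooth_net_def)

lemma mem_negligible_nets:
  assumes \<Omega>: "open \<Omega>"
  shows "u \<in> negligible_nets \<Omega> \<longleftrightarrow>
    smooth_net \<Omega> u \<and> (\<forall>K. compact K \<longrightarrow> K \<subseteq> \<Omega> \<longrightarrow> negligible_on K u)"
proof (cases "smooth_net \<Omega> u")
  case True
  show ?thesis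
  proof
    assume u: "u \<in> negligible_nets \<Omega>"
    have "negligible_on K u" if K: "compact K" "K \<subseteq> \<Omega>" for K
      unfolding negligible_on_def
    proof (intro allI)
      fix "is" :: "'a list" and r :: real
      show "grows r K (\<lambda>\<epsilon>. foldr partial is (u \<epsilon>))"
      proof (cases "K = {}")
        case False
        then have "(\<lambda>\<epsilon>. SUP x\<in>K. norm (mi_deriv (count (mset is)) (u \<epsilon>) x)) \<in> O[at_right 0](\<lambda>\<epsilon>. \<epsilon> powr (max 0 r))"
          using u K by (auto simp: negligible_nets_def)
        then have "grows (max 0 r) K (\<lambda>\<epsilon>. foldr partial is (u \<epsilon>))"
          unfolding SUP_mi_deriv_bigo_iff[OF \<Omega> True K(2,1) False]
            foldr_partial_net_eq_mi_deriv[OF \<Omega> True K(2)] .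
        then show ?thesis by (rule grows_mono_exponent) simp
      qed (auto simp: grows_empty)
    qed
    then show "smooth_net \<Omega> u \<and> (\<forall>K. compact K \<longrightarrow> K \<subseteq> \<Omega> \<longrightarrow> negligible_on K u)" using True by blast
  next
    assume u: "smooth_net \<Omega> u \<and> (\<forall>K. compact K \<longrightarrow> K \<subseteq> \<Omega> \<longrightarrow> negligible_on K u)"
    have "(\<lambda>\<epsilon>. SUP x\<in>K. norm (mi_deriv \<alpha> (u \<epsilon>) x)) \<in> O[at_right 0](\<lambda>\<epsilon>. \<epsilon> powr q)"
      if K: "compact K" "K \<noteq> {}" "K \<subseteq> \<Omega>" for K \<alpha> q
      unfolding SUP_mi_deriv_bigo_iff[OF \<Omega> True K(3,1,2)]
      using u K unfolding negligible_on_def mi_deriv_eq_foldr by blast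
    then show "u \<in> negligible_nets \<Omega>"
      using True by (auto simp: negligible_nets_def smooth_net_def)
  qed
qed (auto simp: negligible_nets_def smooth_net_def)

lemma foldr_partial_net_add:
  assumes "open \<Omega>" "smooth_net \<Omega> u" "smooth_net \<Omega> v" "K \<subseteq> \<Omega>"
    and "grows r K (\<lambda>\<epsilon>. foldr partial is (u \<epsilon>))" "grows r K (\<lambda>\<epsilon>. foldr partial is (v \<epsilon>))"
  shows "grows r K (\<lambda>\<epsilon>. foldr partial is (\<lambda>x. u \<epsilon> x + v \<epsilon> x))"
  by (rule grows_cong[OF _ grows_add[OF assms(5,6)]])
    (use assms(2-4) foldr_partial_add[OF assms(1)] in \<open>auto simp: smooth_net_def\<close>)

lemma smooth_net_add: "open \<Omega> \<Longrightarrow> smooth_net \<Omega> u \<Longrightarrow> smooth_net \<Omega> v \<Longrightarrow> smooth_net \<Omega> (\<lambda>\<epsilon> x. u \<epsilon> x + v \<epsilon> x)"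
  unfolding smooth_net_def using smooth_on_add by blast

lemma smooth_net_mult: "open \<Omega> \<Longrightarrow> smooth_net \<Omega> u \<Longrightarrow> smooth_net \<Omega> v \<Longrightarrow> smooth_net \<Omega> (\<lambda>\<epsilon> x. u \<epsilon> x * v \<epsilon> x)"
  unfolding smooth_net_def using smooth_on_mult by blast

lemma smooth_net_const: "smooth_net \<Omega> (\<lambda>\<epsilon> x. c \<epsilon>)"
  unfolding smooth_net_def by simp

lemma negligible_nets_add:
  assumes "open \<Omega>" "u \<in> negligible_nets \<Omega>" "v \<in> negligible_nets \<Omega>"
  shows "(\<lambda>\<epsilon> x. u \<epsilon> x + v \<epsilon> x) \<in> negligible_nets \<Omega>"
proof -
  have u: "smooth_net \<Omega> u" "\<And>K. compact K \<Longrightarrow> K \<subseteq> \<Omega> \<Longrightarrow> negligible_on K u"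
    and v: "smooth_net \<Omega> v" "\<And>K. compact K \<Longrightarrow> K \<subseteq> \<Omega> \<Longrightarrow> negligible_on K v"
    using assms(2,3) by (auto simp: mem_negligible_nets[OF assms(1)])
  show ?thesis
    unfolding mem_negligible_nets[OF assms(1)] negligible_on_def
  proof (intro conjI allI impI smooth_net_add assms(1) u(1) v(1))
    fix K r and "is" :: "'a list"
    assume K: "compact K" "K \<subseteq> \<Omega>"
    show "grows r K (\<lambda>\<epsilon>. foldr partial is (\<lambda>x. u \<epsilon> x + v \<epsilon> x))"
      using u(2)[OF K] v(2)[OF K] unfolding negligible_on_def
      by (intro foldr_partial_net_add[OF assms(1) u(1) v(1) K(2)]) blast+
  qed
qed

lemma grows_foldr_partial_mult:
  assumes \<Omega>: "open \<Omega>" and u: "smooth_net \<Omega> u" and v: "smooth_net \<Omega> v" and K: "K \<subseteq> \<Omega>"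
    and g: "grows r K (\<lambda>\<epsilon> x. \<Sum>(ys, zs)\<leftarrow>splits is. foldr partial ys (u \<epsilon>) x * foldr partial zs (v \<epsilon>) x)"
  shows "grows r K (\<lambda>\<epsilon>. foldr partial is (\<lambda>x. u \<epsilon> x * v \<epsilon> x))"
proof (rule grows_cong[OF _ g])
  fix \<epsilon> :: real and x assume "\<epsilon> \<in> {0<..1}" "x \<in> K"
  then show "(\<Sum>(ys, zs)\<leftarrow>splits is. foldr partial ys (u \<epsilon>) x * foldr partial zs (v \<epsilon>) x) =
      foldr partial is (\<lambda>x. u \<epsilon> x * v \<epsilon> x) x"
    using u v K unfolding smooth_net_def smooth_on_def
    by (intro foldr_partial_mult[OF \<Omega>, symmetric]) auto
qed

lemma moderate_on_mult:
  assumes \<Omega>: "open \<Omega>" and u: "smooth_net \<Omega> u" and v: "smooth_net \<Omega> v" and K: "K \<subseteq> \<Omega>"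
    and mu: "moderate_on K u" and mv: "moderate_on K v"
  shows "moderate_on K (\<lambda>\<epsilon> x. u \<epsilon> x * v \<epsilon> x)"
  unfolding moderate_on_def
proof
  fix "is" :: "'a list"
  have "\<exists>r. grows r K (\<lambda>\<epsilon> x. foldr partial (fst p) (u \<epsilon>) x * foldr partial (snd p) (v \<epsilon>) x)" for p
    using mu mv grows_mult unfolding moderate_on_def by blast
  then have "\<exists>r. grows r K (\<lambda>\<epsilon> x. \<Sum>p\<leftarrow>splits is. foldr partial (fst p) (u \<epsilon>) x * foldr partial (snd p) (v \<epsilon>) x)"
    by (intro grows_sum_list_ex)
  then show "\<exists>r. grows r K (\<lambda>\<epsilon>. foldr partial is (\<lambda>x. u \<epsilon> x * v \<epsilon> x))"
    using grows_foldr_partial_mult[OF \<Omega> u v K, of _ "is"] by (auto simp: case_prod_unfold)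
qed

text \<open>In each Leibniz term the exponent \<open>s\<close> of the moderate factor is compensated
  by asking for \<open>r - s\<close> from the negligible one.\<close>

lemma negligible_on_mult:
  assumes \<Omega>: "open \<Omega>" and u: "smooth_net \<Omega> u" and v: "smooth_net \<Omega> v" and K: "K \<subseteq> \<Omega>"
    and mu: "moderate_on K u" and nv: "negligible_on K v"
  shows "negligible_on K (\<lambda>\<epsilon> x. u \<epsilon> x * v \<epsilon> x)"
  unfolding negligible_on_def
proof (intro allI)
  fix "is" :: "'a list" and r
  have "grows r K (\<lambda>\<epsilon> x. foldr partial (fst p) (u \<epsilon>) x * foldr partial (snd p) (v \<epsilon>) x)" for p
  proof -
    obtain s where s: "grows s K (\<lambda>\<epsilon>. foldr partial (fst p) (u \<epsilon>))" using mu unfolding moderate_on_def by blast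
    have "grows (r - s) K (\<lambda>\<epsilon>. foldr partial (snd p) (v \<epsilon>))" using nv unfolding negligible_on_def by blast
    from grows_mult[OF s this] show ?thesis by simp
  qed
  then have "grows r K (\<lambda>\<epsilon> x. \<Sum>p\<leftarrow>splits is. foldr partial (fst p) (u \<epsilon>) x * foldr partial (snd p) (v \<epsilon>) x)"
    by (intro grows_sum_list)
  then show "grows r K (\<lambda>\<epsilon>. foldr partial is (\<lambda>x. u \<epsilon> x * v \<epsilon> x))"
    by (intro grows_foldr_partial_mult[OF \<Omega> u v K]) (simp add: case_prod_unfold)
qed

lemma moderate_on_const_number:
  assumes "\<exists>r. grows r K (\<lambda>\<epsilon> x. c \<epsilon>)"
  shows "moderate_on K (\<lambda>\<epsilon> x. c \<epsilon>)"
  unfolding moderate_on_def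
proof
  fix "is" :: "'a list"
  show "\<exists>r. grows r K (\<lambda>\<epsilon>. foldr partial is (\<lambda>x. c \<epsilon>))"
    unfolding foldr_partial_const using assms grows_zero by (cases "is = []") auto
qed

lemma moderate_on_smooth_function:
  assumes "open \<Omega>" "smooth_on \<Omega> f" "compact K" "K \<subseteq> \<Omega>"
  shows "moderate_on K (\<lambda>_. f)"
  unfolding moderate_on_def
proof
  fix "is" :: "'a list"
  have "bounded (foldr partial is f ` K)"
    by (intro compact_imp_bounded compact_continuous_image assms(3)
        continuous_on_subset[OF smooth_on_continuous[OF assms(2)] assms(4)])
  then obtain C where "\<And>x. x \<in> K \<Longrightarrow> norm (foldr partial is f x) \<le> C" unfolding bounded_iff by auto
  then show "\<exists>r. grows r K (\<lambda>_. foldr partial is f)" using grows_bounded by blast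
qed

lemma mem_net_class_iff:
  "v \<in> net_class \<Omega> u \<longleftrightarrow> (\<lambda>\<epsilon> x. v \<epsilon> x - u \<epsilon> x) \<in> negligible_nets \<Omega>"
proof -
  have "v \<in> net_class \<Omega> u \<longleftrightarrow> (\<exists>h\<in>negligible_nets \<Omega>. v = (\<lambda>\<epsilon> x. h \<epsilon> x + u \<epsilon> x))"
    by (simp add: net_class_def a_r_coset_def' moderate_nets_def)
  also have "\<dots> \<longleftrightarrow> (\<lambda>\<epsilon> x. v \<epsilon> x - u \<epsilon> x) \<in> negligible_nets \<Omega>"
  proof
    assume "(\<lambda>\<epsilon> x. v \<epsilon> x - u \<epsilon> x) \<in> negligible_nets \<Omega>"
    then show "\<exists>h\<in>negligible_nets \<Omega>. v = (\<lambda>\<epsilon> x. h \<epsilon> x + u \<epsilon> x)" by (rule bexI[rotated]) simp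
  qed auto
  finally show ?thesis .
qed

lemma negligible_nets_zero: "open \<Omega> \<Longrightarrow> (\<lambda>_ _. 0) \<in> negligible_nets \<Omega>"
  by (auto simp: mem_negligible_nets negligible_on_def smooth_net_def foldr_partial_const grows_zero)

lemma mem_net_class_self: "open \<Omega> \<Longrightarrow> u \<in> net_class \<Omega> u"
  by (simp add: mem_net_class_iff negligible_nets_zero)

lemma negligible_nets_minus:
  assumes \<Omega>: "open \<Omega>" and "u \<in> negligible_nets \<Omega>"
  shows "(\<lambda>\<epsilon> x. - u \<epsilon> x) \<in> negligible_nets \<Omega>"
proof -
  have u: "smooth_net \<Omega> u" "\<And>K. compact K \<Longrightarrow> K \<subseteq> \<Omega> \<Longrightarrow> negligible_on K u"
    using assms(2) by (auto simp: mem_negligible_nets[OF assms(1)])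
  have "moderate_on K (\<lambda>_ _. - 1)" for K :: "(real ^ 'a) set"
    unfolding moderate_on_def foldr_partial_const
    using grows_bounded[of K "\<lambda>_. -1" 1] grows_zero[of 0 K] by auto
  then have "(\<lambda>\<epsilon> x. - 1 * u \<epsilon> x) \<in> negligible_nets \<Omega>"
    unfolding mem_negligible_nets[OF \<Omega>] using u
    by (intro conjI allI impI smooth_net_mult negligible_on_mult[OF \<Omega>] smooth_net_const \<Omega>) auto
  then show ?thesis by simp
qed

lemma net_class_eqI:
  assumes \<Omega>: "open \<Omega>" and "(\<lambda>\<epsilon> x. u \<epsilon> x - v \<epsilon> x) \<in> negligible_nets \<Omega>"
  shows "net_class \<Omega> u = net_class \<Omega> v"
proof (rule Set.set_eqI)
  fix w
  have 1: "(\<lambda>\<epsilon> x. (w \<epsilon> x - u \<epsilon> x) + (u \<epsilon> x - v \<epsilon> x)) = (\<lambda>\<epsilon> x. w \<epsilon> x - v \<epsilon> x)"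
    "(\<lambda>\<epsilon> x. (w \<epsilon> x - v \<epsilon> x) + - (u \<epsilon> x - v \<epsilon> x)) = (\<lambda>\<epsilon> x. w \<epsilon> x - u \<epsilon> x)" by auto
  show "w \<in> net_class \<Omega> u \<longleftrightarrow> w \<in> net_class \<Omega> v"
    unfolding mem_net_class_iff
    using negligible_nets_add[OF \<Omega> _ assms(2), of "\<lambda>\<epsilon> x. w \<epsilon> x - u \<epsilon> x"]
      negligible_nets_add[OF \<Omega> _ negligible_nets_minus[OF assms], of "\<lambda>\<epsilon> x. w \<epsilon> x - v \<epsilon> x"]
    unfolding 1 by blast
qed

lemma carrier_colombeau: "carrier (colombeau \<Omega>) = net_class \<Omega> ` carrier (moderate_nets \<Omega>)"
  by (auto simp: colombeau_def FactRing_def A_RCOSETS_def' net_class_def)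

lemma zero_colombeau: "\<zero>\<^bsub>colombeau \<Omega>\<^esub> = negligible_nets \<Omega>"
  by (simp add: colombeau_def FactRing_def)

section \<open>Generalized numbers and differential operators\<close>

lemma eventually_small: "0 < b \<Longrightarrow> \<forall>\<^sub>F \<epsilon> in at_right 0. \<epsilon> \<in> {0<..1 :: real} \<and> \<epsilon> < b"
  using eventually_at_right_real[of 0 "min b 1"] by (auto elim!: eventually_mono)

abbreviation number_grows :: "real \<Rightarrow> (real \<Rightarrow> complex) \<Rightarrow> bool" where
  "number_grows r c \<equiv> grows r {()} (\<lambda>\<epsilon> _. c \<epsilon>)"

lemma number_grows_iff: "number_grows r c \<longleftrightarrow> (\<exists>C. \<forall>\<^sub>F \<epsilon> in at_right 0. norm (c \<epsilon>) \<le> C * \<epsilon> powr r)"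
  by (simp add: grows_def)

lemma number_grows_imp_grows: "number_grows r c \<Longrightarrow> grows r K (\<lambda>\<epsilon> x. c \<epsilon>)"
  unfolding grows_def by (elim exE, rule_tac x = C in exI, erule eventually_mono) simp

lemma grows_imp_number_grows: "grows r K u \<Longrightarrow> x \<in> K \<Longrightarrow> number_grows r (\<lambda>\<epsilon>. u \<epsilon> x)"
  unfolding grows_def by (elim exE, rule_tac x = C in exI, erule eventually_mono) simp

text \<open>
  In the definition of the generalized numbers the exponents are complex, but the order on the
  complex numbers makes \<open>0 \<le> p\<close> say that \<open>p\<close> is real and nonnegative.
\<close>

lemma bigo_powr_iff: "c \<in> O[at_right 0](\<lambda>\<epsilon>. complex_of_real \<epsilon> powr p) \<longleftrightarrow> number_grows (Re p) c"
proof -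
  have ev: "\<forall>\<^sub>F \<epsilon> in at_right 0. norm (complex_of_real \<epsilon> powr p) = \<epsilon> powr Re p"
    using eventually_unit_interval by eventually_elim (simp add: norm_powr_real_powr)
  show ?thesis
  proof
    assume "c \<in> O[at_right 0](\<lambda>\<epsilon>. complex_of_real \<epsilon> powr p)"
    then obtain C where "\<forall>\<^sub>F \<epsilon> in at_right 0. norm (c \<epsilon>) \<le> C * norm (complex_of_real \<epsilon> powr p)"
      unfolding bigo_def by auto
    with ev have "\<forall>\<^sub>F \<epsilon> in at_right 0. norm (c \<epsilon>) \<le> C * \<epsilon> powr Re p" by eventually_elim simp
    then show "number_grows (Re p) c" unfolding number_grows_iff ..
  next
    assume "number_grows (Re p) c"
    then obtain C where "\<forall>\<^sub>F \<epsilon> in at_right 0. norm (c \<epsilon>) \<le> C * \<epsilon> powr Re p" unfolding number_grows_iff ..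
    with ev have "\<forall>\<^sub>F \<epsilon> in at_right 0. norm (c \<epsilon>) \<le> C * norm (complex_of_real \<epsilon> powr p)" by eventually_elim simp
    then show "c \<in> O[at_right 0](\<lambda>\<epsilon>. complex_of_real \<epsilon> powr p)" by (rule bigoI)
  qed
qed

lemma carrier_moderate_numbers: "c \<in> carrier moderate_numbers \<longleftrightarrow> (\<exists>r. number_grows r c)"
proof
  assume "\<exists>r. number_grows r c"
  then obtain r where "number_grows r c" ..
  then have "number_grows (- max 0 (- r)) c" by (rule grows_mono_exponent) simp
  then have "c \<in> O[at_right 0](\<lambda>\<epsilon>. complex_of_real \<epsilon> powr (- complex_of_real (max 0 (- r))))"
    unfolding bigo_powr_iff by simp
  moreover have "0 \<le> complex_of_real (max 0 (- r))" by (simp add: less_eq_complex_def)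
  ultimately show "c \<in> carrier moderate_numbers" unfolding moderate_numbers_def by auto
qed (auto simp: moderate_numbers_def bigo_powr_iff)

lemma mem_negligible_numbers: "c \<in> negligible_numbers \<longleftrightarrow> (\<forall>r. number_grows r c)"
proof
  assume c: "c \<in> negligible_numbers"
  show "\<forall>r. number_grows r c"
  proof
    fix r :: real
    have "0 \<le> complex_of_real (max 0 r)" by (simp add: less_eq_complex_def)
    then have "number_grows (Re (complex_of_real (max 0 r))) c"
      using c unfolding negligible_numbers_def bigo_powr_iff by blast
    then show "number_grows r c" by (rule grows_mono_exponent) simp
  qed
qed (auto simp: negligible_numbers_def bigo_powr_iff)

lemma negligible_numbers_add:
  "c \<in> negligible_numbers \<Longrightarrow> d \<in> negligible_numbers \<Longrightarrow> (\<lambda>\<epsilon>. c \<epsilon> + d \<epsilon>) \<in> negligible_numbers"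
  unfolding mem_negligible_numbers using grows_add by blast

lemma moderate_numbers_add:
  assumes "c \<in> carrier moderate_numbers" "d \<in> carrier moderate_numbers"
  shows "(\<lambda>\<epsilon>. c \<epsilon> + d \<epsilon>) \<in> carrier moderate_numbers"
proof -
  obtain r s where "number_grows r c" "number_grows s d"
    using assms by (auto simp: carrier_moderate_numbers)
  then have "number_grows (min r s) (\<lambda>\<epsilon>. c \<epsilon> + d \<epsilon>)"
    by (intro grows_add) (auto elim: grows_mono_exponent)
  then show ?thesis unfolding carrier_moderate_numbers by blast
qed

lemma moderate_numbers_mult:
  "c \<in> carrier moderate_numbers \<Longrightarrow> d \<in> carrier moderate_numbers \<Longrightarrow>
    (\<lambda>\<epsilon>. c \<epsilon> * d \<epsilon>) \<in> carrier moderate_numbers"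
  unfolding carrier_moderate_numbers using grows_mult by blast

lemma negligible_numbers_mult:
  assumes "c \<in> carrier moderate_numbers" "d \<in> negligible_numbers"
  shows "(\<lambda>\<epsilon>. c \<epsilon> * d \<epsilon>) \<in> negligible_numbers"
  unfolding mem_negligible_numbers
proof
  fix r
  obtain s where s: "number_grows s c" using assms(1) by (auto simp: carrier_moderate_numbers)
  have "number_grows (r - s) d" using assms(2) by (simp add: mem_negligible_numbers)
  from grows_mult[OF s this] show "number_grows r (\<lambda>\<epsilon>. c \<epsilon> * d \<epsilon>)" by simp
qed

lemma negligible_imp_moderate_number: "c \<in> negligible_numbers \<Longrightarrow> c \<in> carrier moderate_numbers"
  by (auto simp: carrier_moderate_numbers mem_negligible_numbers)

lemma moderate_numbers_const: "(\<lambda>_. c) \<in> carrier moderate_numbers"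
  unfolding carrier_moderate_numbers using grows_bounded[of "{()}" "\<lambda>_. c" "norm c"] by auto

lemma negligible_numbers_zero: "(\<lambda>_. 0) \<in> negligible_numbers"
  by (simp add: mem_negligible_numbers grows_zero)

lemma negligible_numbers_minus: "c \<in> negligible_numbers \<Longrightarrow> (\<lambda>\<epsilon>. - c \<epsilon>) \<in> negligible_numbers"
  using negligible_numbers_mult[OF moderate_numbers_const[of "-1"]] by simp

lemma negligible_numbers_diff:
  "c \<in> negligible_numbers \<Longrightarrow> d \<in> negligible_numbers \<Longrightarrow> (\<lambda>\<epsilon>. c \<epsilon> - d \<epsilon>) \<in> negligible_numbers"
  using negligible_numbers_add[OF _ negligible_numbers_minus] by simp

lemma number_grows_cnj: "number_grows r (\<lambda>\<epsilon>. cnj (c \<epsilon>)) \<longleftrightarrow> number_grows r c"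
  by (simp add: grows_def)

lemma negligible_numbers_sum:
  "(\<And>i. i \<in> I \<Longrightarrow> c i \<in> negligible_numbers) \<Longrightarrow> (\<lambda>\<epsilon>. \<Sum>i\<in>I. c i \<epsilon>) \<in> negligible_numbers"
  by (induction I rule: infinite_finite_induct) (auto intro: negligible_numbers_zero negligible_numbers_add)

lemma moderate_numbers_sum:
  "(\<And>i. i \<in> I \<Longrightarrow> c i \<in> carrier moderate_numbers) \<Longrightarrow> (\<lambda>\<epsilon>. \<Sum>i\<in>I. c i \<epsilon>) \<in> carrier moderate_numbers"
  by (induction I rule: infinite_finite_induct) (auto intro: moderate_numbers_const moderate_numbers_add)

lemma mem_number_class_iff: "d \<in> number_class c \<longleftrightarrow> (\<lambda>\<epsilon>. d \<epsilon> - c \<epsilon>) \<in> negligible_numbers"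
proof -
  have "d \<in> number_class c \<longleftrightarrow> (\<exists>h\<in>negligible_numbers. d = (\<lambda>\<epsilon>. h \<epsilon> + c \<epsilon>))"
    by (simp add: number_class_def a_r_coset_def' moderate_numbers_def)
  also have "\<dots> \<longleftrightarrow> (\<lambda>\<epsilon>. d \<epsilon> - c \<epsilon>) \<in> negligible_numbers"
  proof
    assume "(\<lambda>\<epsilon>. d \<epsilon> - c \<epsilon>) \<in> negligible_numbers"
    then show "\<exists>h\<in>negligible_numbers. d = (\<lambda>\<epsilon>. h \<epsilon> + c \<epsilon>)" by (rule bexI[rotated]) simp
  qed auto
  finally show ?thesis .
qed

lemma mem_number_class_self: "c \<in> number_class c"
  by (simp add: mem_number_class_iff negligible_numbers_zero)

lemma number_class_eqI:
  assumes "(\<lambda>\<epsilon>. c \<epsilon> - d \<epsilon>) \<in> negligible_numbers"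
  shows "number_class c = number_class d"
proof (rule Set.set_eqI)
  fix w
  have 1: "(\<lambda>\<epsilon>. (w \<epsilon> - c \<epsilon>) + (c \<epsilon> - d \<epsilon>)) = (\<lambda>\<epsilon>. w \<epsilon> - d \<epsilon>)"
    "(\<lambda>\<epsilon>. (w \<epsilon> - d \<epsilon>) - (c \<epsilon> - d \<epsilon>)) = (\<lambda>\<epsilon>. w \<epsilon> - c \<epsilon>)" by auto
  show "w \<in> number_class c \<longleftrightarrow> w \<in> number_class d"
    unfolding mem_number_class_iff
    using negligible_numbers_add[OF _ assms, of "\<lambda>\<epsilon>. w \<epsilon> - c \<epsilon>"]
      negligible_numbers_diff[OF _ assms, of "\<lambda>\<epsilon>. w \<epsilon> - d \<epsilon>"]
    unfolding 1 by blast
qed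

lemma carrier_gen_numbers: "carrier gen_numbers = number_class ` carrier moderate_numbers"
  by (auto simp: gen_numbers_def FactRing_def A_RCOSETS_def' number_class_def)

lemma one_gen_numbers: "\<one>\<^bsub>gen_numbers\<^esub> = number_class (\<lambda>_. 1)"
  by (simp add: gen_numbers_def FactRing_def number_class_def moderate_numbers_def)

text \<open>The product of cosets is a union over pairs of representatives. All its terms coincide,
  because negligible numbers absorb products with moderate ones.\<close>

lemma mult_gen_numbers:
  assumes c: "c \<in> carrier moderate_numbers" and d: "d \<in> carrier moderate_numbers"
  shows "number_class c \<otimes>\<^bsub>gen_numbers\<^esub> number_class d = number_class (\<lambda>\<epsilon>. c \<epsilon> * d \<epsilon>)"
proof -
  have "number_class c \<otimes>\<^bsub>gen_numbers\<^esub> number_class d =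
      (\<Union>a\<in>number_class c. \<Union>b\<in>number_class d. number_class (\<lambda>\<epsilon>. a \<epsilon> * b \<epsilon>))"
    by (simp add: gen_numbers_def FactRing_def rcoset_mult_def number_class_def moderate_numbers_def)
  also have "\<dots> = number_class (\<lambda>\<epsilon>. c \<epsilon> * d \<epsilon>)"
  proof (intro SUP_eq_const)
    show "number_class c \<noteq> {}" "number_class d \<noteq> {}" using mem_number_class_self by blast+
    show "number_class (\<lambda>\<epsilon>. a \<epsilon> * b \<epsilon>) = number_class (\<lambda>\<epsilon>. c \<epsilon> * d \<epsilon>)"
    if a: "a \<in> number_class c" and b: "b \<in> number_class d" for a b
  proof (rule number_class_eqI)
    have a': "(\<lambda>\<epsilon>. a \<epsilon> - c \<epsilon>) \<in> negligible_numbers" and b': "(\<lambda>\<epsilon>. b \<epsilon> - d \<epsilon>) \<in> negligible_numbers"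
      using a b by (auto simp: mem_number_class_iff)
    have am: "(\<lambda>\<epsilon>. (a \<epsilon> - c \<epsilon>) + c \<epsilon>) \<in> carrier moderate_numbers"
      by (intro moderate_numbers_add negligible_imp_moderate_number a' c)
    have "(\<lambda>\<epsilon>. ((a \<epsilon> - c \<epsilon>) + c \<epsilon>) * (b \<epsilon> - d \<epsilon>) + d \<epsilon> * (a \<epsilon> - c \<epsilon>)) \<in> negligible_numbers"
      by (intro negligible_numbers_add negligible_numbers_mult am a' b' d)
    then show "(\<lambda>\<epsilon>. a \<epsilon> * b \<epsilon> - c \<epsilon> * d \<epsilon>) \<in> negligible_numbers" by (simp add: algebra_simps)
    qed
  qed
  finally show ?thesis .
qed

text \<open>If \<open>d * c\<close> is close to 1 and \<open>d\<close> is at most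
  \<open>C * \<epsilon> powr r\<close>, then \<open>c\<close> is at least
  \<open>\<epsilon> powr (- r) / (2 * C)\<close>. Conversely the lower bound makes the pointwise
  reciprocal moderate.\<close>

lemma number_class_unit_iff:
  assumes c: "c \<in> carrier moderate_numbers"
  shows "number_class c \<in> Units gen_numbers \<longleftrightarrow> (\<exists>N. \<forall>\<^sub>F \<epsilon> in at_right 0. \<epsilon> powr N \<le> norm (c \<epsilon>))"
proof
  assume "number_class c \<in> Units gen_numbers"
  then obtain D where D: "D \<in> carrier gen_numbers" "D \<otimes>\<^bsub>gen_numbers\<^esub> number_class c = \<one>\<^bsub>gen_numbers\<^esub>"
    unfolding Units_def by blast
  then obtain d where d: "D = number_class d" "d \<in> carrier moderate_numbers" by (auto simp: carrier_gen_numbers)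
  have "number_class (\<lambda>\<epsilon>. d \<epsilon> * c \<epsilon>) = number_class (\<lambda>_. 1)"
    using D(2) unfolding d(1) mult_gen_numbers[OF d(2) c] one_gen_numbers .
  then have "(\<lambda>\<epsilon>. d \<epsilon> * c \<epsilon> - 1) \<in> negligible_numbers"
    using mem_number_class_self[of "\<lambda>\<epsilon>. d \<epsilon> * c \<epsilon>"] by (simp add: mem_number_class_iff)
  then have "number_grows 1 (\<lambda>\<epsilon>. d \<epsilon> * c \<epsilon> - 1)" by (simp add: mem_negligible_numbers)
  from growsD[OF this] obtain B where B: "0 < B"
    "\<forall>\<^sub>F \<epsilon> in at_right 0. \<epsilon> \<in> {0<..1} \<and> (\<forall>x\<in>{()}. norm (d \<epsilon> * c \<epsilon> - 1) \<le> B * \<epsilon> powr 1)" by (elim exE conjE)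
  obtain r where r: "number_grows r d" using d(2) by (auto simp: carrier_moderate_numbers)
  from growsD[OF this] obtain C where C: "0 < C"
    "\<forall>\<^sub>F \<epsilon> in at_right 0. \<epsilon> \<in> {0<..1} \<and> (\<forall>x\<in>{()}. norm (d \<epsilon>) \<le> C * \<epsilon> powr r)" by (elim exE conjE)
  have small: "\<forall>\<^sub>F \<epsilon> in at_right 0. \<epsilon> \<in> {0<..1} \<and> \<epsilon> < 1 / (2 * B)"
    "\<forall>\<^sub>F \<epsilon> in at_right 0. \<epsilon> \<in> {0<..1} \<and> \<epsilon> < 1 / (2 * C)"
    by (intro eventually_small divide_pos_pos; use B(1) C(1) in simp)+
  \<comment> \<open>The extra power of \<epsilon> in \<open>1 - r\<close> absorbs the constant
    \<open>2 * C\<close>.\<close>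
  have "\<forall>\<^sub>F \<epsilon> in at_right 0. \<epsilon> powr (1 - r) \<le> norm (c \<epsilon>)"
    using B(2) C(2) small
  proof eventually_elim
    fix \<epsilon> :: real
    assume 1: "\<epsilon> \<in> {0<..1} \<and> (\<forall>x\<in>{()}. norm (d \<epsilon> * c \<epsilon> - 1) \<le> B * \<epsilon> powr 1)"
      and 2: "\<epsilon> \<in> {0<..1} \<and> (\<forall>x\<in>{()}. norm (d \<epsilon>) \<le> C * \<epsilon> powr r)"
      and 3: "\<epsilon> \<in> {0<..1} \<and> \<epsilon> < 1 / (2 * B)" and 4: "\<epsilon> \<in> {0<..1} \<and> \<epsilon> < 1 / (2 * C)"
    have "B * \<epsilon> \<le> 1 / 2" "2 * C * \<epsilon> \<le> 1" using 3 4 B(1) C(1) by (auto simp: field_simps)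
    have "norm (d \<epsilon> * c \<epsilon> - 1) \<le> 1 / 2" using 1 \<open>B * \<epsilon> \<le> 1 / 2\<close> by auto
    then have "1 / 2 \<le> norm (d \<epsilon> * c \<epsilon>)"
      using norm_triangle_ineq2[of 1 "1 - d \<epsilon> * c \<epsilon>"] by (simp add: norm_minus_commute)
    also have "\<dots> \<le> C * \<epsilon> powr r * norm (c \<epsilon>)" unfolding norm_mult using 2 by (intro mult_right_mono) auto
    finally have "1 \<le> 2 * C * \<epsilon> powr r * norm (c \<epsilon>)" by simp
    with \<open>2 * C * \<epsilon> \<le> 1\<close> have "(2 * C) * \<epsilon> \<le> (2 * C) * (\<epsilon> powr r * norm (c \<epsilon>))"
      unfolding mult.assoc by (rule order_trans)
    then have "\<epsilon> \<le> \<epsilon> powr r * norm (c \<epsilon>)" using C(1) by (simp add: mult_le_cancel_left_pos)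
    moreover have "0 < \<epsilon> powr r" using 1 by simp
    ultimately have "\<epsilon> / \<epsilon> powr r \<le> norm (c \<epsilon>)" by (simp add: divide_le_eq mult.commute)
    then show "\<epsilon> powr (1 - r) \<le> norm (c \<epsilon>)" using 1 by (simp add: powr_diff)
  qed
  then show "\<exists>N. \<forall>\<^sub>F \<epsilon> in at_right 0. \<epsilon> powr N \<le> norm (c \<epsilon>)" ..
next
  assume "\<exists>N. \<forall>\<^sub>F \<epsilon> in at_right 0. \<epsilon> powr N \<le> norm (c \<epsilon>)"
  then obtain N where N: "\<forall>\<^sub>F \<epsilon> in at_right 0. \<epsilon> powr N \<le> norm (c \<epsilon>)" ..
  \<comment> \<open>Where \<open>c\<close> vanishes this is 0 by convention; the lower bound rules
    that out for small \<epsilon>.\<close>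
  define d where "d \<epsilon> = inverse (c \<epsilon>)" for \<epsilon>
  have "number_grows (- N) d"
    unfolding number_grows_iff
  proof
    show "\<forall>\<^sub>F \<epsilon> in at_right 0. norm (d \<epsilon>) \<le> 1 * \<epsilon> powr (- N)"
      using N eventually_unit_interval
    proof eventually_elim
      case (elim \<epsilon>)
      have "inverse (norm (c \<epsilon>)) \<le> inverse (\<epsilon> powr N)" using elim by (intro le_imp_inverse_le) auto
      then show ?case by (simp add: d_def norm_inverse powr_minus)
    qed
  qed
  then have d: "d \<in> carrier moderate_numbers" unfolding carrier_moderate_numbers by blast
  have "number_grows r (\<lambda>\<epsilon>. d \<epsilon> * c \<epsilon> - 1)" for r
    unfolding number_grows_iff
  proof
    show "\<forall>\<^sub>F \<epsilon> in at_right 0. norm (d \<epsilon> * c \<epsilon> - 1) \<le> 0 * \<epsilon> powr r"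
      using N eventually_unit_interval
    proof eventually_elim
      case (elim \<epsilon>)
      have "0 < \<epsilon> powr N" using elim by simp
      then have "c \<epsilon> \<noteq> 0" using elim by auto
      then show ?case by (simp add: d_def)
    qed
  qed
  then have eq: "number_class (\<lambda>\<epsilon>. d \<epsilon> * c \<epsilon>) = \<one>\<^bsub>gen_numbers\<^esub>"
    unfolding one_gen_numbers by (intro number_class_eqI) (simp add: mem_negligible_numbers)
  have "number_class d \<otimes>\<^bsub>gen_numbers\<^esub> number_class c = \<one>\<^bsub>gen_numbers\<^esub>"
    "number_class c \<otimes>\<^bsub>gen_numbers\<^esub> number_class d = \<one>\<^bsub>gen_numbers\<^esub>"
    unfolding mult_gen_numbers[OF d c] mult_gen_numbers[OF c d] using eq by (simp_all add: mult.commute)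
  then show "number_class c \<in> Units gen_numbers"
    unfolding Units_def using c d carrier_gen_numbers by blast
qed

section \<open>Independence of the operator from the representatives\<close>

lemma coeff_reps_moderate:
  assumes "\<And>\<alpha>. mi_size \<alpha> \<le> m \<Longrightarrow> A \<alpha> \<in> carrier gen_numbers" "a \<in> coeff_reps m A" "mi_size \<alpha> \<le> m"
  shows "a \<alpha> \<in> carrier moderate_numbers"
proof -
  obtain c where c: "A \<alpha> = number_class c" "c \<in> carrier moderate_numbers"
    using assms(1)[OF assms(3)] by (auto simp: carrier_gen_numbers)
  have "(\<lambda>\<epsilon>. a \<alpha> \<epsilon> - c \<epsilon>) \<in> negligible_numbers"
    using assms(2,3) c(1) by (auto simp: coeff_reps_def mem_number_class_iff)
  from moderate_numbers_add[OF negligible_imp_moderate_number[OF this] c(2)] show ?thesis by simp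
qed

lemma coeff_reps_diff:
  assumes "\<And>\<alpha>. mi_size \<alpha> \<le> m \<Longrightarrow> A \<alpha> \<in> carrier gen_numbers"
    and "a \<in> coeff_reps m A" "b \<in> coeff_reps m A" "mi_size \<alpha> \<le> m"
  shows "(\<lambda>\<epsilon>. a \<alpha> \<epsilon> - b \<alpha> \<epsilon>) \<in> negligible_numbers"
proof -
  obtain c where c: "A \<alpha> = number_class c" using assms(1)[OF assms(4)] by (auto simp: carrier_gen_numbers)
  have "(\<lambda>\<epsilon>. a \<alpha> \<epsilon> - c \<epsilon>) \<in> negligible_numbers" "(\<lambda>\<epsilon>. b \<alpha> \<epsilon> - c \<epsilon>) \<in> negligible_numbers"
    using assms(2-4) c by (auto simp: coeff_reps_def mem_number_class_iff)
  from negligible_numbers_diff[OF this] show ?thesis by simp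
qed

lemma coeff_reps_nonempty:
  assumes "\<And>\<alpha>. mi_size \<alpha> \<le> m \<Longrightarrow> A \<alpha> \<in> carrier gen_numbers"
  obtains a where "a \<in> coeff_reps m A"
proof -
  have "\<forall>\<alpha>. \<exists>c. mi_size \<alpha> \<le> m \<longrightarrow> c \<in> A \<alpha>"
    using assms mem_number_class_self unfolding carrier_gen_numbers by fastforce
  from choice[OF this] show ?thesis using that by (auto simp: coeff_reps_def)
qed

lemma moderate_nets_mult:
  assumes \<Omega>: "open \<Omega>" and "u \<in> carrier (moderate_nets \<Omega>)" "v \<in> carrier (moderate_nets \<Omega>)"
  shows "(\<lambda>\<epsilon> x. u \<epsilon> x * v \<epsilon> x) \<in> carrier (moderate_nets \<Omega>)"
  using assms unfolding carrier_moderate_nets[OF \<Omega>]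
  by (auto intro!: smooth_net_mult moderate_on_mult[OF \<Omega>])

lemma negligible_nets_mult:
  assumes \<Omega>: "open \<Omega>" and "u \<in> carrier (moderate_nets \<Omega>)" "v \<in> negligible_nets \<Omega>"
  shows "(\<lambda>\<epsilon> x. u \<epsilon> x * v \<epsilon> x) \<in> negligible_nets \<Omega>"
  using assms unfolding carrier_moderate_nets[OF \<Omega>] mem_negligible_nets[OF \<Omega>]
  by (auto intro!: smooth_net_mult negligible_on_mult[OF \<Omega>])

lemma moderate_nets_number:
  "open \<Omega> \<Longrightarrow> c \<in> carrier moderate_numbers \<Longrightarrow> (\<lambda>\<epsilon> x. c \<epsilon>) \<in> carrier (moderate_nets \<Omega>)"
  unfolding carrier_moderate_nets carrier_moderate_numbers
  using number_grows_imp_grows by (auto intro!: smooth_net_const moderate_on_const_number)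

lemma negligible_nets_number:
  assumes \<Omega>: "open \<Omega>" and c: "c \<in> negligible_numbers"
  shows "(\<lambda>\<epsilon> x. c \<epsilon>) \<in> negligible_nets \<Omega>"
  unfolding mem_negligible_nets[OF \<Omega>] negligible_on_def foldr_partial_const
proof (intro conjI allI impI smooth_net_const)
  fix K :: "(real ^ 'a) set" and "is" :: "'a list" and r
  have "grows r K (\<lambda>\<epsilon> x. c \<epsilon>)"
    by (rule number_grows_imp_grows) (use c in \<open>simp add: mem_negligible_numbers\<close>)
  then show "grows r K (\<lambda>\<epsilon>. if is = [] then (\<lambda>_. c \<epsilon>) else (\<lambda>_. 0))"
    by (cases "is = []") (simp_all add: grows_zero)
qed

lemma smooth_net_mi_deriv: "smooth_net \<Omega> u \<Longrightarrow> smooth_net \<Omega> (\<lambda>\<epsilon>. mi_deriv \<alpha> (u \<epsilon>))"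
  unfolding smooth_net_def mi_deriv_eq_foldr using smooth_on_foldr_partial by blast

lemma moderate_nets_mi_deriv:
  assumes \<Omega>: "open \<Omega>" and "u \<in> carrier (moderate_nets \<Omega>)"
  shows "(\<lambda>\<epsilon>. mi_deriv \<alpha> (u \<epsilon>)) \<in> carrier (moderate_nets \<Omega>)"
proof -
  have "moderate_on K (\<lambda>\<epsilon>. mi_deriv \<alpha> (u \<epsilon>))" if "moderate_on K u" for K
    unfolding moderate_on_def
  proof
    fix "is" :: "'a list"
    show "\<exists>r. grows r K (\<lambda>\<epsilon>. foldr partial is (mi_deriv \<alpha> (u \<epsilon>)))"
      using that[unfolded moderate_on_def, rule_format, of "is @ mi_list \<alpha>"] by (simp add: mi_deriv_eq_foldr)
  qed
  then show ?thesis using assms(2) unfolding carrier_moderate_nets[OF \<Omega>] using smooth_net_mi_deriv by blast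
qed

lemma negligible_nets_mi_deriv:
  assumes \<Omega>: "open \<Omega>" and "u \<in> negligible_nets \<Omega>"
  shows "(\<lambda>\<epsilon>. mi_deriv \<alpha> (u \<epsilon>)) \<in> negligible_nets \<Omega>"
proof -
  have "negligible_on K (\<lambda>\<epsilon>. mi_deriv \<alpha> (u \<epsilon>))" if "negligible_on K u" for K
    unfolding negligible_on_def
  proof (intro allI)
    fix "is" :: "'a list" and r
    show "grows r K (\<lambda>\<epsilon>. foldr partial is (mi_deriv \<alpha> (u \<epsilon>)))"
      using that[unfolded negligible_on_def, rule_format, of r "is @ mi_list \<alpha>"] by (simp add: mi_deriv_eq_foldr)
  qed
  then show ?thesis using assms(2) unfolding mem_negligible_nets[OF \<Omega>] using smooth_net_mi_deriv by blast
qed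

lemma negligible_nets_sum:
  assumes \<Omega>: "open \<Omega>"
  shows "(\<And>i. i \<in> I \<Longrightarrow> F i \<in> negligible_nets \<Omega>) \<Longrightarrow> (\<lambda>\<epsilon> x. \<Sum>i\<in>I. F i \<epsilon> x) \<in> negligible_nets \<Omega>"
  by (induction I rule: infinite_finite_induct) (auto intro: negligible_nets_zero[OF \<Omega>] negligible_nets_add[OF \<Omega>])

lemma negligible_nets_cong:
  assumes \<Omega>: "open \<Omega>" and eq: "\<And>\<epsilon> x. \<epsilon> \<in> {0<..1} \<Longrightarrow> x \<in> \<Omega> \<Longrightarrow> u \<epsilon> x = v \<epsilon> x" and u: "u \<in> negligible_nets \<Omega>"
  shows "v \<in> negligible_nets \<Omega>"
  unfolding mem_negligible_nets[OF \<Omega>] negligible_on_def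
proof (intro conjI allI impI)
  have u': "smooth_net \<Omega> u" "\<And>K. compact K \<Longrightarrow> K \<subseteq> \<Omega> \<Longrightarrow> negligible_on K u"
    using u by (auto simp: mem_negligible_nets[OF \<Omega>])
  show "smooth_net \<Omega> v"
    unfolding smooth_net_def
  proof
    fix \<epsilon> :: real assume \<epsilon>: "\<epsilon> \<in> {0<..1}"
    show "smooth_on \<Omega> (v \<epsilon>)"
      by (rule smooth_on_cong[OF \<Omega> eq[OF \<epsilon>]]) (use u'(1) \<epsilon> in \<open>auto simp: smooth_net_def\<close>)
  qed
  fix K "is" r assume K: "compact K" "K \<subseteq> \<Omega>"
  show "grows r K (\<lambda>\<epsilon>. foldr partial is (v \<epsilon>))"
  proof (rule grows_cong)
    show "grows r K (\<lambda>\<epsilon>. foldr partial is (u \<epsilon>))" using u'(2)[OF K] by (simp add: negligible_on_def)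
    show "foldr partial is (u \<epsilon>) x = foldr partial is (v \<epsilon>) x" if "\<epsilon> \<in> {0<..1}" "x \<in> K" for \<epsilon> x
      by (rule foldr_partial_cong[OF \<Omega> _ eq[OF that(1)]]) (use that K in auto)
  qed
qed

lemma negligible_nets_subset:
  assumes "open \<Omega>" "open V" "V \<subseteq> \<Omega>" "u \<in> negligible_nets \<Omega>"
  shows "u \<in> negligible_nets V"
  using assms(3,4) unfolding mem_negligible_nets[OF assms(1)] mem_negligible_nets[OF assms(2)] smooth_net_def
  by (auto intro: smooth_on_subset)

text \<open>With \<open>w = u - u\<^sub>0\<close>, every term of the difference splits into a
  derivative of \<open>u\<^sub>0\<close> times the difference of the coefficients and a coefficient
  times a derivative of \<open>w\<close>. Both are moderate times negligible.\<close>

lemma diff_op_net_diff_negligible: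
  assumes \<Omega>: "open \<Omega>" and A: "\<And>\<alpha>. mi_size \<alpha> \<le> m \<Longrightarrow> A \<alpha> \<in> carrier gen_numbers"
    and a: "a \<in> coeff_reps m A" and a\<^sub>0: "a\<^sub>0 \<in> coeff_reps m A"
    and u\<^sub>0: "u\<^sub>0 \<in> carrier (moderate_nets \<Omega>)" and h: "(\<lambda>\<epsilon> x. u \<epsilon> x - u\<^sub>0 \<epsilon> x) \<in> negligible_nets \<Omega>"
  shows "(\<lambda>\<epsilon> x. diff_op_net m a u \<epsilon> x - diff_op_net m a\<^sub>0 u\<^sub>0 \<epsilon> x) \<in> negligible_nets \<Omega>"
proof -
  define w where "w \<epsilon> x = u \<epsilon> x - u\<^sub>0 \<epsilon> x" for \<epsilon> x
  have w: "w \<in> negligible_nets \<Omega>" using h by (simp add: w_def[abs_def])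
  let ?s = "\<lambda>\<alpha>. (- \<i>) ^ mi_size \<alpha>"
  let ?F = "\<lambda>\<alpha> \<epsilon> x. (mi_deriv \<alpha> (u\<^sub>0 \<epsilon>) x * ?s \<alpha>) * (a \<alpha> \<epsilon> - a\<^sub>0 \<alpha> \<epsilon>) + (a \<alpha> \<epsilon> * ?s \<alpha>) * mi_deriv \<alpha> (w \<epsilon>) x"
  have "(\<lambda>\<epsilon> x. \<Sum>\<alpha> | mi_size \<alpha> \<le> m. ?F \<alpha> \<epsilon> x) \<in> negligible_nets \<Omega>"
  proof (rule negligible_nets_sum[OF \<Omega>])
    fix \<alpha> :: "'a multiindex" assume "\<alpha> \<in> {\<alpha>. mi_size \<alpha> \<le> m}"
    then have \<alpha>: "mi_size \<alpha> \<le> m" by simp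
    have k: "(\<lambda>\<epsilon>. a \<alpha> \<epsilon> * ?s \<alpha>) \<in> carrier moderate_numbers"
      by (intro moderate_numbers_mult coeff_reps_moderate[OF A a \<alpha>] moderate_numbers_const)
    show "?F \<alpha> \<in> negligible_nets \<Omega>"
      by (intro negligible_nets_add[OF \<Omega>] negligible_nets_mult[OF \<Omega>] moderate_nets_mult[OF \<Omega>]
          moderate_nets_mi_deriv[OF \<Omega> u\<^sub>0] moderate_nets_number[OF \<Omega>] negligible_nets_number[OF \<Omega>]
          coeff_reps_diff[OF A a a\<^sub>0 \<alpha>] k moderate_numbers_const negligible_nets_mi_deriv[OF \<Omega> w])
  qed
  then show ?thesis
  proof (rule negligible_nets_cong[OF \<Omega>, rotated])
    fix \<epsilon> :: real and x assume \<epsilon>: "\<epsilon> \<in> {0<..1}" and x: "x \<in> \<Omega>"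
    have s: "smooth_on \<Omega> (u\<^sub>0 \<epsilon>)" "smooth_on \<Omega> (w \<epsilon>)"
      using u\<^sub>0 w \<epsilon> by (auto simp: carrier_moderate_nets[OF \<Omega>] mem_negligible_nets[OF \<Omega>] smooth_net_def)
    have "u \<epsilon> = (\<lambda>x. u\<^sub>0 \<epsilon> x + w \<epsilon> x)" by (auto simp: w_def)
    then have "mi_deriv \<alpha> (u \<epsilon>) x = mi_deriv \<alpha> (u\<^sub>0 \<epsilon>) x + mi_deriv \<alpha> (w \<epsilon>) x" for \<alpha>
      unfolding mi_deriv_eq_foldr using foldr_partial_add[OF \<Omega> s x] by simp
    then show "(\<Sum>\<alpha> | mi_size \<alpha> \<le> m. ?F \<alpha> \<epsilon> x) = diff_op_net m a u \<epsilon> x - diff_op_net m a\<^sub>0 u\<^sub>0 \<epsilon> x"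
      unfolding diff_op_net_def sum_subtractf[symmetric] by (intro sum.cong) (auto simp: algebra_simps)
  qed
qed

text \<open>All classes in the union that defines \<open>diff_op\<close> coincide, so any single
  choice of representatives computes it.\<close>

lemma diff_op_net_class:
  assumes \<Omega>: "open \<Omega>" and A: "\<And>\<alpha>. mi_size \<alpha> \<le> m \<Longrightarrow> A \<alpha> \<in> carrier gen_numbers"
    and a: "a \<in> coeff_reps m A" and u: "u \<in> carrier (moderate_nets \<Omega>)"
  shows "diff_op \<Omega> m A (net_class \<Omega> u) = net_class \<Omega> (diff_op_net m a u)"
proof -
  have "net_class \<Omega> (diff_op_net m b v) = net_class \<Omega> (diff_op_net m a u)"
    if "b \<in> coeff_reps m A" "v \<in> net_class \<Omega> u" for b v
    using that by (intro net_class_eqI[OF \<Omega>] diff_op_net_diff_negligible[OF \<Omega> A _ a u]) (auto simp: mem_net_class_iff)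
  moreover have "net_class \<Omega> u \<noteq> {}" "coeff_reps m A \<noteq> {}" using a mem_net_class_self[OF \<Omega>, of u] by blast+
  ultimately show ?thesis unfolding diff_op_def by (intro SUP_eq_const)
qed

section \<open>The weight function and necessity\<close>

lemma smooth_on_coordinate: "smooth_on \<Omega> (\<lambda>x :: real ^ 'n::finite. complex_of_real (x $ i))"
proof -
  have D: "((\<lambda>x :: real ^ 'n. complex_of_real (x $ i)) has_derivative (\<lambda>h. of_real (h $ i))) (at x)" for x
    by (intro has_derivative_of_real bounded_linear_imp_has_derivative bounded_linear_vec_nth)
  have P: "partial j (\<lambda>x :: real ^ 'n. complex_of_real (x $ i)) = (\<lambda>_. of_real ((axis j 1 :: real ^ 'n) $ i))" for j
    using partial_has_derivative[OF D] by auto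
  have "foldr partial is (\<lambda>x :: real ^ 'n. complex_of_real (x $ i)) differentiable_on \<Omega>" for "is"
  proof (cases "is" rule: rev_cases)
    case Nil
    then show ?thesis using has_derivative_at_withinI[OF D]
      by (auto simp: differentiable_on_def differentiable_def)
  next
    case (snoc js j)
    then show ?thesis by (simp add: P foldr_partial_const)
  qed
  then show ?thesis unfolding smooth_on_def by blast
qed

lemma smooth_on_monomial: "open \<Omega> \<Longrightarrow> smooth_on \<Omega> (\<lambda>\<xi>. of_real (mi_power \<xi> \<beta>))"
proof -
  assume \<Omega>: "open \<Omega>"
  have "smooth_on \<Omega> (\<lambda>x. complex_of_real (x $ i) ^ k)" for i k
  proof -
    have "smooth_on \<Omega> (\<lambda>x. \<Prod>l<k. complex_of_real (x $ i))"
      by (intro smooth_on_prod \<Omega> smooth_on_coordinate)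
    then show ?thesis by simp
  qed
  then have "smooth_on \<Omega> (\<lambda>x. \<Prod>i\<in>UNIV. complex_of_real (x $ i) ^ \<beta> i)" by (intro smooth_on_prod \<Omega>)
  then show ?thesis by (simp add: mi_power_def)
qed

text \<open>For \<open>\<beta> i = 0\<close> the truncated exponent is harmless, as the factor
  \<open>\<beta> i\<close> makes the right side zero.\<close>

lemma partial_monomial:
  fixes \<beta> :: "'n::finite multiindex"
  shows "partial i (\<lambda>\<xi>. c * of_real (mi_power \<xi> \<beta>)) =
    (\<lambda>\<xi>. (c * of_nat (\<beta> i)) * of_real (mi_power \<xi> (\<beta>(i := \<beta> i - 1))))"
proof
  fix \<xi> :: "real ^ 'n"
  define R where "R = (\<Prod>j\<in>UNIV - {i}. (\<xi> $ j) ^ \<beta> j)"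
  have split: "mi_power \<eta> \<gamma> = (\<eta> $ i) ^ \<gamma> i * (\<Prod>j\<in>UNIV - {i}. (\<eta> $ j) ^ \<gamma> j)" for \<eta> :: "real ^ 'n" and \<gamma>
    unfolding mi_power_def by (subst prod.remove[of UNIV i]) auto
  have along: "mi_power (\<xi> + t *\<^sub>R axis i 1) \<beta> = (\<xi> $ i + t) ^ \<beta> i * R" for t
    unfolding split R_def by (auto simp: axis_def intro!: prod.cong)
  have "((\<lambda>t. (\<xi> $ i + t) ^ \<beta> i) has_real_derivative of_nat (\<beta> i) * (\<xi> $ i + 0) ^ (\<beta> i - 1)) (at 0)"
    by (auto intro!: derivative_eq_intros)
  then have "((\<lambda>t. (\<xi> $ i + t) ^ \<beta> i * R) has_real_derivative of_nat (\<beta> i) * (\<xi> $ i) ^ (\<beta> i - 1) * R) (at 0)"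
    using DERIV_cmult_right by fastforce
  then have "((\<lambda>t. complex_of_real ((\<xi> $ i + t) ^ \<beta> i * R)) has_vector_derivative
      of_real (of_nat (\<beta> i) * (\<xi> $ i) ^ (\<beta> i - 1) * R)) (at 0)"
    by (intro has_vector_derivative_of_real) (simp add: has_real_derivative_iff_has_vector_derivative)
  then have "((\<lambda>t. c * complex_of_real ((\<xi> $ i + t) ^ \<beta> i * R)) has_vector_derivative
      c * of_real (of_nat (\<beta> i) * (\<xi> $ i) ^ (\<beta> i - 1) * R)) (at 0)"
    by (rule has_vector_derivative_mult_right)
  then have "partial i (\<lambda>\<xi>. c * of_real (mi_power \<xi> \<beta>)) \<xi> = c * of_real (of_nat (\<beta> i) * (\<xi> $ i) ^ (\<beta> i - 1) * R)"
    unfolding partial_def along by (rule vector_derivative_at)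
  also have "(\<xi> $ i) ^ (\<beta> i - 1) * R = mi_power \<xi> (\<beta>(i := \<beta> i - 1))"
    unfolding split R_def by (auto intro!: prod.cong)
  then have "c * of_real (of_nat (\<beta> i) * (\<xi> $ i) ^ (\<beta> i - 1) * R) =
      (c * of_nat (\<beta> i)) * of_real (mi_power \<xi> (\<beta>(i := \<beta> i - 1)))"
    by (simp add: mult.assoc)
  finally show "partial i (\<lambda>\<xi>. c * of_real (mi_power \<xi> \<beta>)) \<xi> =
    (c * of_nat (\<beta> i)) * of_real (mi_power \<xi> (\<beta>(i := \<beta> i - 1)))" .
qed

text \<open>Product of the factors that successive differentiation of a monomial brings down;
  truncated subtraction makes it 0 once a direction occurs too often. For
  \<open>mi_list \<alpha>\<close> and \<alpha> it is the factorial of the multi-index.\<close>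

fun falling :: "'n::finite list \<Rightarrow> 'n multiindex \<Rightarrow> nat" where
  "falling [] \<beta> = 1"
| "falling (i # is) \<beta> = falling is \<beta> * (\<beta> i - count (mset is) i)"

lemma foldr_partial_monomial:
  "foldr partial is (\<lambda>\<xi>. of_real (mi_power \<xi> \<beta>)) =
    (\<lambda>\<xi>. of_nat (falling is \<beta>) * of_real (mi_power \<xi> (\<lambda>j. \<beta> j - count (mset is) j)))"
proof (induction "is")
  case (Cons i "is")
  have "(\<lambda>j. \<beta> j - count (mset is) j)(i := \<beta> i - count (mset is) i - 1) = (\<lambda>j. \<beta> j - count (mset (i # is)) j)"
    by auto
  then show ?case by (simp only: foldr.simps o_apply Cons partial_monomial falling.simps of_nat_mult)
qed simp

lemma falling_eq_0: "\<beta> j < count (mset is) j \<Longrightarrow> falling is \<beta> = 0"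
proof (induction "is")
  case (Cons i "is")
  then show ?case by (cases "\<beta> j < count (mset is) j") (auto split: if_splits)
qed simp

lemma falling_pos: "(\<And>j. count (mset is) j \<le> \<beta> j) \<Longrightarrow> 0 < falling is \<beta>"
proof (induction "is")
  case (Cons i "is")
  have "count (mset is) j \<le> \<beta> j" for j using Cons.prems[of j] by (auto split: if_splits)
  moreover have "count (mset is) i < \<beta> i" using Cons.prems[of i] by simp
  ultimately show ?case using Cons.IH by simp
qed simp

lemma mi_power_0: "mi_power 0 \<gamma> = (if \<gamma> = (\<lambda>_. 0) then 1 else 0)"
  unfolding mi_power_def by (auto simp: fun_eq_iff power_0_left intro!: prod.neutral)

text \<open>At the origin only a constant survives, which forces \<open>\<alpha> = \<beta>\<close>.
  Hence a derivative of the symbol at 0 reads off a single coefficient.\<close>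

lemma mi_deriv_monomial_at_0:
  fixes \<alpha> \<beta> :: "'n::finite multiindex"
  shows "mi_deriv \<alpha> (\<lambda>\<xi>. of_real (mi_power \<xi> \<beta>)) 0 = (if \<alpha> = \<beta> then of_nat (falling (mi_list \<alpha>) \<alpha>) else 0)"
proof (cases "\<exists>j. \<beta> j < \<alpha> j")
  case True
  then obtain j where "\<beta> j < \<alpha> j" ..
  then show ?thesis
    unfolding mi_deriv_eq_foldr foldr_partial_monomial using falling_eq_0[of \<beta> j "mi_list \<alpha>"]
    by (auto simp: count_mi_list)
next
  case False
  then have "(\<lambda>j. \<beta> j - \<alpha> j) = (\<lambda>_. 0) \<longleftrightarrow> \<alpha> = \<beta>"
    by (auto simp: fun_eq_iff not_less intro: le_antisym)
  then show ?thesis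
    unfolding mi_deriv_eq_foldr foldr_partial_monomial by (auto simp: count_mi_list mi_power_0)
qed

lemma mi_deriv_symbol:
  "mi_deriv \<alpha> (symbol_net m a \<epsilon>) \<xi> =
    (\<Sum>\<beta> | mi_size \<beta> \<le> m. a \<beta> \<epsilon> * mi_deriv \<alpha> (\<lambda>\<xi>. of_real (mi_power \<xi> \<beta>)) \<xi>)"
  unfolding mi_deriv_eq_foldr symbol_net_def
  by (subst foldr_partial_sum[of UNIV])
    (auto intro!: smooth_on_cmult smooth_on_monomial sum.cong foldr_partial_cmult[of UNIV])

text \<open>At the origin the \<alpha>-th derivative of the symbol is \<open>a \<alpha>\<close>
  times a positive integer, and its square is one summand of the weight. This makes 0 the point at
  which necessity yields invertibility.\<close>

lemma weight_ge_coefficient: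
  fixes \<alpha> :: "'n::finite multiindex"
  assumes "mi_size \<alpha> \<le> m"
  shows "(norm (a \<alpha> \<epsilon>))\<^sup>2 \<le> norm (weight_sq_net m a \<epsilon> (0 :: real ^ 'n))"
proof -
  have fin: "finite {\<alpha> :: 'n multiindex. mi_size \<alpha> \<le> m}" by (rule finite_mi_size_le)
  let ?D = "\<lambda>\<alpha>. mi_deriv \<alpha> (symbol_net m a \<epsilon>) (0 :: real ^ 'n)"
  have "?D \<alpha> = (\<Sum>\<beta> | mi_size \<beta> \<le> m. if \<beta> = \<alpha> then a \<alpha> \<epsilon> * of_nat (falling (mi_list \<alpha>) \<alpha>) else 0)"
    unfolding mi_deriv_symbol mi_deriv_monomial_at_0 by (intro sum.cong) auto
  also have "\<dots> = a \<alpha> \<epsilon> * of_nat (falling (mi_list \<alpha>) \<alpha>)" using assms fin by (subst sum.delta) auto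
  finally have "norm (?D \<alpha>) = norm (a \<alpha> \<epsilon>) * real (falling (mi_list \<alpha>) \<alpha>)" by (simp add: norm_mult)
  moreover have "1 \<le> real (falling (mi_list \<alpha>) \<alpha>)"
    using falling_pos[of "mi_list \<alpha>" \<alpha>] by (simp add: count_mi_list Suc_le_eq)
  ultimately have "norm (a \<alpha> \<epsilon>) \<le> norm (?D \<alpha>)" by (simp add: mult_le_cancel_left1)
  then have "(norm (a \<alpha> \<epsilon>))\<^sup>2 \<le> (norm (?D \<alpha>))\<^sup>2" by (intro power_mono) auto
  also have "\<dots> \<le> (\<Sum>\<alpha> | mi_size \<alpha> \<le> m. (norm (?D \<alpha>))\<^sup>2)"
    using assms fin by (intro member_le_sum) auto
  also have "\<dots> = norm (weight_sq_net m a \<epsilon> (0 :: real ^ 'n))"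
    unfolding weight_sq_net_def norm_of_real by (rule abs_of_nonneg[symmetric]) (intro sum_nonneg, simp)
  finally show ?thesis .
qed

text \<open>The index is that of a coefficient of largest modulus and may change with \<epsilon>,
  whereas \<open>B\<close> depends only on the order and the point.\<close>

lemma weight_le_coefficients:
  fixes \<xi> :: "real ^ 'n::finite"
  shows "\<exists>B>0. \<forall>(a :: 'n multiindex \<Rightarrow> real \<Rightarrow> complex) \<epsilon>. \<exists>\<alpha>. mi_size \<alpha> \<le> m \<and>
    norm (weight_sq_net m a \<epsilon> \<xi>) \<le> B * (norm (a \<alpha> \<epsilon>))\<^sup>2"
proof -
  define M where "M = {\<alpha> :: 'n multiindex. mi_size \<alpha> \<le> m}"
  have fin: "finite M" unfolding M_def by (rule finite_mi_size_le)
  have ne: "(\<lambda>_. 0) \<in> M" by (simp add: M_def mi_size_def)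
  define \<kappa> where "\<kappa> \<alpha> = (\<Sum>\<beta>\<in>M. norm (mi_deriv \<alpha> (\<lambda>\<xi>. complex_of_real (mi_power \<xi> \<beta>)) \<xi>))" for \<alpha>
  define B where "B = (\<Sum>\<alpha>\<in>M. (\<kappa> \<alpha>)\<^sup>2) + 1"
  have \<kappa>0: "0 \<le> \<kappa> \<alpha>" for \<alpha> unfolding \<kappa>_def by (intro sum_nonneg) auto
  have "0 \<le> (\<Sum>\<alpha>\<in>M. (\<kappa> \<alpha>)\<^sup>2)" by (intro sum_nonneg) auto
  then have B0: "0 < B" by (simp add: B_def)
  have "\<exists>\<alpha>. mi_size \<alpha> \<le> m \<and> norm (weight_sq_net m a \<epsilon> \<xi>) \<le> B * (norm (a \<alpha> \<epsilon>))\<^sup>2"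
    for a :: "'n multiindex \<Rightarrow> real \<Rightarrow> complex" and \<epsilon>
  proof -
    have "Max ((\<lambda>\<alpha>. norm (a \<alpha> \<epsilon>)) ` M) \<in> (\<lambda>\<alpha>. norm (a \<alpha> \<epsilon>)) ` M" using fin ne by (intro Max_in) auto
    then obtain \<alpha>\<^sub>0 where \<alpha>\<^sub>0: "\<alpha>\<^sub>0 \<in> M" "Max ((\<lambda>\<alpha>. norm (a \<alpha> \<epsilon>)) ` M) = norm (a \<alpha>\<^sub>0 \<epsilon>)" by blast
    have le: "norm (a \<alpha> \<epsilon>) \<le> norm (a \<alpha>\<^sub>0 \<epsilon>)" if "\<alpha> \<in> M" for \<alpha>
      unfolding \<alpha>\<^sub>0(2)[symmetric] using fin that by (intro Max_ge) auto
    have D: "norm (mi_deriv \<alpha> (symbol_net m a \<epsilon>) \<xi>) \<le> norm (a \<alpha>\<^sub>0 \<epsilon>) * \<kappa> \<alpha>" for \<alpha>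
    proof -
      have "norm (mi_deriv \<alpha> (symbol_net m a \<epsilon>) \<xi>) \<le>
          (\<Sum>\<beta>\<in>M. norm (a \<beta> \<epsilon> * mi_deriv \<alpha> (\<lambda>\<xi>. of_real (mi_power \<xi> \<beta>)) \<xi>))"
        unfolding mi_deriv_symbol M_def by (rule norm_sum)
      also have "\<dots> \<le> (\<Sum>\<beta>\<in>M. norm (a \<alpha>\<^sub>0 \<epsilon>) * norm (mi_deriv \<alpha> (\<lambda>\<xi>. complex_of_real (mi_power \<xi> \<beta>)) \<xi>))"
        unfolding norm_mult by (intro sum_mono mult_right_mono le) auto
      finally show ?thesis by (simp add: \<kappa>_def sum_distrib_left)
    qed
    have "norm (weight_sq_net m a \<epsilon> \<xi>) = (\<Sum>\<alpha>\<in>M. (norm (mi_deriv \<alpha> (symbol_net m a \<epsilon>) \<xi>))\<^sup>2)"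
      unfolding weight_sq_net_def norm_of_real M_def by (rule abs_of_nonneg) (intro sum_nonneg, simp)
    also have "\<dots> \<le> (\<Sum>\<alpha>\<in>M. (norm (a \<alpha>\<^sub>0 \<epsilon>) * \<kappa> \<alpha>)\<^sup>2)" by (intro sum_mono power_mono D) auto
    also have "\<dots> = (\<Sum>\<alpha>\<in>M. (\<kappa> \<alpha>)\<^sup>2) * (norm (a \<alpha>\<^sub>0 \<epsilon>))\<^sup>2"
      by (simp add: power_mult_distrib sum_distrib_left mult.commute)
    also have "\<dots> \<le> B * (norm (a \<alpha>\<^sub>0 \<epsilon>))\<^sup>2" by (intro mult_right_mono) (auto simp: B_def)
    finally show ?thesis using \<alpha>\<^sub>0(1) by (auto simp: M_def)
  qed
  with B0 show ?thesis by blast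
qed

lemma symbol_derivative_moderate:
  assumes A: "\<And>\<alpha>. mi_size \<alpha> \<le> m \<Longrightarrow> A \<alpha> \<in> carrier gen_numbers" and a: "a \<in> coeff_reps m A"
  shows "(\<lambda>\<epsilon>. mi_deriv \<alpha> (symbol_net m a \<epsilon>) \<xi>) \<in> carrier moderate_numbers"
  unfolding mi_deriv_symbol
  by (intro moderate_numbers_sum moderate_numbers_mult moderate_numbers_const coeff_reps_moderate[OF A a]) auto

lemma moderate_numbers_cnj: "c \<in> carrier moderate_numbers \<Longrightarrow> (\<lambda>\<epsilon>. cnj (c \<epsilon>)) \<in> carrier moderate_numbers"
  unfolding carrier_moderate_numbers number_grows_cnj .

lemma negligible_numbers_cnj: "c \<in> negligible_numbers \<Longrightarrow> (\<lambda>\<epsilon>. cnj (c \<epsilon>)) \<in> negligible_numbers"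
  unfolding mem_negligible_numbers number_grows_cnj .

text \<open>In the form \<open>z * cnj z\<close> the squares become accessible to the closure of
  moderate and negligible numbers under sums, products and conjugation.\<close>

lemma weight_eq_sum_cnj:
  "weight_sq_net m a \<epsilon> \<xi> = (\<Sum>\<alpha> | mi_size \<alpha> \<le> m.
    mi_deriv \<alpha> (symbol_net m a \<epsilon>) \<xi> * cnj (mi_deriv \<alpha> (symbol_net m a \<epsilon>) \<xi>))"
  unfolding weight_sq_net_def of_real_sum complex_norm_square ..

lemma weight_moderate:
  assumes A: "\<And>\<alpha>. mi_size \<alpha> \<le> m \<Longrightarrow> A \<alpha> \<in> carrier gen_numbers" and a: "a \<in> coeff_reps m A"
  shows "(\<lambda>\<epsilon>. weight_sq_net m a \<epsilon> \<xi>) \<in> carrier moderate_numbers"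
  unfolding weight_eq_sum_cnj
  by (intro moderate_numbers_sum moderate_numbers_mult moderate_numbers_cnj symbol_derivative_moderate[OF A a])

lemma weight_diff_negligible:
  assumes A: "\<And>\<alpha>. mi_size \<alpha> \<le> m \<Longrightarrow> A \<alpha> \<in> carrier gen_numbers"
    and a: "a \<in> coeff_reps m A" and b: "b \<in> coeff_reps m A"
  shows "(\<lambda>\<epsilon>. weight_sq_net m a \<epsilon> \<xi> - weight_sq_net m b \<epsilon> \<xi>) \<in> negligible_numbers"
proof -
  let ?D = "\<lambda>a \<alpha> \<epsilon>. mi_deriv \<alpha> (symbol_net m a \<epsilon>) \<xi>"
  have "(\<lambda>\<epsilon>. \<Sum>\<beta> | mi_size \<beta> \<le> m. mi_deriv \<alpha> (\<lambda>\<xi>. of_real (mi_power \<xi> \<beta>)) \<xi> * (a \<beta> \<epsilon> - b \<beta> \<epsilon>)) \<in> negligible_numbers" for \<alpha>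
    by (intro negligible_numbers_sum negligible_numbers_mult moderate_numbers_const coeff_reps_diff[OF A a b]) auto
  then have diff: "(\<lambda>\<epsilon>. ?D a \<alpha> \<epsilon> - ?D b \<alpha> \<epsilon>) \<in> negligible_numbers" for \<alpha>
    by (simp add: mi_deriv_symbol sum_subtractf[symmetric] algebra_simps)
  \<comment> \<open>From \<open>|x|^2 - |y|^2 = cnj x * (x - y) + y * cnj (x - y)\<close>.\<close>
  have "(\<lambda>\<epsilon>. \<Sum>\<alpha> | mi_size \<alpha> \<le> m. cnj (?D a \<alpha> \<epsilon>) * (?D a \<alpha> \<epsilon> - ?D b \<alpha> \<epsilon>) +
      ?D b \<alpha> \<epsilon> * cnj (?D a \<alpha> \<epsilon> - ?D b \<alpha> \<epsilon>)) \<in> negligible_numbers"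
    by (intro negligible_numbers_sum negligible_numbers_add negligible_numbers_mult moderate_numbers_cnj
        symbol_derivative_moderate[OF A a] symbol_derivative_moderate[OF A b] negligible_numbers_cnj diff)
  then show ?thesis
    by (simp add: weight_eq_sum_cnj sum_subtractf[symmetric] algebra_simps)
qed

lemma negligible_nets_point:
  assumes "open \<Omega>" "u \<in> negligible_nets \<Omega>" "x \<in> \<Omega>"
  shows "(\<lambda>\<epsilon>. u \<epsilon> x) \<in> negligible_numbers"
  unfolding mem_negligible_numbers
proof
  fix r
  have "negligible_on {x} u" using assms by (auto simp: mem_negligible_nets)
  then have "grows r {x} (\<lambda>\<epsilon>. foldr partial [] (u \<epsilon>))" unfolding negligible_on_def by blast
  then show "number_grows r (\<lambda>\<epsilon>. u \<epsilon> x)" by (intro grows_imp_number_grows[of r "{x}"]) auto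
qed

lemma point_value_weight:
  fixes A :: "'n::finite multiindex \<Rightarrow> (real \<Rightarrow> complex) set"
  assumes A: "\<And>\<alpha>. mi_size \<alpha> \<le> m \<Longrightarrow> A \<alpha> \<in> carrier gen_numbers" and a: "a \<in> coeff_reps m A"
  shows "point_value (weight_sq m A) \<xi> = number_class (\<lambda>\<epsilon>. weight_sq_net m a \<epsilon> \<xi>)"
  unfolding point_value_def
proof (rule SUP_eq_const)
  show "weight_sq m A \<noteq> {}"
    unfolding weight_sq_def using a mem_net_class_self[OF open_UNIV, of "weight_sq_net m a"] by blast
  fix v assume "v \<in> weight_sq m A"
  then obtain b where b: "b \<in> coeff_reps m A" "v \<in> net_class UNIV (weight_sq_net m b)"
    unfolding weight_sq_def by blast
  have "(\<lambda>\<epsilon>. v \<epsilon> \<xi> - weight_sq_net m b \<epsilon> \<xi>) \<in> negligible_numbers"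
    using negligible_nets_point[OF open_UNIV, of "\<lambda>\<epsilon> x. v \<epsilon> x - weight_sq_net m b \<epsilon> x" \<xi>] b(2)
    by (simp add: mem_net_class_iff)
  from negligible_numbers_add[OF this weight_diff_negligible[OF A b(1) a, of \<xi>]]
  show "number_class (\<lambda>\<epsilon>. v \<epsilon> \<xi>) = number_class (\<lambda>\<epsilon>. weight_sq_net m a \<epsilon> \<xi>)"
    by (intro number_class_eqI) simp
qed

lemma invertible_weight_iff:
  fixes A :: "'n::finite multiindex \<Rightarrow> (real \<Rightarrow> complex) set"
  assumes A: "\<And>\<alpha>. mi_size \<alpha> \<le> m \<Longrightarrow> A \<alpha> \<in> carrier gen_numbers" and a: "a \<in> coeff_reps m A"
  shows "point_value (weight_sq m A) \<xi> \<in> Units gen_numbers \<longleftrightarrow>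
    (\<exists>N. \<forall>\<^sub>F \<epsilon> in at_right 0. \<epsilon> powr N \<le> norm (weight_sq_net m a \<epsilon> \<xi>))"
proof -
  have "point_value (weight_sq m A) \<xi> = number_class (\<lambda>\<epsilon>. weight_sq_net m a \<epsilon> \<xi>)"
    by (rule point_value_weight) (use A a in auto)
  moreover have "(\<lambda>\<epsilon>. weight_sq_net m a \<epsilon> \<xi>) \<in> carrier moderate_numbers"
    by (rule weight_moderate) (use A a in auto)
  ultimately show ?thesis using number_class_unit_iff by simp
qed

text \<open>The class restricts to zero on the open set \<open>\<Omega> - K\<close>, so its support
  is what remains of \<open>K\<close> after removing an open set.\<close>

lemma constant_net_in_colombeau_c:
  fixes \<Omega> K :: "(real ^ 'n::finite) set"
  assumes \<Omega>: "open \<Omega>" and f: "smooth_on UNIV f" and K: "compact K" "K \<subseteq> \<Omega>" "\<And>x. x \<notin> K \<Longrightarrow> f x = 0"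
  shows "net_class \<Omega> (\<lambda>_. f) \<in> colombeau_c \<Omega>"
proof -
  have mod: "(\<lambda>_. f) \<in> carrier (moderate_nets \<Omega>)"
    unfolding carrier_moderate_nets[OF \<Omega>]
    using smooth_on_subset[OF f] by (auto simp: smooth_net_def intro!: moderate_on_smooth_function[OF open_UNIV f])
  let ?U = "\<Union>{V. open V \<and> V \<subseteq> \<Omega> \<and> restriction V (net_class \<Omega> (\<lambda>_. f)) = \<zero>\<^bsub>colombeau V\<^esub>}"
  have V: "open (\<Omega> - K)" using \<Omega> K(1) by (intro open_Diff compact_imp_closed)
  have "restriction (\<Omega> - K) (net_class \<Omega> (\<lambda>_. f)) = net_class (\<Omega> - K) (\<lambda>_ _. 0)"
    unfolding restriction_def
  proof (rule SUP_eq_const)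
    show "net_class \<Omega> (\<lambda>_. f) \<noteq> {}" using mem_net_class_self[OF \<Omega>] by blast
    fix v assume "v \<in> net_class \<Omega> (\<lambda>_. f)"
    then have "(\<lambda>\<epsilon> x. v \<epsilon> x - f x) \<in> negligible_nets (\<Omega> - K)"
      unfolding mem_net_class_iff by (rule negligible_nets_subset[OF \<Omega> V, rotated]) auto
    then have "(\<lambda>\<epsilon> x. v \<epsilon> x - 0) \<in> negligible_nets (\<Omega> - K)"
      by (rule negligible_nets_cong[OF V, rotated]) (use K(3) in auto)
    then show "net_class (\<Omega> - K) v = net_class (\<Omega> - K) (\<lambda>_ _. 0)" by (rule net_class_eqI[OF V])
  qed
  also have "\<dots> = \<zero>\<^bsub>colombeau (\<Omega> - K)\<^esub>"
    unfolding zero_colombeau by (auto simp: mem_net_class_iff)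
  finally have "\<Omega> - K \<subseteq> ?U" using V by blast
  then have "gen_support \<Omega> (net_class \<Omega> (\<lambda>_. f)) = K \<inter> (- ?U)"
    unfolding gen_support_def using K(2) by blast
  moreover have "closed (- ?U)" by (intro closed_Compl open_Union) auto
  ultimately have "compact (gen_support \<Omega> (net_class \<Omega> (\<lambda>_. f)))"
    using K(1) by (simp add: compact_Int_closed)
  with mod show ?thesis by (simp add: colombeau_c_def carrier_colombeau)
qed

lemma solvable_imp_invertible:
  fixes \<Omega> :: "(real ^ 'n::finite) set" and A :: "'n multiindex \<Rightarrow> (real \<Rightarrow> complex) set"
  assumes \<Omega>: "open \<Omega>" "\<Omega> \<noteq> {}" and A: "\<And>\<alpha>. mi_size \<alpha> \<le> m \<Longrightarrow> A \<alpha> \<in> carrier gen_numbers"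
    and solv: "\<And>F. F \<in> colombeau_c \<Omega> \<Longrightarrow> \<exists>U\<in>carrier (colombeau \<Omega>). diff_op \<Omega> m A U = F"
  shows "point_value (weight_sq m A) 0 \<in> Units gen_numbers"
proof -
  obtain a where a: "a \<in> coeff_reps m A" by (rule coeff_reps_nonempty[where A = A and m = m, OF A])
  obtain x\<^sub>0 where x\<^sub>0: "x\<^sub>0 \<in> \<Omega>" using \<Omega>(2) by blast
  obtain \<phi> W K where \<phi>: "smooth_on UNIV \<phi>" "{x\<^sub>0} \<subseteq> W" "\<And>x. x \<in> W \<Longrightarrow> \<phi> x = 1"
    "compact K" "K \<subseteq> \<Omega>" "\<And>x. x \<notin> K \<Longrightarrow> \<phi> x = 0"
    using exists_cutoff[OF compact_sing[of x\<^sub>0] \<Omega>(1)] x\<^sub>0 by (metis empty_subsetI insert_subset)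
  obtain U where U: "U \<in> carrier (colombeau \<Omega>)" "diff_op \<Omega> m A U = net_class \<Omega> (\<lambda>_. \<phi>)"
    using solv[OF constant_net_in_colombeau_c[OF \<Omega>(1) \<phi>(1,4,5,6)]] by blast
  then obtain u where u: "U = net_class \<Omega> u" "u \<in> carrier (moderate_nets \<Omega>)" by (auto simp: carrier_colombeau)
  have "net_class \<Omega> (diff_op_net m a u) = net_class \<Omega> (\<lambda>_. \<phi>)"
    unfolding U(2)[symmetric] u(1) by (rule diff_op_net_class[symmetric]) (use A a u(2) \<Omega>(1) in auto)
  then have "diff_op_net m a u \<in> net_class \<Omega> (\<lambda>_. \<phi>)" using mem_net_class_self[OF \<Omega>(1)] by blast
  then have "(\<lambda>\<epsilon> x. diff_op_net m a u \<epsilon> x - \<phi> x) \<in> negligible_nets \<Omega>" by (simp add: mem_net_class_iff)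
  from negligible_nets_point[OF \<Omega>(1) this x\<^sub>0] \<phi>(2,3)
  have "number_grows 1 (\<lambda>\<epsilon>. diff_op_net m a u \<epsilon> x\<^sub>0 - 1)" by (simp add: mem_negligible_numbers)
  from growsD[OF this] obtain B where B: "0 < B"
    "\<forall>\<^sub>F \<epsilon> in at_right 0. \<epsilon> \<in> {0<..1} \<and> (\<forall>x\<in>{()}. norm (diff_op_net m a u \<epsilon> x\<^sub>0 - 1) \<le> B * \<epsilon> powr 1)"
    by (elim exE conjE)
  define s where "s \<epsilon> = (\<Sum>\<alpha> | mi_size \<alpha> \<le> m. norm (mi_deriv \<alpha> (u \<epsilon>) x\<^sub>0))" for \<epsilon>
  have "\<exists>r. grows r {x\<^sub>0} (\<lambda>\<epsilon> x. \<Sum>\<alpha> | mi_size \<alpha> \<le> m. complex_of_real (norm (mi_deriv \<alpha> (u \<epsilon>) x)))"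
  proof (rule grows_sum_ex)
    fix \<alpha> :: "'n multiindex"
    have "moderate_on {x\<^sub>0} u" using u(2) x\<^sub>0 by (auto simp: carrier_moderate_nets[OF \<Omega>(1)])
    then obtain r where "grows r {x\<^sub>0} (\<lambda>\<epsilon>. mi_deriv \<alpha> (u \<epsilon>))" unfolding moderate_on_def mi_deriv_eq_foldr by blast
    then have "grows r {x\<^sub>0} (\<lambda>\<epsilon> x. complex_of_real (norm (mi_deriv \<alpha> (u \<epsilon>) x)))" by (simp add: grows_def)
    then show "\<exists>r. grows r {x\<^sub>0} (\<lambda>\<epsilon> x. complex_of_real (norm (mi_deriv \<alpha> (u \<epsilon>) x)))" ..
  qed
  then obtain r where "grows r {x\<^sub>0} (\<lambda>\<epsilon> x. \<Sum>\<alpha> | mi_size \<alpha> \<le> m. complex_of_real (norm (mi_deriv \<alpha> (u \<epsilon>) x)))" ..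
  from growsD[OF this] obtain C where C: "0 < C"
    "\<forall>\<^sub>F \<epsilon> in at_right 0. \<epsilon> \<in> {0<..1} \<and> (\<forall>x\<in>{x\<^sub>0}.
       norm (\<Sum>\<alpha> | mi_size \<alpha> \<le> m. complex_of_real (norm (mi_deriv \<alpha> (u \<epsilon>) x))) \<le> C * \<epsilon> powr r)"
    by (elim exE conjE)
  have small: "\<forall>\<^sub>F \<epsilon> in at_right 0. \<epsilon> \<in> {0<..1} \<and> \<epsilon> < 1 / (2 * B)"
    "\<forall>\<^sub>F \<epsilon> in at_right 0. \<epsilon> \<in> {0<..1} \<and> \<epsilon> < 1 / (2 * C)"
    by (intro eventually_small divide_pos_pos; use B(1) C(1) in simp)+
  \<comment> \<open>The exponent \<open>1 - r\<close> belongs to the square root of the weight: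
    \<open>- r\<close> comes from the derivatives of \<open>u\<close>, and one more power of
    \<epsilon> absorbs \<open>2 * C\<close>. It is doubled for the weight itself.\<close>
  have "\<forall>\<^sub>F \<epsilon> in at_right 0. \<epsilon> powr (2 * (1 - r)) \<le> norm (weight_sq_net m a \<epsilon> (0 :: real ^ 'n))"
    using B(2) C(2) small
  proof eventually_elim
    fix \<epsilon> :: real
    assume 1: "\<epsilon> \<in> {0<..1} \<and> (\<forall>x\<in>{()}. norm (diff_op_net m a u \<epsilon> x\<^sub>0 - 1) \<le> B * \<epsilon> powr 1)"
      and 2: "\<epsilon> \<in> {0<..1} \<and> (\<forall>x\<in>{x\<^sub>0}.
       norm (\<Sum>\<alpha> | mi_size \<alpha> \<le> m. complex_of_real (norm (mi_deriv \<alpha> (u \<epsilon>) x))) \<le> C * \<epsilon> powr r)"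
      and 3: "\<epsilon> \<in> {0<..1} \<and> \<epsilon> < 1 / (2 * B)" and 4: "\<epsilon> \<in> {0<..1} \<and> \<epsilon> < 1 / (2 * C)"
    have small: "B * \<epsilon> \<le> 1 / 2" "(2 * C) * \<epsilon> \<le> 1" using 3 4 B(1) C(1) by (auto simp: field_simps)
    \<comment> \<open>A common bound for all coefficients, which can be taken out of the sum for
      \<open>P(D)u\<close> at the chosen point.\<close>
    define w where "w = sqrt (norm (weight_sq_net m a \<epsilon> (0 :: real ^ 'n)))"
    have aw: "norm (a \<alpha> \<epsilon>) \<le> w" if "mi_size \<alpha> \<le> m" for \<alpha>
      unfolding w_def by (rule real_le_rsqrt[OF weight_ge_coefficient[OF that]])
    have "norm (\<Sum>\<alpha> | mi_size \<alpha> \<le> m. complex_of_real (norm (mi_deriv \<alpha> (u \<epsilon>) x\<^sub>0))) = s \<epsilon>"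
      unfolding s_def of_real_sum[symmetric] norm_of_real by (rule abs_of_nonneg) (intro sum_nonneg, simp)
    then have s: "s \<epsilon> \<le> C * \<epsilon> powr r" using 2 by simp
    have "norm (diff_op_net m a u \<epsilon> x\<^sub>0 - 1) \<le> 1 / 2" using 1 small(1) by auto
    then have "1 / 2 \<le> norm (diff_op_net m a u \<epsilon> x\<^sub>0)"
      using norm_triangle_ineq2[of 1 "1 - diff_op_net m a u \<epsilon> x\<^sub>0"] by (simp add: norm_minus_commute)
    also have "\<dots> \<le> (\<Sum>\<alpha> | mi_size \<alpha> \<le> m. norm (a \<alpha> \<epsilon> * ((- \<i>) ^ mi_size \<alpha> * mi_deriv \<alpha> (u \<epsilon>) x\<^sub>0)))"
      unfolding diff_op_net_def by (rule norm_sum)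
    also have "\<dots> = (\<Sum>\<alpha> | mi_size \<alpha> \<le> m. norm (a \<alpha> \<epsilon>) * norm (mi_deriv \<alpha> (u \<epsilon>) x\<^sub>0))"
      by (simp add: norm_mult norm_power)
    also have "\<dots> \<le> (\<Sum>\<alpha> | mi_size \<alpha> \<le> m. w * norm (mi_deriv \<alpha> (u \<epsilon>) x\<^sub>0))"
      by (intro sum_mono mult_right_mono aw) auto
    also have "\<dots> = w * s \<epsilon>" by (simp add: s_def sum_distrib_left)
    also have "\<dots> \<le> w * (C * \<epsilon> powr r)" by (intro mult_left_mono s) (simp add: w_def)
    finally have "1 \<le> (2 * C) * (\<epsilon> powr r * w)" by (simp add: mult_ac)
    with small(2) have "(2 * C) * \<epsilon> \<le> (2 * C) * (\<epsilon> powr r * w)" by (rule order_trans)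
    then have "\<epsilon> \<le> \<epsilon> powr r * w" using C(1) by (simp add: mult_le_cancel_left_pos)
    moreover have "0 < \<epsilon> powr r" using 1 by simp
    ultimately have "\<epsilon> / \<epsilon> powr r \<le> w" by (simp add: divide_le_eq mult.commute)
    then have "\<epsilon> powr (1 - r) \<le> w" using 1 by (simp add: powr_diff)
    then have "(\<epsilon> powr (1 - r))\<^sup>2 \<le> w\<^sup>2" by (intro power_mono) auto
    also have "(\<epsilon> powr (1 - r))\<^sup>2 = \<epsilon> powr (2 * (1 - r))"
      unfolding power2_eq_square powr_add[symmetric] by simp
    finally show "\<epsilon> powr (2 * (1 - r)) \<le> norm (weight_sq_net m a \<epsilon> (0 :: real ^ 'n))" by (simp add: w_def)
  qed
  then have "\<exists>N. \<forall>\<^sub>F \<epsilon> in at_right 0. \<epsilon> powr N \<le> norm (weight_sq_net m a \<epsilon> (0 :: real ^ 'n))" ..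
  then show ?thesis by (rule invertible_weight_iff[THEN iffD2, rotated 2]) (use A a in auto)
qed

section \<open>Sufficiency\<close>

lemma smooth_on_Un:
  assumes "open A" "open B" "smooth_on A f" "smooth_on B f"
  shows "smooth_on (A \<union> B) f"
  using assms unfolding smooth_on_def
  by (simp add: differentiable_on_eq_differentiable_at open_Un) blast

text \<open>Every point of \<open>K\<close> has a ball on which the net is negligible; finitely many
  of them cover \<open>K\<close>, and growth bounds pass to finite unions. This is the separation
  property of the sheaf.\<close>

lemma negligible_off_support:
  fixes f :: "'n::finite net"
  assumes \<Omega>: "open \<Omega>" and K: "compact K" "K \<subseteq> \<Omega> - gen_support \<Omega> (net_class \<Omega> f)"
  shows "negligible_on K f"
  unfolding negligible_on_def
proof (intro allI)
  fix "is" :: "'n list" and r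
  have "\<exists>e>0. grows r (ball x e) (\<lambda>\<epsilon>. foldr partial is (f \<epsilon>))" if "x \<in> K" for x
  proof -
    define \<V> where "\<V> = {V. open V \<and> V \<subseteq> \<Omega> \<and> restriction V (net_class \<Omega> f) = \<zero>\<^bsub>colombeau V\<^esub>}"
    have "K \<subseteq> \<Omega> - (\<Omega> - \<Union>\<V>)" using K(2) by (simp only: gen_support_def \<V>_def)
    with that obtain V where "V \<in> \<V>" and x: "x \<in> V" by blast
    then have V: "open V" "V \<subseteq> \<Omega>" and zero: "restriction V (net_class \<Omega> f) = negligible_nets V"
      by (simp_all only: \<V>_def mem_Collect_eq zero_colombeau)
    have f: "f \<in> negligible_nets V"
      unfolding zero[symmetric] restriction_def
      by (rule UN_I[OF mem_net_class_self[OF \<Omega>] mem_net_class_self[OF V(1)]])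
    obtain e where e: "0 < e" "cball x e \<subseteq> V" using V(1) x by (meson open_contains_cball)
    have "negligible_on (cball x e) f" using f e(2) unfolding mem_negligible_nets[OF V(1)] by simp
    then have "grows r (cball x e) (\<lambda>\<epsilon>. foldr partial is (f \<epsilon>))" unfolding negligible_on_def by blast
    then have "grows r (ball x e) (\<lambda>\<epsilon>. foldr partial is (f \<epsilon>))" by (rule grows_subset) (rule ball_subset_cball)
    with e(1) show ?thesis by blast
  qed
  then have "\<forall>x. \<exists>e. x \<in> K \<longrightarrow> 0 < e \<and> grows r (ball x e) (\<lambda>\<epsilon>. foldr partial is (f \<epsilon>))" by blast
  from choice[OF this] obtain e where e: "\<And>x. x \<in> K \<Longrightarrow> 0 < e x"
    "\<And>x. x \<in> K \<Longrightarrow> grows r (ball x (e x)) (\<lambda>\<epsilon>. foldr partial is (f \<epsilon>))" by blast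
  have cover: "K \<subseteq> (\<Union>x\<in>K. ball x (e x))" using e(1) by auto
  obtain T where T: "T \<subseteq> K" "finite T" "K \<subseteq> (\<Union>x\<in>T. ball x (e x))"
    by (rule compactE_image[OF K(1) _ cover]) auto
  have "grows r (\<Union>x\<in>T. ball x (e x)) (\<lambda>\<epsilon>. foldr partial is (f \<epsilon>))"
    using T(1) by (intro grows_UN T(2) e(2)) auto
  then show "grows r K (\<lambda>\<epsilon>. foldr partial is (f \<epsilon>))" by (rule grows_subset[OF _ T(3)])
qed

text \<open>Multiplication by a cutoff \<kappa> that is 1 near the support changes \<open>f\<close>
  by \<open>(1 - \<kappa>) * f\<close>, which vanishes near the support and is negligible away from
  it. The new net lives in one cube for all \<epsilon>, with bounds on the whole space, as the
  Fourier series requires.\<close>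

lemma compactly_supported_representative:
  fixes \<Omega> :: "(real ^ 'n::finite) set"
  assumes \<Omega>: "open \<Omega>" and F: "F \<in> colombeau_c \<Omega>"
  obtains g :: "'n net" and R where "smooth_net UNIV g" "0 \<le> R" "\<And>\<epsilon> x. x \<notin> cube R \<Longrightarrow> g \<epsilon> x = 0"
    "moderate_on UNIV g" "F = net_class \<Omega> g"
proof -
  obtain f where f: "F = net_class \<Omega> f" "f \<in> carrier (moderate_nets \<Omega>)"
    using F by (auto simp: colombeau_c_def carrier_colombeau)
  then have sf: "smooth_net \<Omega> f" and mf: "\<And>K. compact K \<Longrightarrow> K \<subseteq> \<Omega> \<Longrightarrow> moderate_on K f"
    by (auto simp: carrier_moderate_nets[OF \<Omega>])
  define S where "S = gen_support \<Omega> F"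
  have S: "compact S" "S \<subseteq> \<Omega>" using F by (auto simp: S_def colombeau_c_def gen_support_def)
  obtain \<kappa> W K where \<kappa>: "smooth_on UNIV \<kappa>" "open W" "S \<subseteq> W" "\<And>x. x \<in> W \<Longrightarrow> \<kappa> x = 1"
    "compact K" "K \<subseteq> \<Omega>" "\<And>x. x \<notin> K \<Longrightarrow> \<kappa> x = 0"
    by (rule exists_cutoff[OF S(1) \<Omega> S(2)]) blast
  have oK: "open (- K)" using \<kappa>(5) by (intro open_Compl compact_imp_closed)
  have s\<kappa>: "smooth_net \<Omega> (\<lambda>_. \<kappa>)" using smooth_on_subset[OF \<kappa>(1)] by (simp add: smooth_net_def)
  \<comment> \<open>Explicitly zero outside \<Omega>, because nothing is known about the values of
    \<open>f\<close> there.\<close>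
  define g where "g \<epsilon> x = (if x \<in> \<Omega> then \<kappa> x * f \<epsilon> x else 0)" for \<epsilon> x
  have g0: "g \<epsilon> x = 0" if "x \<notin> K" for \<epsilon> x using that \<kappa>(7) by (simp add: g_def)
  have sg: "smooth_net UNIV g"
    unfolding smooth_net_def
  proof
    fix \<epsilon> :: real assume \<epsilon>: "\<epsilon> \<in> {0<..1}"
    \<comment> \<open>Smoothness is glued from the open sets \<Omega> and \<open>- K\<close>, which
      cover the space since \<open>K \<subseteq> \<Omega>\<close>.\<close>
    have "smooth_on \<Omega> (\<lambda>x. \<kappa> x * f \<epsilon> x)"
      using s\<kappa> sf \<epsilon> by (intro smooth_on_mult \<Omega>) (auto simp: smooth_net_def)
    then have 1: "smooth_on \<Omega> (g \<epsilon>)" by (rule smooth_on_cong[OF \<Omega>, rotated]) (simp add: g_def)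
    have 2: "smooth_on (- K) (g \<epsilon>)"
      by (rule smooth_on_cong[OF oK _ smooth_on_const[of _ 0]]) (simp add: g0)
    have "\<Omega> \<union> - K = UNIV" using \<kappa>(6) by blast
    with smooth_on_Un[OF \<Omega> oK 1 2] show "smooth_on UNIV (g \<epsilon>)" by simp
  qed
  have mg: "moderate_on UNIV g"
    unfolding moderate_on_def
  proof
    fix "is" :: "'n list"
    have "moderate_on K (\<lambda>\<epsilon> x. \<kappa> x * f \<epsilon> x)"
      by (intro moderate_on_mult[OF \<Omega> s\<kappa> sf \<kappa>(6)] mf \<kappa>(5,6) moderate_on_smooth_function[OF open_UNIV \<kappa>(1)]) simp
    then obtain r where "grows r K (\<lambda>\<epsilon>. foldr partial is (\<lambda>x. \<kappa> x * f \<epsilon> x))" unfolding moderate_on_def by blast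
    then have 1: "grows r K (\<lambda>\<epsilon>. foldr partial is (g \<epsilon>))"
      by (rule grows_cong[rotated], intro foldr_partial_cong[OF \<Omega>]) (use \<kappa>(6) in \<open>auto simp: g_def\<close>)
    have 2: "grows r (- K) (\<lambda>\<epsilon>. foldr partial is (g \<epsilon>))"
    proof (rule grows_cong[OF _ grows_zero])
      fix \<epsilon> :: real and x assume "x \<in> - K"
      then show "0 = foldr partial is (g \<epsilon>) x"
        using foldr_partial_outside[OF compact_imp_closed[OF \<kappa>(5)] g0] by simp
    qed
    show "\<exists>r. grows r UNIV (\<lambda>\<epsilon>. foldr partial is (g \<epsilon>))" using grows_Un[OF 1 2] by auto
  qed
  have "bounded K" using \<kappa>(5) by (rule compact_imp_bounded)
  then obtain R where R: "0 < R" "\<And>x. x \<in> K \<Longrightarrow> norm x \<le> R" unfolding bounded_pos by blast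
  have gR: "g \<epsilon> x = 0" if "x \<notin> cube R" for \<epsilon> x
  proof (rule g0)
    show "x \<notin> K"
    proof
      assume "x \<in> K"
      then have "\<bar>x $ i\<bar> \<le> R" for i using R(2) component_le_norm_cart[of x i] by (meson order_trans)
      then have "- R \<le> x $ i \<and> x $ i \<le> R" for i by (simp add: abs_le_iff minus_le_iff)
      then have "x \<in> cube R" by (simp add: mem_cube)
      with that show False ..
    qed
  qed
  define d where "d \<epsilon> x = (1 + (- 1) * \<kappa> x) * f \<epsilon> x" for \<epsilon> x
  have s1: "smooth_on UNIV (\<lambda>x. 1 + (- 1) * \<kappa> x)"
    by (intro smooth_on_add smooth_on_cmult smooth_on_const \<kappa>(1) open_UNIV)
  then have s1': "smooth_net \<Omega> (\<lambda>_ x. 1 + (- 1) * \<kappa> x)"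
    using smooth_on_subset by (auto simp: smooth_net_def)
  have "d \<in> negligible_nets \<Omega>"
    unfolding mem_negligible_nets[OF \<Omega>]
  proof (intro conjI allI impI)
    show "smooth_net \<Omega> d" unfolding d_def by (rule smooth_net_mult[OF \<Omega> s1' sf])
    fix L assume L: "compact L" "L \<subseteq> \<Omega>"
    \<comment> \<open>\<open>L\<close> is split into the part in \<open>W\<close>, where
      \<open>d\<close> vanishes with all derivatives because \<open>W\<close> is open, and the
      compact rest, which misses the support of the class.\<close>
    have LW: "compact (L - W)" using L(1) \<kappa>(2) by (rule compact_diff)
    have "L - W \<subseteq> \<Omega> - gen_support \<Omega> (net_class \<Omega> f)" using L(2) \<kappa>(3) by (auto simp: S_def f(1))
    then have n: "negligible_on (L - W) f" by (rule negligible_off_support[OF \<Omega> LW])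
    have 1: "negligible_on (L - W) d"
      unfolding d_def using L(2)
      by (intro negligible_on_mult[OF \<Omega> s1' sf _ _ n] moderate_on_smooth_function[OF open_UNIV s1] LW) auto
    show "negligible_on L d"
      unfolding negligible_on_def
    proof (intro allI)
      fix "is" :: "'n list" and r
      have "grows r (L - W) (\<lambda>\<epsilon>. foldr partial is (d \<epsilon>))" using 1 unfolding negligible_on_def by blast
      moreover have "grows r W (\<lambda>\<epsilon>. foldr partial is (d \<epsilon>))"
      proof (rule grows_cong[OF _ grows_zero])
        fix \<epsilon> :: real and x assume "x \<in> W"
        then have "foldr partial is (d \<epsilon>) x = foldr partial is (\<lambda>_. 0) x"
          by (intro foldr_partial_cong[OF \<kappa>(2)]) (auto simp: d_def \<kappa>(4))
        then show "0 = foldr partial is (d \<epsilon>) x" by (simp add: foldr_partial_const split: if_splits)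
      qed
      ultimately have "grows r ((L - W) \<union> W) (\<lambda>\<epsilon>. foldr partial is (d \<epsilon>))" by (rule grows_Un)
      then show "grows r L (\<lambda>\<epsilon>. foldr partial is (d \<epsilon>))" by (rule grows_subset) blast
    qed
  qed
  then have "(\<lambda>\<epsilon> x. f \<epsilon> x - g \<epsilon> x) \<in> negligible_nets \<Omega>"
    by (rule negligible_nets_cong[OF \<Omega>, rotated]) (simp add: d_def g_def algebra_simps)
  then have "net_class \<Omega> f = net_class \<Omega> g" by (rule net_class_eqI[OF \<Omega>])
  with f(1) have Fg: "F = net_class \<Omega> g" by simp
  show ?thesis by (rule that[OF sg less_imp_le[OF R(1)] gR mg Fg])
qed

text \<open>Only finitely many lists have length at most \<open>L\<close>; the sum of the norms of
  these derivatives gives one constant and one exponent for all.\<close>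

lemma uniform_derivative_bound:
  fixes g :: "'n::finite net"
  assumes "moderate_on UNIV g"
  shows "\<exists>B r. 0 < B \<and> (\<forall>\<^sub>F \<epsilon> in at_right 0. \<forall>js x. length js \<le> L \<longrightarrow> norm (foldr partial js (g \<epsilon>) x) \<le> B * \<epsilon> powr r)"
proof -
  have fin: "finite {js :: 'n list. length js \<le> L}"
    using finite_lists_length_le[of "UNIV :: 'n set" L] by simp
  have "\<exists>r. grows r UNIV (\<lambda>\<epsilon> x. \<Sum>js | length js \<le> L. complex_of_real (norm (foldr partial js (g \<epsilon>) x)))"
  proof (rule grows_sum_ex)
    fix js :: "'n list"
    obtain r where "grows r UNIV (\<lambda>\<epsilon>. foldr partial js (g \<epsilon>))" using assms unfolding moderate_on_def by blast
    then have "grows r UNIV (\<lambda>\<epsilon> x. complex_of_real (norm (foldr partial js (g \<epsilon>) x)))" by (simp add: grows_def)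
    then show "\<exists>r. grows r UNIV (\<lambda>\<epsilon> x. complex_of_real (norm (foldr partial js (g \<epsilon>) x)))" ..
  qed
  then obtain r where "grows r UNIV (\<lambda>\<epsilon> x. \<Sum>js | length js \<le> L. complex_of_real (norm (foldr partial js (g \<epsilon>) x)))" ..
  from growsD[OF this] obtain B where B: "0 < B" "\<forall>\<^sub>F \<epsilon> in at_right 0. \<epsilon> \<in> {0<..1} \<and> (\<forall>x\<in>UNIV.
      norm (\<Sum>js | length js \<le> L. complex_of_real (norm (foldr partial js (g \<epsilon>) x))) \<le> B * \<epsilon> powr r)"
    by (elim exE conjE)
  have "\<forall>\<^sub>F \<epsilon> in at_right 0. \<forall>js x. length js \<le> L \<longrightarrow> norm (foldr partial js (g \<epsilon>) x) \<le> B * \<epsilon> powr r"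
    using B(2)
  proof eventually_elim
    case (elim \<epsilon>)
    show ?case
    proof (intro allI impI)
      fix js :: "'n list" and x assume js: "length js \<le> L"
      let ?s = "\<Sum>js | length js \<le> L. norm (foldr partial js (g \<epsilon>) x)"
      have "norm (foldr partial js (g \<epsilon>) x) \<le> ?s"
        using js fin by (intro member_le_sum[where f = "\<lambda>js. norm (foldr partial js (g \<epsilon>) x)"]) auto
      also have "?s = norm (\<Sum>js | length js \<le> L. complex_of_real (norm (foldr partial js (g \<epsilon>) x)))"
        unfolding of_real_sum[symmetric] norm_of_real by (rule abs_of_nonneg[symmetric]) (intro sum_nonneg, simp)
      also have "\<dots> \<le> B * \<epsilon> powr r" using elim by simp
      finally show "norm (foldr partial js (g \<epsilon>) x) \<le> B * \<epsilon> powr r" .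
    qed
  qed
  with B(1) show ?thesis by blast
qed

lemma smooth_net_diff_op_net:
  assumes \<Omega>: "open \<Omega>" and u: "smooth_net \<Omega> u"
  shows "smooth_net \<Omega> (diff_op_net m a u)"
  using u unfolding smooth_net_def diff_op_net_def mi_deriv_eq_foldr
  by (intro ballI smooth_on_sum[OF \<Omega>] smooth_on_cmult[OF \<Omega>] smooth_on_foldr_partial) auto

lemma invertible_imp_solvable:
  fixes \<Omega> :: "(real ^ 'n::finite) set" and A :: "'n multiindex \<Rightarrow> (real \<Rightarrow> complex) set"
  assumes \<Omega>: "open \<Omega>" and A: "\<And>\<alpha>. mi_size \<alpha> \<le> m \<Longrightarrow> A \<alpha> \<in> carrier gen_numbers"
    and inv: "point_value (weight_sq m A) \<xi>\<^sub>0 \<in> Units gen_numbers" and F: "F \<in> colombeau_c \<Omega>"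
  shows "\<exists>U\<in>carrier (colombeau \<Omega>). diff_op \<Omega> m A U = F"
proof -
  obtain a where a: "a \<in> coeff_reps m A" by (rule coeff_reps_nonempty[where A = A and m = m, OF A])
  obtain N where N: "\<forall>\<^sub>F \<epsilon> in at_right 0. \<epsilon> powr N \<le> norm (weight_sq_net m a \<epsilon> \<xi>\<^sub>0)"
    using inv invertible_weight_iff[of m A a \<xi>\<^sub>0] A a by blast
  obtain B where B: "0 < B" "\<And>(a :: 'n multiindex \<Rightarrow> real \<Rightarrow> complex) \<epsilon>. \<exists>\<alpha>. mi_size \<alpha> \<le> m \<and>
    norm (weight_sq_net m a \<epsilon> \<xi>\<^sub>0) \<le> B * (norm (a \<alpha> \<epsilon>))\<^sup>2"
    using weight_le_coefficients[of m \<xi>\<^sub>0] by blast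
  \<comment> \<open>Half of \<open>N\<close> since the weight compares with squares of coefficients,
    and another half power of \<epsilon> to absorb \<open>B\<close>, using
    \<open>B * \<epsilon> < 1\<close>.\<close>
  define N' where "N' = (N + 1) / 2"
  have large: "\<forall>\<^sub>F \<epsilon> in at_right 0. \<exists>\<alpha>. mi_size \<alpha> \<le> m \<and> \<epsilon> powr N' \<le> norm (a \<alpha> \<epsilon>)"
    using N eventually_small[of "1 / B", OF divide_pos_pos[OF zero_less_one B(1)]]
  proof eventually_elim
    case (elim \<epsilon>)
    obtain \<alpha> where \<alpha>: "mi_size \<alpha> \<le> m" "norm (weight_sq_net m a \<epsilon> \<xi>\<^sub>0) \<le> B * (norm (a \<alpha> \<epsilon>))\<^sup>2"
      using B(2) by blast
    have "B * (\<epsilon> powr N')\<^sup>2 = (B * \<epsilon>) * \<epsilon> powr N"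
    proof -
      have "(\<epsilon> powr N')\<^sup>2 = \<epsilon> powr (N + 1)" unfolding power2_eq_square powr_add[symmetric] by (simp add: N'_def)
      also have "\<dots> = \<epsilon> powr N * \<epsilon>" using elim by (simp add: powr_add)
      finally show ?thesis by simp
    qed
    also have "\<dots> \<le> 1 * \<epsilon> powr N"
      using elim B(1) by (intro mult_right_mono) (auto simp: field_simps)
    also have "\<dots> \<le> B * (norm (a \<alpha> \<epsilon>))\<^sup>2" using elim \<alpha>(2) by simp
    finally have "(\<epsilon> powr N')\<^sup>2 \<le> (norm (a \<alpha> \<epsilon>))\<^sup>2" using B(1) by simp
    then have "\<epsilon> powr N' \<le> norm (a \<alpha> \<epsilon>)" by (rule power2_le_imp_le) simp
    with \<alpha>(1) show ?case by blast
  qed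
  obtain g :: "'n net" and R where g: "smooth_net UNIV g" "0 \<le> R" "\<And>\<epsilon> x. x \<notin> cube R \<Longrightarrow> g \<epsilon> x = 0"
    "moderate_on UNIV g" "F = net_class \<Omega> g"
    by (rule compactly_supported_representative[OF \<Omega> F]) blast
  obtain C :: "nat \<Rightarrow> real" and E L :: "nat \<Rightarrow> nat" where solve:
    "\<forall>\<epsilon> (a :: 'n multiindex \<Rightarrow> complex) \<alpha>\<^sub>0 g.
      0 < \<epsilon> \<longrightarrow> \<epsilon> \<le> 1 \<longrightarrow> R < pi / \<epsilon> \<longrightarrow> mi_size \<alpha>\<^sub>0 \<le> m \<longrightarrow> a \<alpha>\<^sub>0 \<noteq> 0 \<longrightarrow>
      smooth_on UNIV g \<longrightarrow> (\<forall>x. x \<notin> cube R \<longrightarrow> g x = 0) \<longrightarrow>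
      (\<exists>u. smooth_on UNIV u \<and>
        (\<forall>x. (\<forall>i. \<bar>x $ i\<bar> < pi / \<epsilon>) \<longrightarrow>
           (\<Sum>\<alpha> | mi_size \<alpha> \<le> m. a \<alpha> * ((- \<i>) ^ mi_size \<alpha> * mi_deriv \<alpha> u x)) = g x) \<and>
        (\<forall>is G. (\<forall>js x. length js \<le> L (length is) \<longrightarrow> norm (foldr partial js g x) \<le> G) \<longrightarrow>
           (\<forall>x. norm (foldr partial is u x) \<le> C (length is) * G / (norm (a \<alpha>\<^sub>0) * \<epsilon> ^ E (length is)))))"
    using solve_on_cube[OF g(2), of m, where 'n = 'n] by (elim exE)
  \<comment> \<open>The values of \<epsilon> at which the cube construction applies. They include
    all small ones; for the others the zero function is taken, since the net has to be smooth for
    every \<epsilon> in \<open>{0<..1}\<close>.\<close>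
  define good where "good \<epsilon> \<longleftrightarrow> \<epsilon> \<in> {0<..1} \<and> R < pi / \<epsilon> \<and> (\<exists>\<alpha>. mi_size \<alpha> \<le> m \<and> \<epsilon> powr N' \<le> norm (a \<alpha> \<epsilon>))" for \<epsilon>
  have far: "\<forall>\<^sub>F \<epsilon> in at_right 0. \<epsilon> \<in> {0<..1} \<and> R' < pi / \<epsilon>" for R'
  proof -
    have "0 < pi / (\<bar>R'\<bar> + 1)" by (simp add: add_nonneg_pos)
    from eventually_small[OF this] show ?thesis
    proof eventually_elim
      case (elim \<epsilon>)
      then have "\<epsilon> * (\<bar>R'\<bar> + 1) < pi" by (simp add: pos_less_divide_eq add_nonneg_pos)
      then have "\<bar>R'\<bar> + 1 < pi / \<epsilon>" using elim by (simp add: pos_less_divide_eq mult.commute)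
      then show ?case using elim by auto
    qed
  qed
  have ev_good: "\<forall>\<^sub>F \<epsilon> in at_right 0. good \<epsilon>"
    using large far[of R] by eventually_elim (simp add: good_def)
  \<comment> \<open>Absolute values make the numerator nonnegative, so that the modulus of the large
    coefficient in the denominator may be replaced by \<open>\<epsilon> powr N'\<close>. The index,
    which varies with \<epsilon>, thereby disappears from the bound.\<close>
  have "\<forall>\<epsilon>. \<exists>u. smooth_on UNIV u \<and> (good \<epsilon> \<longrightarrow>
      (\<forall>x. (\<forall>i. \<bar>x $ i\<bar> < pi / \<epsilon>) \<longrightarrow>
           (\<Sum>\<alpha> | mi_size \<alpha> \<le> m. a \<alpha> \<epsilon> * ((- \<i>) ^ mi_size \<alpha> * mi_deriv \<alpha> u x)) = g \<epsilon> x) \<and>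
      (\<forall>is G. (\<forall>js x. length js \<le> L (length is) \<longrightarrow> norm (foldr partial js (g \<epsilon>) x) \<le> G) \<longrightarrow>
           (\<forall>x. norm (foldr partial is u x) \<le> \<bar>C (length is)\<bar> * \<bar>G\<bar> / (\<epsilon> powr N' * \<epsilon> ^ E (length is)))))"
  proof
    fix \<epsilon>
    show "\<exists>u. smooth_on UNIV u \<and> (good \<epsilon> \<longrightarrow>
      (\<forall>x. (\<forall>i. \<bar>x $ i\<bar> < pi / \<epsilon>) \<longrightarrow>
           (\<Sum>\<alpha> | mi_size \<alpha> \<le> m. a \<alpha> \<epsilon> * ((- \<i>) ^ mi_size \<alpha> * mi_deriv \<alpha> u x)) = g \<epsilon> x) \<and>
      (\<forall>is G. (\<forall>js x. length js \<le> L (length is) \<longrightarrow> norm (foldr partial js (g \<epsilon>) x) \<le> G) \<longrightarrow>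
           (\<forall>x. norm (foldr partial is u x) \<le> \<bar>C (length is)\<bar> * \<bar>G\<bar> / (\<epsilon> powr N' * \<epsilon> ^ E (length is)))))"
    proof (cases "good \<epsilon>")
      case True
      then obtain \<alpha>\<^sub>0 where \<epsilon>: "0 < \<epsilon>" "\<epsilon> \<le> 1" "R < pi / \<epsilon>" and \<alpha>\<^sub>0: "mi_size \<alpha>\<^sub>0 \<le> m" "\<epsilon> powr N' \<le> norm (a \<alpha>\<^sub>0 \<epsilon>)"
        by (auto simp: good_def)
      have "0 < \<epsilon> powr N'" using \<epsilon> by simp
      then have a0: "a \<alpha>\<^sub>0 \<epsilon> \<noteq> 0" using \<alpha>\<^sub>0(2) by auto
      have sg: "smooth_on UNIV (g \<epsilon>)" using g(1) \<epsilon> by (simp add: smooth_net_def)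
      obtain u where u: "smooth_on UNIV u"
        "\<forall>x. (\<forall>i. \<bar>x $ i\<bar> < pi / \<epsilon>) \<longrightarrow>
           (\<Sum>\<alpha> | mi_size \<alpha> \<le> m. a \<alpha> \<epsilon> * ((- \<i>) ^ mi_size \<alpha> * mi_deriv \<alpha> u x)) = g \<epsilon> x"
        "\<forall>is G. (\<forall>js x. length js \<le> L (length is) \<longrightarrow> norm (foldr partial js (g \<epsilon>) x) \<le> G) \<longrightarrow>
           (\<forall>x. norm (foldr partial is u x) \<le> C (length is) * G / (norm (a \<alpha>\<^sub>0 \<epsilon>) * \<epsilon> ^ E (length is)))"
        using solve[rule_format, of \<epsilon> \<alpha>\<^sub>0 "\<lambda>\<alpha>. a \<alpha> \<epsilon>" "g \<epsilon>"] \<epsilon> \<alpha>\<^sub>0(1) a0 sg g(3) by blast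
      have "C l * G / (norm (a \<alpha>\<^sub>0 \<epsilon>) * \<epsilon> ^ E l) \<le> \<bar>C l\<bar> * \<bar>G\<bar> / (\<epsilon> powr N' * \<epsilon> ^ E l)" for l G
      proof (rule frac_le)
        show "C l * G \<le> \<bar>C l\<bar> * \<bar>G\<bar>" unfolding abs_mult[symmetric] by (rule abs_ge_self)
        show "\<epsilon> powr N' * \<epsilon> ^ E l \<le> norm (a \<alpha>\<^sub>0 \<epsilon>) * \<epsilon> ^ E l"
          using \<epsilon> \<alpha>\<^sub>0(2) by (intro mult_right_mono) auto
      qed (use \<epsilon> in auto)
      with u(3) have "\<forall>is G. (\<forall>js x. length js \<le> L (length is) \<longrightarrow> norm (foldr partial js (g \<epsilon>) x) \<le> G) \<longrightarrow>
           (\<forall>x. norm (foldr partial is u x) \<le> \<bar>C (length is)\<bar> * \<bar>G\<bar> / (\<epsilon> powr N' * \<epsilon> ^ E (length is)))"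
        by (meson order_trans)
      with u(1,2) show ?thesis by blast
    next
      case False
      then show ?thesis by (intro exI[of _ "\<lambda>_. 0"]) simp
    qed
  qed
  from choice[OF this] obtain u where u': "\<forall>\<epsilon>. smooth_on UNIV (u \<epsilon>) \<and> (good \<epsilon> \<longrightarrow>
      (\<forall>x. (\<forall>i. \<bar>x $ i\<bar> < pi / \<epsilon>) \<longrightarrow>
           (\<Sum>\<alpha> | mi_size \<alpha> \<le> m. a \<alpha> \<epsilon> * ((- \<i>) ^ mi_size \<alpha> * mi_deriv \<alpha> (u \<epsilon>) x)) = g \<epsilon> x) \<and>
      (\<forall>is G. (\<forall>js x. length js \<le> L (length is) \<longrightarrow> norm (foldr partial js (g \<epsilon>) x) \<le> G) \<longrightarrow>
           (\<forall>x. norm (foldr partial is (u \<epsilon>) x) \<le> \<bar>C (length is)\<bar> * \<bar>G\<bar> / (\<epsilon> powr N' * \<epsilon> ^ E (length is)))))"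
    by (elim exE)
  then have su: "\<And>\<epsilon>. smooth_on UNIV (u \<epsilon>)"
    and eq: "\<And>\<epsilon> x. good \<epsilon> \<Longrightarrow> (\<forall>i. \<bar>x $ i\<bar> < pi / \<epsilon>) \<Longrightarrow> diff_op_net m a u \<epsilon> x = g \<epsilon> x"
    and bound: "\<And>\<epsilon> is G x. good \<epsilon> \<Longrightarrow> (\<forall>js x. length js \<le> L (length is) \<longrightarrow> norm (foldr partial js (g \<epsilon>) x) \<le> G) \<Longrightarrow>
        norm (foldr partial is (u \<epsilon>) x) \<le> \<bar>C (length is)\<bar> * \<bar>G\<bar> / (\<epsilon> powr N' * \<epsilon> ^ E (length is))"
    unfolding diff_op_net_def by blast+
  have su\<Omega>: "smooth_net \<Omega> u" using smooth_on_subset[OF su] by (auto simp: smooth_net_def)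
  have mu: "u \<in> carrier (moderate_nets \<Omega>)"
    unfolding carrier_moderate_nets[OF \<Omega>] moderate_on_def
  proof (intro conjI allI impI su\<Omega>)
    fix K and "is" :: "'n list"
    define l where "l = length is"
    obtain B r where Br: "0 < B"
      "\<forall>\<^sub>F \<epsilon> in at_right 0. \<forall>js x. length js \<le> L l \<longrightarrow> norm (foldr partial js (g \<epsilon>) x) \<le> B * \<epsilon> powr r"
      using uniform_derivative_bound[OF g(4), of "L l"] by blast
    \<comment> \<open>\<open>r\<close> stems from the derivatives of \<open>g\<close>,
      \<open>- N'\<close> from the large coefficient in the denominator, and
      \<open>- real (E l)\<close> from the lattice spacing.\<close>
    have "grows (r - N' - real (E l)) K (\<lambda>\<epsilon>. foldr partial is (u \<epsilon>))"
    proof (rule growsI)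
      show "\<forall>\<^sub>F \<epsilon> in at_right 0. \<forall>x\<in>K. norm (foldr partial is (u \<epsilon>) x) \<le> (\<bar>C l\<bar> * B) * \<epsilon> powr (r - N' - real (E l))"
        using Br(2) ev_good
      proof eventually_elim
        case (elim \<epsilon>)
        have \<epsilon>: "0 < \<epsilon>" using elim(2) by (simp add: good_def)
        have "norm (foldr partial is (u \<epsilon>) x) \<le> \<bar>C l\<bar> * \<bar>B * \<epsilon> powr r\<bar> / (\<epsilon> powr N' * \<epsilon> ^ E l)" for x
          unfolding l_def by (rule bound[OF elim(2)]) (use elim(1) in \<open>simp add: l_def\<close>)
        also have "\<bar>C l\<bar> * \<bar>B * \<epsilon> powr r\<bar> / (\<epsilon> powr N' * \<epsilon> ^ E l) = (\<bar>C l\<bar> * B) * \<epsilon> powr (r - N' - real (E l))"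
          using \<epsilon> Br(1) by (simp add: powr_diff powr_realpow abs_mult)
        finally show ?case by blast
      qed
    qed
    then show "\<exists>r. grows r K (\<lambda>\<epsilon>. foldr partial is (u \<epsilon>))" by blast
  qed
  have "(\<lambda>\<epsilon> x. diff_op_net m a u \<epsilon> x + - 1 * g \<epsilon> x) \<in> negligible_nets \<Omega>"
    unfolding mem_negligible_nets[OF \<Omega>] negligible_on_def
  proof (intro conjI allI impI)
    have "smooth_net \<Omega> g" using g(1) smooth_on_subset[OF _ subset_UNIV] unfolding smooth_net_def by blast
    then show "smooth_net \<Omega> (\<lambda>\<epsilon> x. diff_op_net m a u \<epsilon> x + - 1 * g \<epsilon> x)"
      by (intro smooth_net_add \<Omega> smooth_net_diff_op_net su\<Omega> smooth_net_mult smooth_net_const)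
    fix K and "is" :: "'n list" and r assume K: "compact K" "K \<subseteq> \<Omega>"
    obtain R' where R': "\<And>x. x \<in> K \<Longrightarrow> norm x \<le> R'"
      using compact_imp_bounded[OF K(1)] unfolding bounded_iff by blast
    show "grows r K (\<lambda>\<epsilon>. foldr partial is (\<lambda>x. diff_op_net m a u \<epsilon> x + - 1 * g \<epsilon> x))"
    proof (rule growsI)
      \<comment> \<open>The constant is 0 because, once the open cube contains \<open>K\<close>, the
        equation holds exactly on a neighbourhood of it, so all derivatives of the difference vanish
        on \<open>K\<close>.\<close>
      show "\<forall>\<^sub>F \<epsilon> in at_right 0. \<forall>x\<in>K.
        norm (foldr partial is (\<lambda>x. diff_op_net m a u \<epsilon> x + - 1 * g \<epsilon> x) x) \<le> 0 * \<epsilon> powr r"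
        using ev_good far[of R']
      proof eventually_elim
        case (elim \<epsilon>)
        define Q where "Q = box (vec (- (pi / \<epsilon>))) (vec (pi / \<epsilon>) :: real ^ 'n)"
        have oQ: "open Q" unfolding Q_def by (rule open_box)
        have Q: "x \<in> Q \<longleftrightarrow> (\<forall>i. \<bar>x $ i\<bar> < pi / \<epsilon>)" for x by (auto simp: Q_def mem_box_cart abs_less_iff minus_less_iff)
        have "foldr partial is (\<lambda>x. diff_op_net m a u \<epsilon> x + - 1 * g \<epsilon> x) x = 0" if x: "x \<in> K" for x
        proof -
          have "\<bar>x $ i\<bar> < pi / \<epsilon>" for i using component_le_norm_cart[of x i] R'[OF x] elim(2) by linarith
          then have "x \<in> Q" by (simp add: Q)
          then have "foldr partial is (\<lambda>x. diff_op_net m a u \<epsilon> x + - 1 * g \<epsilon> x) x = foldr partial is (\<lambda>_. 0) x"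
            by (intro foldr_partial_cong[OF oQ]) (auto simp: Q eq[OF elim(1)])
          then show ?thesis by (simp add: foldr_partial_const split: if_splits)
        qed
        then show ?case by simp
      qed
    qed
  qed
  then have "net_class \<Omega> (diff_op_net m a u) = net_class \<Omega> g" by (intro net_class_eqI[OF \<Omega>]) simp
  moreover have "diff_op \<Omega> m A (net_class \<Omega> u) = net_class \<Omega> (diff_op_net m a u)"
    by (rule diff_op_net_class) (use \<Omega> A a mu in auto)
  ultimately show ?thesis using g(5) mu by (intro bexI[of _ "net_class \<Omega> u"]) (auto simp: carrier_colombeau)
qed

text \<open>Solvability yields invertibility at the origin, while the converse starts from an
  arbitrary point. Together they show that invertibility at one point implies invertibility at
  0.\<close>

theorem corollary7p9:
  fixes \<Omega> :: "(real ^ 'n) set"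
    and m :: nat
    and A :: "'n multiindex \<Rightarrow> (real \<Rightarrow> complex) set"
  assumes "open \<Omega>" and "\<Omega> \<noteq> {}"
    and "\<And>\<alpha>. mi_size \<alpha> \<le> m \<Longrightarrow> A \<alpha> \<in> carrier gen_numbers"
  shows "(\<forall>F\<in>colombeau_c \<Omega>. \<exists>U\<in>carrier (colombeau \<Omega>). diff_op \<Omega> m A U = F) \<longleftrightarrow>
         (\<exists>\<xi>\<^sub>0. point_value (weight_sq m A) \<xi>\<^sub>0 \<in> Units gen_numbers)"
proof
  assume "\<forall>F\<in>colombeau_c \<Omega>. \<exists>U\<in>carrier (colombeau \<Omega>). diff_op \<Omega> m A U = F"
  then have "point_value (weight_sq m A) 0 \<in> Units gen_numbers"
    by (intro solvable_imp_invertible[OF assms(1,2)]) (use assms(3) in auto)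
  then show "\<exists>\<xi>\<^sub>0. point_value (weight_sq m A) \<xi>\<^sub>0 \<in> Units gen_numbers" ..
next
  assume "\<exists>\<xi>\<^sub>0. point_value (weight_sq m A) \<xi>\<^sub>0 \<in> Units gen_numbers"
  then obtain \<xi>\<^sub>0 where "point_value (weight_sq m A) \<xi>\<^sub>0 \<in> Units gen_numbers" ..
  then show "\<forall>F\<in>colombeau_c \<Omega>. \<exists>U\<in>carrier (colombeau \<Omega>). diff_op \<Omega> m A U = F"
    by (intro ballI invertible_imp_solvable[OF assms(1)]) (use assms(3) in auto)
qed

end
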